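(* There are infinitely many pairs $(K_1,K_2)$ of nonisomorphic solvably equivalent number fields such that the Galois groups (over $\mathbf{Q}$) of the Galois closures associated with distinct pairs do not admit a common nontrivial quotient.
   Context: Subgroups $H_1,H_2$ of a finite group $G$ are solvably equivalent if there is a bijection between the set of solvable subgroups of $H_1$ and the set of solvable subgroups of $H_2$ that sends each subgroup to a $G$-conjugate of itself; equivalently, for every solvable $K\le G$, the right coset spaces $[H_1\backslash G]$ and $[H_2\backslash G]$ are isomorphic as $K$-sets. Number fields $K_1,K_2$ are solvably equivalent if they have a common Galois closure $L$ over $\mathbf{Q}$ and $\mathrm{Gal}(L/K_1)$, $\mathrm{Gal}(L/K_2)$ are solvably equivalent subgroups of $\mathrm{Gal}(L/\mathbf{Q})$; the Galois group associated with the pair is $\mathrm{Gal}(L/\mathbf{Q})$. *)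

theory Defs
  imports
    "HOL-Algebra.Algebra"
    "HOL-Algebra.Solvable_Groups"
    "HOL-Algebra.Algebraic_Closure_Type"
    "HOL.Complex"
begin

text \<open>Number fields are realised inside the complex numbers, as subfields \<open>K\<close> with \<open>[K : \<rat>]\<close>
  finite. Every number field embeds there, and isomorphism is tested on abstract rings, so this
  loses no isomorphism class. The advantage is that all composites and Galois closures live in one
  ambient field.\<close>

abbreviation \<CC> :: "complex ring"
  where "\<CC> \<equiv> ring_of_type_algebra"

definition number_field :: "complex set \<Rightarrow> bool"
  where "number_field K \<longleftrightarrow> subfield K \<CC> \<and> ring.finite_dimension \<CC> \<rat> K"

definition fields_isomorphic :: "complex set \<Rightarrow> complex set \<Rightarrow> bool"
  where "fields_isomorphic K L \<longleftrightarrow> \<CC>\<lparr>carrier := K\<rparr> \<simeq> \<CC>\<lparr>carrier := L\<rparr>"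

text \<open>As in \<^const>\<open>AutoGroup\<close>, automorphisms of \<open>L\<close> are taken extensional on \<open>L\<close> (via \<^const>\<open>Bij\<close>);
  otherwise one automorphism of \<open>L\<close> would be counted many times.\<close>

definition Gal :: "complex set \<Rightarrow> complex set \<Rightarrow> (complex \<Rightarrow> complex) monoid"
  where "Gal L F = BijGroup L
    \<lparr>carrier := {\<sigma> \<in> ring_iso (\<CC>\<lparr>carrier := L\<rparr>) (\<CC>\<lparr>carrier := L\<rparr>) \<inter> Bij L. \<forall>x\<in>F. \<sigma> x = x}\<rparr>"

definition galois_extension :: "complex set \<Rightarrow> complex set \<Rightarrow> bool"
  where "galois_extension F L \<longleftrightarrow>
    subfield F \<CC> \<and> subfield L \<CC> \<and> F \<subseteq> L \<and> ring.finite_dimension \<CC> F L \<and>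
    {x \<in> L. \<forall>\<sigma>\<in>carrier (Gal L F). \<sigma> x = x} = F"

definition is_galois_closure :: "complex set \<Rightarrow> complex set \<Rightarrow> bool"
  where "is_galois_closure K L \<longleftrightarrow>
    galois_extension \<rat> L \<and> K \<subseteq> L \<and> (\<forall>M. galois_extension \<rat> M \<and> K \<subseteq> M \<longrightarrow> L \<subseteq> M)"

definition solvable_subgroups :: "('a, 'b) monoid_scheme \<Rightarrow> 'a set \<Rightarrow> 'a set set"
  where "solvable_subgroups G H =
    {K. subgroup K (G\<lparr>carrier := H\<rparr>) \<and> solvable (G\<lparr>carrier := K\<rparr>)}"

definition solvably_equivalent_subgroups ::
    "('a, 'b) monoid_scheme \<Rightarrow> 'a set \<Rightarrow> 'a set \<Rightarrow> bool"
  where "solvably_equivalent_subgroups G H\<^sub>1 H\<^sub>2 \<longleftrightarrow>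
    group G \<and> finite (carrier G) \<and> subgroup H\<^sub>1 G \<and> subgroup H\<^sub>2 G \<and>
    (\<exists>\<phi>. bij_betw \<phi> (solvable_subgroups G H\<^sub>1) (solvable_subgroups G H\<^sub>2) \<and>
         (\<forall>K \<in> solvable_subgroups G H\<^sub>1. \<exists>g \<in> carrier G. \<phi> K = g <#\<^bsub>G\<^esub> K #>\<^bsub>G\<^esub> inv\<^bsub>G\<^esub> g))"

definition solvably_equivalent_fields :: "complex set \<Rightarrow> complex set \<Rightarrow> bool"
  where "solvably_equivalent_fields K\<^sub>1 K\<^sub>2 \<longleftrightarrow>
    number_field K\<^sub>1 \<and> number_field K\<^sub>2 \<and>
    (\<exists>L. is_galois_closure K\<^sub>1 L \<and> is_galois_closure K\<^sub>2 L \<and>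
         solvably_equivalent_subgroups (Gal L \<rat>) (carrier (Gal L K\<^sub>1)) (carrier (Gal L K\<^sub>2)))"

definition common_nontrivial_quotient ::
    "('a, 'c) monoid_scheme \<Rightarrow> ('b, 'd) monoid_scheme \<Rightarrow> bool"
  where "common_nontrivial_quotient G H \<longleftrightarrow>
    (\<exists>M N. M \<lhd> G \<and> N \<lhd> H \<and> G Mod M \<cong> H Mod N \<and> carrier (G Mod M) \<noteq> {\<one>\<^bsub>G Mod M\<^esub>})"

lemma subgroup_Gal_BijGroup:
  assumes "subfield L \<CC>" "F \<subseteq> L"
  shows "subgroup (carrier (Gal L F)) (BijGroup L)"
proof -
  interpret B: group "BijGroup L" by (rule group_BijGroup)
  let ?R = "\<CC>\<lparr>carrier := L\<rparr>"
  have R: "ring ?R"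
    using ring.subring_is_ring[OF ring_from_type_algebra subfieldE(1)[OF assms(1)]] .
  note closed = ring.ring_simprules(1,5,6)[OF R, simplified]
  have iso_restrict: "restrict h L \<in> ring_iso ?R ?R" if h: "h \<in> ring_iso ?R ?R" for h
  proof -
    have "bij_betw (restrict h L) L L"
      using h bij_betw_cong[of L "restrict h L" h L] by (simp add: ring_iso_def)
    then show ?thesis
      using h closed by (auto simp: ring_iso_def ring_hom_def)
  qed
  have inv_eq: "inv\<^bsub>BijGroup L\<^esub> \<sigma> = restrict (inv_into L \<sigma>) L" if "\<sigma> \<in> Bij L" for \<sigma>
    using inv_BijGroup[OF that] .
  show ?thesis
  proof (rule B.subgroupI)
    show "carrier (Gal L F) \<subseteq> carrier (BijGroup L)"
      by (auto simp: Gal_def BijGroup_def)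
    have "(\<lambda>x\<in>L. x) \<in> carrier (Gal L F)"
      using assms(2) id_Bij[of L] closed
      by (auto simp: Gal_def ring_iso_def Bij_def intro!: ring_hom_memI)
    then show "carrier (Gal L F) \<noteq> {}" by blast
  next
    fix \<sigma> assume s: "\<sigma> \<in> carrier (Gal L F)"
    then have iso: "\<sigma> \<in> ring_iso ?R ?R" and b: "\<sigma> \<in> Bij L" and fx: "\<forall>x\<in>F. \<sigma> x = x"
      by (auto simp: Gal_def)
    have inj: "inj_on \<sigma> L" using b by (simp add: Bij_def bij_betw_def)
    have "inv_into L \<sigma> \<in> ring_iso ?R ?R"
      using ring_iso_set_sym[OF R iso] by simp
    then have "restrict (inv_into L \<sigma>) L \<in> ring_iso ?R ?R"
      by (rule iso_restrict)
    moreover have "\<forall>x\<in>F. restrict (inv_into L \<sigma>) L x = x"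
      using fx assms(2) inv_into_f_f[OF inj] by (metis restrict_apply subsetD)
    ultimately show "inv\<^bsub>BijGroup L\<^esub> \<sigma> \<in> carrier (Gal L F)"
      using restrict_inv_into_Bij[OF b] inv_eq[OF b] by (simp add: Gal_def)
  next
    fix \<sigma> \<tau> assume s: "\<sigma> \<in> carrier (Gal L F)" and t: "\<tau> \<in> carrier (Gal L F)"
    have b: "\<sigma> \<in> Bij L" "\<tau> \<in> Bij L" using s t by (auto simp: Gal_def)
    have "\<sigma> \<circ> \<tau> \<in> ring_iso ?R ?R"
      using ring_iso_set_trans s t by (auto simp: Gal_def)
    then have "compose L \<sigma> \<tau> \<in> ring_iso ?R ?R"
      using iso_restrict[of "\<sigma> \<circ> \<tau>"] by (simp add: compose_def comp_def)
    moreover have "\<forall>x\<in>F. compose L \<sigma> \<tau> x = x"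
      using s t assms(2) by (auto simp: Gal_def compose_def)
    ultimately show "\<sigma> \<otimes>\<^bsub>BijGroup L\<^esub> \<tau> \<in> carrier (Gal L F)"
      using b compose_Bij[OF b] by (simp add: Gal_def BijGroup_def)
  qed
qed

lemma group_Gal:
  assumes "subfield L \<CC>" "F \<subseteq> L"
  shows "group (Gal L F)"
  using subgroup.subgroup_is_group[OF subgroup_Gal_BijGroup[OF assms] group_BijGroup]
  by (simp add: Gal_def)

end

theory Submission
  imports Defs "HOL-Computational_Algebra.Computational_Algebra" "Jordan_Normal_Form.Char_Poly"
begin

text \<open>The Galois groups are the alternating groups \<open>A\<^sub>n\<close> with \<open>n = p\<^sup>2\<close>, \<open>p\<close> a large prime. They are simple of
  distinct orders, so no two of them have a common nontrivial quotient.

  Let \<open>H\<close> be an unsolvable group, say \<open>A\<^sub>5\<close>, with \<open>m\<close> left cosets of solvable subgroups. Consider the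
  injective words of length \<open>m\<close> in these cosets and in labels that are used in the order \<open>0, 1, \<dots>\<close> without
  gaps. \<open>H\<close> acts on the words with an even and on those with an odd number of labels. A solvable
  subgroup \<open>K\<close> fixes the coset \<open>K\<close>, and trading it with the last label (or introducing a new label) is a
  \<open>K\<close>-equivariant bijection of the two sets of words. But \<open>H\<close> fixes only words consisting of \<open>m\<close> labels,
  which all lie on one side. Hence \<open>H\<close> embeds in two ways into \<open>A\<^sub>n\<close>, for all large \<open>n\<close>, such that the
  restrictions to each solvable subgroup are conjugate but the images are not. The fixed fields of the
  images are solvably equivalent and nonisomorphic.

  To realise \<open>A\<^sub>n\<close>, take \<open>f = x\<^sup>n - N x\<^sup>n\<^sup>-\<^sup>1 + M x\<^sup>n\<^sup>-\<^sup>2 + c\<close> with \<open>f' = n x\<^sup>n\<^sup>-\<^sup>3 (x - \<beta>)\<^sup>2\<close>. As \<open>n\<close> is a square and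
  \<open>(n - 1) / 2\<close> is even, the discriminant of \<open>f\<close> is a square. If 2 divides \<open>c\<close> exactly once, an inertia group
  at 2 fixes one root and is transitive on the others; if \<open>p\<close> divides \<open>c\<close> exactly once, \<open>f\<close> has no rational
  root, so the Galois group is doubly transitive. If a prime \<open>q\<close> divides \<open>f(\<beta>)\<close> exactly once, then an
  inertia group at \<open>q\<close> permutes the three roots congruent to \<open>\<beta>\<close> transitively and fixes the others, which
  gives a 3-cycle.\<close>

subsection \<open>Alternating groups\<close>

text \<open>Simplicity has a second use: every proper subgroup is core-free, so both fixed fields
  have the full splitting field as Galois closure, as solvable equivalence of fields demands. That n
  is p^2 also excludes rational roots: the two middle coefficients are multiples of n, so such a
  root would be divisible by p and force p^2 to divide c. All conditions on c are congruences modulo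
  4, p^2 and q^2, with q chosen after p. Ramification is handled without factoring ideals: one prime
  P above q suffices, together with the fact that an element of P fixed by inertia becomes a
  multiple of q after multiplication by some element outside P. Two inertia orbits in one residue
  class would then yield q^2 where q divides only once. The length m of the words equals the number
  of cosets so that a word missing the fixed coset must contain a label to trade. The two images of
  H are told apart by their numbers of moved points, which conjugation preserves.\<close>

lemma three_cycle_rotate: "distinct [a, b, c] \<Longrightarrow> cycle_of_list [b, c, a] = cycle_of_list [a, b, c]"
  by (rule ext) (auto simp: transpose_def)

lemma three_cycle_square:
  "distinct [a, b, c] \<Longrightarrow> cycle_of_list [a, b, c] \<circ> cycle_of_list [a, b, c] = cycle_of_list [a, c, b]"
  by (rule ext) (auto simp: transpose_def)

lemma three_cycle_comp_reverse:
  "distinct [r, s, x, y] \<Longrightarrow>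
    cycle_of_list [s, x, y] \<circ> cycle_of_list [r, y, x] = cycle_of_list [r, s, x]"
  by (rule ext) (auto simp: transpose_def)

lemma three_cycle_in_alt_group:
  assumes "distinct [a, b, c]" "{a, b, c} \<subseteq> {1..n}"
  shows "cycle_of_list [a, b, c] \<in> carrier (alt_group n)"
proof -
  have "cycle_of_list [a, b, c] \<in> three_cycles n"
    using assms by (intro CollectI exI[of _ "[a, b, c]"]) auto
  then show ?thesis using three_cycles_incl by blast
qed

lemma obtain_outside:
  fixes xs :: "nat list"
  assumes "length xs < n"
  obtains x where "x \<in> {1..n}" "x \<notin> set xs"
proof -
  have "card (set xs) < card {1..n}"
    using card_length[of xs] assms by simp
  then have "\<not> {1..n} \<subseteq> set xs"
    using card_mono[of "set xs" "{1..n}"] by auto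
  then show thesis using that by blast
qed

lemma alt_group_conj:
  assumes "subgroup H (alt_group n)" "h \<in> H" "k \<in> H"
  shows "h \<circ> k \<circ> inv' h \<in> H"
proof -
  interpret group "alt_group n" by (rule alt_group_is_group)
  have "h \<in> carrier (alt_group n)" using assms subgroup.subset by blast
  then have "inv' h \<in> H"
    using subgroup.m_inv_closed[OF assms(1,2)] by (simp add: alt_group_inv_equality)
  then show ?thesis
    using assms subgroup.m_closed[OF assms(1)] by (simp add: alt_group_mult)
qed

lemma alt_group_bij: "h \<in> carrier (alt_group n) \<Longrightarrow> bij h"
  using permutes_bij by (auto simp: alt_group_carrier)

text \<open>Conjugation inside H exchanges the uncontrolled third point c for any other point, so H
  contains all 3-cycles, and these generate the alternating group.\<close>

lemma eq_alt_groupI_pairs: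
  assumes H: "subgroup H (alt_group n)"
    and pairs: "\<And>a b. \<lbrakk>a \<in> {1..n}; b \<in> {1..n}; a \<noteq> b\<rbrakk> \<Longrightarrow>
      \<exists>c. c \<notin> {a, b} \<and> cycle_of_list [a, b, c] \<in> H"
  shows "H = carrier (alt_group n)"
proof
  interpret group "alt_group n" by (rule alt_group_is_group)
  show sub: "H \<subseteq> carrier (alt_group n)" using H subgroup.subset by blast
  define T where "T a b c \<longleftrightarrow> distinct [a, b, c] \<and> cycle_of_list [a, b, c] \<in> H" for a b c
  have comp: "h \<circ> k \<in> H" if "h \<in> H" "k \<in> H" for h k
    using subgroup.m_closed[OF H that] by (simp add: alt_group_mult)
  have rot: "T b c a" if "T a b c" for a b c
    using that three_cycle_rotate[of a b c] by (auto simp: T_def)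
  have swap: "T a c b" if "T a b c" for a b c
    using that three_cycle_square[of a b c] comp[of "cycle_of_list [a, b, c]" "cycle_of_list [a, b, c]"]
    by (auto simp: T_def)
  have conj: "T (h a) (h b) (h c)" if "h \<in> H" "T a b c" for h a b c
  proof -
    have "bij h" using that sub alt_group_bij by blast
    then show ?thesis
      using alt_group_conj[OF H that(1), of "cycle_of_list [a, b, c]"] that(2)
        conjugation_of_cycle[of "[a, b, c]" h] bij_is_inj[of h]
      by (auto simp: T_def inj_eq)
  qed
  have cyc: "cycle_of_list [a, b, c] a = b" "cycle_of_list [a, b, c] b = c"
      "cycle_of_list [a, b, c] c = a" if "distinct [a, b, c]" for a b c :: nat
    using that by (auto simp: transpose_def)
  have cyc_fix: "cycle_of_list [a, b, c] d = d" if "d \<notin> {a, b, c}" for a b c d :: nat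
    using that id_outside_supp[of d "[a, b, c]"] by auto
  \<comment> \<open>Conjugating (x y w) by (x y z) sends x to y and y to z and fixes w.\<close>
  have share2: "T y z w" if "T x y z" "T x y w" "z \<noteq> w" for x y z w
  proof -
    have d: "distinct [x, y, z]" "w \<notin> {x, y, z}" using that by (auto simp: T_def)
    have "cycle_of_list [x, y, z] \<in> H" using that(1) by (simp only: T_def)
    from conj[OF this that(2)] show ?thesis
      unfolding cyc[OF d(1)] cyc_fix[OF d(2)] .
  qed
  have tri: "T a b c" if abc: "distinct [a, b, c]" "{a, b, c} \<subseteq> {1..n}" for a b c
  proof -
    have ex: "\<exists>z. T x y z" if xy: "x \<in> {1..n}" "y \<in> {1..n}" "x \<noteq> y" for x y
    proof -
      obtain z where "z \<notin> {x, y}" "cycle_of_list [x, y, z] \<in> H" using pairs[OF xy] by blast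
      then show ?thesis using xy unfolding T_def by (intro exI[of _ z] conjI) auto
    qed
    obtain z where z: "T a b z" using ex[of a b] abc by auto
    obtain w where w: "T a c w" using ex[of a c] abc by auto
    \<comment> \<open>The completions z of (a, b) and w of (a, c) may coincide with each other or
      hit the prescribed point; only the last case has five distinct points.\<close>
    consider "z = c" | "w = b" | "w = z" "z \<noteq> c" | "distinct [a, b, c, z, w]"
      using abc z w by (auto simp: T_def)
    then show ?thesis
    proof cases
      case 1 then show ?thesis using z by simp
    next
      case 2 then show ?thesis using w swap by simp
    next
      case 3
      have "T z a b" "T z a c" using z w 3 rot by blast+
      moreover have "b \<noteq> c" using abc by simp
      ultimately show ?thesis by (rule share2)
    next
      case 4
      \<comment> \<open>Conjugation by (a c w) turns (a b z) into (c b z); two 3-cycles sharing b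
        and z then yield (b a c).\<close>
      have "cycle_of_list [a, c, w] \<in> H" using w by (simp only: T_def)
      from conj[OF this z] have "T c b z"
        using 4 cyc[of a c w] cyc_fix[of b a c w] cyc_fix[of z a c w] by auto
      then have "T b z c" "T b z a" using z rot by blast+
      have "T z b a" "T z b c" using \<open>T b z c\<close> \<open>T b z a\<close> rot swap by blast+
      moreover have "a \<noteq> c" using abc by simp
      ultimately have "T b a c" by (rule share2)
      then show ?thesis using rot swap by blast
    qed
  qed
  have "three_cycles n \<subseteq> H"
  proof
    fix p assume "p \<in> three_cycles n"
    then obtain cs where cs: "p = cycle_of_list cs" "distinct cs" "length cs = 3" "set cs \<subseteq> {1..n}"
      by auto
    obtain a b c where abc: "cs = [a, b, c]" using stupid_lemma[OF cs(3)] by blast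
    then show "p \<in> H" using tri[of a b c] cs by (simp only: T_def) auto
  qed
  then have "generate (alt_group n) (three_cycles n) \<subseteq> H"
    using generate_subgroup_incl[OF _ H] by blast
  then show "carrier (alt_group n) \<subseteq> H" using alt_group_carrier_as_three_cycles by simp
qed

text \<open>Conjugating the one given 3-cycle by an element that takes u, v to a, b gives a 3-cycle
  through the pair a, b.\<close>

lemma eq_alt_groupI_two_transitive:
  assumes H: "subgroup H (alt_group n)"
    and trans: "\<And>a b a' b'. \<lbrakk>a \<in> {1..n}; b \<in> {1..n}; a \<noteq> b; a' \<in> {1..n}; b' \<in> {1..n}; a' \<noteq> b'\<rbrakk>
      \<Longrightarrow> \<exists>h\<in>H. h a = a' \<and> h b = b'"
    and cyc: "distinct [u, v, w]" "{u, v, w} \<subseteq> {1..n}" "cycle_of_list [u, v, w] \<in> H"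
  shows "H = carrier (alt_group n)"
proof (rule eq_alt_groupI_pairs[OF H])
  fix a b assume ab: "a \<in> {1..n}" "b \<in> {1..n}" "a \<noteq> b"
  obtain h where h: "h \<in> H" "h u = a" "h v = b" using trans[of u v a b] ab cyc by auto
  have "bij h" using alt_group_bij h(1) subgroup.subset[OF H] by blast
  then have "cycle_of_list [a, b, h w] \<in> H" "h w \<notin> {a, b}"
    using alt_group_conj[OF H h(1) cyc(3)] conjugation_of_cycle[OF cyc(1), of h] h cyc(1)
      bij_is_inj[of h] by (auto simp: inj_eq)
  then show "\<exists>c. c \<notin> {a, b} \<and> cycle_of_list [a, b, c] \<in> H" by blast
qed

text \<open>A 3-cycle through a spare point moves x to y and fixes z, so parity is no obstruction:
  one such step moves \<open>a\<close> to \<open>a'\<close>, a second corrects the image of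
  \<open>b\<close> while fixing \<open>a'\<close>.\<close>

lemma alt_group_two_transitive:
  assumes n: "n \<ge> 5" and "a \<in> {1..n}" "b \<in> {1..n}" "a \<noteq> b" "a' \<in> {1..n}" "b' \<in> {1..n}" "a' \<noteq> b'"
  shows "\<exists>h\<in>carrier (alt_group n). h a = a' \<and> h b = b'"
proof -
  interpret group "alt_group n" by (rule alt_group_is_group)
  have step: "\<exists>h\<in>carrier (alt_group n). h x = y \<and> h z = z"
    if "x \<in> {1..n}" "y \<in> {1..n}" "z \<noteq> x" "z \<noteq> y" for x y z
  proof (cases "x = y")
    case True
    then show ?thesis using one_closed by (intro bexI[of _ id]) (auto simp: alt_group_one)
  next
    case False
    obtain u where u: "u \<in> {1..n}" "u \<notin> {x, y, z}" using obtain_outside[of "[x, y, z]" n] n by auto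
    have "cycle_of_list [x, y, u] \<in> carrier (alt_group n)"
      using that False u by (intro three_cycle_in_alt_group) auto
    moreover have "cycle_of_list [x, y, u] x = y" using False u by (auto simp: transpose_def)
    moreover have "cycle_of_list [x, y, u] z = z"
      using that u id_outside_supp[of z "[x, y, u]"] by auto
    ultimately show ?thesis by blast
  qed
  obtain z where z: "z \<in> {1..n}" "z \<notin> {a, a'}"
    using obtain_outside[of "[a, a']" n] n by auto
  obtain h where h: "h \<in> carrier (alt_group n)" "h a = a'" using step[of a a' z] z assms by auto
  have hb: "h b \<in> {1..n}" "h b \<noteq> a'"
    using h assms permutes_in_image[of h "{1..n}" b] permutes_inj[of h "{1..n}"]
    by (auto simp: alt_group_carrier inj_eq)
  obtain k where k: "k \<in> carrier (alt_group n)" "k (h b) = b'" "k a' = a'"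
    using step[of "h b" b' a'] hb assms by auto
  have "k \<circ> h \<in> carrier (alt_group n)" using m_closed[OF k(1) h(1)] by (simp add: alt_group_mult)
  then show ?thesis using h k by (intro bexI[of _ "k \<circ> h"]) auto
qed

section \<open>Normal subgroups of the alternating groups\<close>

lemma normal_alt_group_conj:
  assumes "N \<lhd> alt_group n" "g \<in> carrier (alt_group n)" "h \<in> N"
  shows "g \<circ> h \<circ> inv' g \<in> N"
  using normal.inv_op_closed2[OF assms] assms(2) by (simp add: alt_group_mult alt_group_inv_equality)

lemma normal_alt_group_commutator:
  assumes "N \<lhd> alt_group n" "h \<in> N" "g \<in> carrier (alt_group n)"
  shows "h \<circ> g \<circ> inv' h \<circ> inv' g \<in> N"
proof -
  interpret group "alt_group n" by (rule alt_group_is_group)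
  have N: "subgroup N (alt_group n)" using assms(1) normal_imp_subgroup by blast
  have h: "h \<in> carrier (alt_group n)" using assms(2) subgroup.subset[OF N] by blast
  have "g \<circ> inv' h \<circ> inv' g \<in> N"
    using normal_alt_group_conj[OF assms(1,3)] subgroup.m_inv_closed[OF N assms(2)] h
    by (simp add: alt_group_inv_equality)
  then show ?thesis
    using subgroup.m_closed[OF N assms(2)] by (simp add: alt_group_mult comp_assoc)
qed

lemma inv_three_cycle:
  assumes "distinct [a, b, c]" shows "inv' (cycle_of_list [a, b, c]) = cycle_of_list [a, c, b]"
  by (rule inv_unique_comp; rule ext) (use assms in \<open>auto simp: transpose_def\<close>)

lemma three_cycle_conj_commutator:
  assumes "bij h" "distinct [a, b, c]"
  shows "h \<circ> cycle_of_list [a, b, c] \<circ> inv' h \<circ> inv' (cycle_of_list [a, b, c]) =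
    cycle_of_list [h a, h b, h c] \<circ> cycle_of_list [a, c, b]"
  using conjugation_of_cycle[of "[a, b, c]" h] assms inv_three_cycle[OF assms(2)] by simp

text \<open>The commutator r of a nontrivial h in N with a 3-cycle lies in N and is a product of two
  3-cycles, so it moves at most six points. Two further points x, y, fixed by r, make the commutator
  of r with (m x y) collapse to a single 3-cycle of N. Two-transitivity spreads it to all pairs by
  conjugation.\<close>

theorem alt_group_normal_trivial:
  assumes n: "n \<ge> 9" and N: "N \<lhd> alt_group n" and nontriv: "N \<noteq> {id}"
  shows "N = carrier (alt_group n)"
proof -
  interpret group "alt_group n" by (rule alt_group_is_group)
  have NS: "subgroup N (alt_group n)" using N normal_imp_subgroup by blast
  have "id \<in> N" using subgroup.one_closed[OF NS] by (simp add: alt_group_one)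
  then obtain h where h: "h \<in> N" "h \<noteq> id" using nontriv by blast
  have perm: "p permutes {1..n}" if "p \<in> N" for p
    using that subgroup.subset[OF NS] by (auto simp: alt_group_carrier)
  have bij: "bij p" if "p \<in> N" for p using perm[OF that] permutes_bij by blast
  obtain a where a: "h a \<noteq> a" using h(2) by (metis eq_id_iff)
  then have a_in: "a \<in> {1..n}" using perm[OF h(1)] by (auto simp: permutes_def)
  obtain u where u: "u \<in> {1..n}" "u \<notin> {a, h a}"
    using obtain_outside[of "[a, h a]" n] n by auto
  obtain v where v: "v \<in> {1..n}" "v \<notin> {a, h a, u}" using obtain_outside[of "[a, h a, u]" n] n by auto
  have dist: "distinct [a, u, v]" using u v by auto
  let ?t = "cycle_of_list [a, u, v]"
  define r where "r = h \<circ> ?t \<circ> inv' h \<circ> inv' ?t"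
  have t: "?t \<in> carrier (alt_group n)"
    using a_in u v by (intro three_cycle_in_alt_group) auto
  have rN: "r \<in> N" unfolding r_def by (rule normal_alt_group_commutator[OF N h(1) t])
  have r_eq: "r = cycle_of_list [h a, h u, h v] \<circ> cycle_of_list [a, v, u]"
    unfolding r_def by (rule three_cycle_conj_commutator[OF bij[OF h(1)] dist])
  let ?F = "{a, u, v, h a, h u, h v}"
  have r_fix: "r x = x" if "x \<notin> ?F" for x
    using that id_outside_supp[of x "[h a, h u, h v]"] id_outside_supp[of x "[a, v, u]"]
    by (auto simp: r_eq)
  \<comment> \<open>The factor applied first, (a v u), fixes \<open>h a\<close> by the choice of u
    and v, and the other factor moves it; so r is not the identity.\<close>
  have r_ha: "r (h a) \<noteq> h a"
  proof -
    have "h a \<noteq> h u" "h a \<noteq> h v" "h u \<noteq> h v"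
      using dist bij_is_inj[OF bij[OF h(1)]] by (auto simp: inj_eq)
    then have "cycle_of_list [h a, h u, h v] (h a) \<noteq> h a" by (auto simp: transpose_def)
    moreover have "cycle_of_list [a, v, u] (h a) = h a"
      using a u v id_outside_supp[of "h a" "[a, v, u]"] by auto
    ultimately show ?thesis unfolding r_eq comp_def by metis
  qed
  let ?m = "h a" and ?w = "r (h a)"
  obtain x where x: "x \<in> {1..n}" "x \<notin> ?F"
    using obtain_outside[of "[a, u, v, h a, h u, h v]" n] n by auto
  obtain y where y: "y \<in> {1..n}" "y \<notin> insert x ?F"
    using obtain_outside[of "[x, a, u, v, h a, h u, h v]" n] n by auto
  have rx: "r x = x" "r y = y" using r_fix x y by auto
  have m: "?m \<in> {1..n}" using permutes_in_image[OF perm[OF h(1)]] a_in by simp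
  have w: "?w \<in> {1..n}" using permutes_in_image[OF perm[OF rN]] m by simp
  have wne: "?w \<noteq> x" "?w \<noteq> y"
    using rx x y bij_is_inj[OF bij[OF rN]] by (metis injD insertCI)+
  have d1: "distinct [?m, x, y]" using x y by auto
  have "r \<circ> cycle_of_list [?m, x, y] \<circ> inv' r \<circ> inv' (cycle_of_list [?m, x, y]) \<in> N"
    using x y m by (intro normal_alt_group_commutator[OF N rN] three_cycle_in_alt_group) auto
  also have "r \<circ> cycle_of_list [?m, x, y] \<circ> inv' r \<circ> inv' (cycle_of_list [?m, x, y]) =
      cycle_of_list [?w, x, y] \<circ> cycle_of_list [?m, y, x]"
    using three_cycle_conj_commutator[OF bij[OF rN] d1] rx by simp
  also have "\<dots> = cycle_of_list [?m, ?w, x]"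
    by (rule three_cycle_comp_reverse) (use d1 wne r_ha in auto)
  finally have cyc: "cycle_of_list [?m, ?w, x] \<in> N" .
  have d2: "distinct [?m, ?w, x]" using d1 wne r_ha by auto
  show ?thesis
  proof (rule eq_alt_groupI_pairs[OF NS])
    fix i j assume ij: "i \<in> {1..n}" "j \<in> {1..n}" "i \<noteq> j"
    obtain g where g: "g \<in> carrier (alt_group n)" "g ?m = i" "g ?w = j"
      using alt_group_two_transitive[of n ?m ?w i j] ij m w n r_ha by auto
    have "bij g" using alt_group_bij g(1) by blast
    then have "cycle_of_list [i, j, g x] \<in> N" "g x \<notin> {i, j}"
      using normal_alt_group_conj[OF N g(1) cyc] conjugation_of_cycle[OF d2, of g] g d2
        bij_is_inj[of g] by (auto simp: inj_eq)
    then show "\<exists>c. c \<notin> {i, j} \<and> cycle_of_list [i, j, c] \<in> N" by blast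
  qed
qed

subsection \<open>The sign of a permutation on difference products\<close>

definition index_pairs :: "nat \<Rightarrow> (nat \<times> nat) set"
  where "index_pairs n = {(i, j). 1 \<le> i \<and> i < j \<and> j \<le> n}"

definition difference_product :: "nat \<Rightarrow> (nat \<Rightarrow> complex) \<Rightarrow> complex"
  where "difference_product n x = (\<Prod>(i, j)\<in>index_pairs n. x j - x i)"

definition inversion_sign :: "nat \<Rightarrow> (nat \<Rightarrow> nat) \<Rightarrow> complex"
  where "inversion_sign n p = (\<Prod>(i, j)\<in>index_pairs n. if p i < p j then 1 else - 1)"

lemma finite_index_pairs [simp]: "finite (index_pairs n)"
  by (rule finite_subset[of _ "{1..n} \<times> {1..n}"]) (auto simp: index_pairs_def)

text \<open>\<open>f\<close> sends a pair to its sorted image pair and so permutes the increasing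
  pairs; each inversion contributes one sign.\<close>

lemma difference_product_comp:
  assumes p: "p permutes {1..n}"
  shows "difference_product n (x \<circ> p) = inversion_sign n p * difference_product n x"
proof -
  let ?P = "index_pairs n"
  define f where "f = (\<lambda>(i, j). (min (p i) (p j), max (p i) (p j)))"
  have inj: "p i = p j \<longleftrightarrow> i = j" for i j using permutes_inj[OF p] by (simp add: inj_eq)
  have im: "p i \<in> {1..n} \<longleftrightarrow> i \<in> {1..n}" for i using permutes_in_image[OF p] .
  have f_in: "f ij \<in> ?P" if "ij \<in> ?P" for ij
  proof -
    obtain i j where eq: "ij = (i, j)" by (cases ij)
    then have ij: "ij = (i, j)" "1 \<le> i" "i < j" "j \<le> n"
      using that by (auto simp: index_pairs_def)
    then show ?thesis using im[of i] im[of j] inj[of i j]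
      by (auto simp: index_pairs_def f_def min_def max_def)
  qed
  have "inj_on f ?P"
  proof (rule inj_onI)
    fix a b assume ab: "a \<in> ?P" "b \<in> ?P" "f a = f b"
    obtain i j where a: "a = (i, j)" "i < j" using ab by (auto simp: index_pairs_def)
    obtain k l where b: "b = (k, l)" "k < l" using ab by (auto simp: index_pairs_def)
    have "{p i, p j} = {p k, p l}"
      using ab(3) unfolding a b f_def by (auto simp: min_def max_def split: if_splits)
    then show "a = b" using a b by (auto simp: doubleton_eq_iff inj)
  qed
  then have bij: "bij_betw f ?P ?P"
    using f_in by (intro bij_betw_imageI endo_inj_surj) auto
  have "difference_product n (x \<circ> p) =
      (\<Prod>ij\<in>?P. (case ij of (i, j) \<Rightarrow> if p i < p j then 1 else - 1) *
        (case f ij of (i, j) \<Rightarrow> x j - x i))"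
    unfolding difference_product_def
    by (rule prod.cong) (auto simp: f_def index_pairs_def min_def max_def)
  also have "\<dots> = inversion_sign n p * (\<Prod>ij\<in>?P. case f ij of (i, j) \<Rightarrow> x j - x i)"
    by (simp add: prod.distrib inversion_sign_def)
  also have "(\<Prod>ij\<in>?P. case f ij of (i, j) \<Rightarrow> x j - x i) = difference_product n x"
    unfolding difference_product_def by (rule prod.reindex_bij_betw[OF bij])
  finally show ?thesis .
qed

lemma difference_product_nonzero:
  assumes "inj_on x {1..n}"
  shows "difference_product n x \<noteq> 0"
proof -
  have "x j - x i \<noteq> 0" if "(i, j) \<in> index_pairs n" for i j
    using that inj_onD[OF assms, of j i] by (auto simp: index_pairs_def)
  then show ?thesis by (auto simp: difference_product_def)
qed

text \<open>Multiplicativity is read off from the product of differences of the distinct numbers 1,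
  ..., n, which is nonzero and can be cancelled.\<close>

lemma inversion_sign_compose:
  assumes p: "p permutes {1..n}" and q: "q permutes {1..n}"
  shows "inversion_sign n (p \<circ> q) = inversion_sign n p * inversion_sign n q"
proof -
  let ?D = "difference_product n of_nat"
  have "inversion_sign n (p \<circ> q) * ?D = difference_product n (of_nat \<circ> p \<circ> q)"
    using difference_product_comp[OF permutes_compose[OF q p]] by (simp add: comp_assoc)
  also have "\<dots> = inversion_sign n q * (inversion_sign n p * ?D)"
    using difference_product_comp[OF q, of "of_nat \<circ> p"] difference_product_comp[OF p, of of_nat] by simp
  finally show ?thesis
    using difference_product_nonzero[of of_nat n] by (simp add: inj_on_def mult.commute)
qed

lemma inversion_sign_adjacent:
  assumes "1 \<le> k" "Suc k \<le> n"
  shows "inversion_sign n (transpose k (Suc k)) = - 1"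
proof -
  have "inversion_sign n (transpose k (Suc k)) =
      (\<Prod>ij\<in>index_pairs n. if ij = (k, Suc k) then - 1 else 1)"
    unfolding inversion_sign_def
    by (rule prod.cong) (auto simp: transpose_def index_pairs_def split: if_splits)
  also have "\<dots> = - 1"
    using assms by (subst prod.delta) (simp_all, simp add: index_pairs_def)
  finally show ?thesis .
qed

lemma inversion_sign_transpose:
  assumes "1 \<le> a" "a < b" "b \<le> n"
  shows "inversion_sign n (transpose a b) = - 1"
  using assms(2,3)
proof (induction b)
  case 0 then show ?case by simp
next
  case (Suc b)
  show ?case
  proof (cases "a = b")
    case True then show ?thesis using inversion_sign_adjacent assms Suc by simp
  next
    case False
    let ?t = "transpose b (Suc b)"
    have eq: "transpose a (Suc b) = ?t \<circ> (transpose a b \<circ> ?t)"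
      using Suc False by (intro ext) (auto simp: transpose_def)
    have perms: "?t permutes {1..n}" "transpose a b permutes {1..n}"
      using Suc False assms by (auto intro!: permutes_swap_id)
    have "inversion_sign n (transpose a (Suc b)) =
        inversion_sign n ?t * (inversion_sign n (transpose a b) * inversion_sign n ?t)"
      unfolding eq using perms by (simp only: inversion_sign_compose permutes_compose)
    then show ?thesis using Suc False assms inversion_sign_adjacent[of b n] by simp
  qed
qed

text \<open>This joins the inversion sign, which governs products of differences, to the parity that
  defines \<open>alt_group\<close>.\<close>

lemma inversion_sign_eq_sign:
  assumes "p permutes {1..n}"
  shows "inversion_sign n p = of_int (sign p)"
  using assms finite_atLeastAtMost
proof (induction rule: permutes_induct)
  case id
  have "inversion_sign n id = (\<Prod>ij\<in>index_pairs n. 1)"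
    unfolding inversion_sign_def by (rule prod.cong) (auto simp: index_pairs_def)
  then show ?case by (simp add: id_def)
next
  case (swap a b p)
  have "inversion_sign n (transpose a b) = - 1"
    using swap inversion_sign_transpose[of a b n] inversion_sign_transpose[of b a n]
    by (cases "a < b") (auto simp: transpose_commute)
  moreover have "transpose a b permutes {1..n}" using swap by (intro permutes_swap_id) auto
  moreover have "permutation p" using swap permutation_permutes by blast
  ultimately show ?case
    unfolding inversion_sign_compose[OF \<open>transpose a b permutes {1..n}\<close> \<open>p permutes {1..n}\<close>]
      sign_compose[OF permutation_swap_id \<open>permutation p\<close>]
    using swap by (simp add: sign_swap_id)
qed

subsection \<open>Twin permutation representations of an unsolvable group\<close>

text \<open>On two disjoint copies of A the map is a product of two copies of f with equal
  parity.\<close>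

lemma evenperm_map_prod_bool:
  fixes f :: "'a \<Rightarrow> 'a"
  assumes f: "f permutes A" and A: "finite A"
  shows "map_prod f id permutes A \<times> (UNIV :: bool set)" "evenperm (map_prod f (id :: bool \<Rightarrow> bool))"
proof -
  let ?c = "\<lambda>b. map_permutation A (\<lambda>w. (w, b :: bool)) f"
  have inj: "inj_on (\<lambda>w. (w, b :: bool)) A" for b by (auto simp: inj_on_def)
  have app: "?c b (w, b') = (if b' = b then (f w, b') else (w, b'))" for b b' w
  proof (cases "b' = b \<and> w \<in> A")
    case True then show ?thesis using map_permutation_apply[OF inj] by auto
  next
    case False
    then have "(w, b') \<notin> (\<lambda>w. (w, b)) ` A" by auto
    then have "?c b (w, b') = (w, b')" by (simp add: map_permutation_def restrict_id_def)
    moreover have "f w = w" if "w \<notin> A" using f that by (simp add: permutes_def)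
    ultimately show ?thesis using False by auto
  qed
  have perm: "?c b permutes (\<lambda>w. (w, b)) ` A" for b
    by (rule map_permutation_permutes[OF _ f]) (use inj in \<open>simp add: bij_betw_def\<close>)
  have eq: "map_prod f id = ?c True \<circ> ?c False"
    by (rule ext) (auto simp: app simp del: map_permutation_compose')
  have "permutation (?c b)" for b
    using perm[of b] A by (meson permutation_permutes finite_imageI)
  moreover have "evenperm (?c b) = evenperm f" for b
    by (rule evenperm_map_permutation[OF inj f A])
  ultimately show "evenperm (map_prod f (id :: bool \<Rightarrow> bool))"
    unfolding eq by (simp add: evenperm_comp)
  have "?c b permutes A \<times> UNIV" for b
    by (rule permutes_subset[OF perm]) auto
  then show "map_prod f id permutes A \<times> (UNIV :: bool set)"
    unfolding eq by (intro permutes_compose)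
qed

section \<open>The action of an unsolvable group on the cosets of its solvable subgroups\<close>

locale unsolvable_finite_group = group H for H (structure) +
  assumes fin: "finite (carrier H)" and unsolvable: "\<not> solvable H"
begin

text \<open>Every solvable subgroup fixes a point of this set, namely itself, while the whole group
  fixes none. The cosets of all solvable subgroups are taken at once so that one pair of actions
  serves every one of them.\<close>

definition cosets :: "'a set set"
  where "cosets = {h <# K | h K. h \<in> carrier H \<and> subgroup K H \<and> solvable (H\<lparr>carrier := K\<rparr>)}"

lemma cosetsI:
  "\<lbrakk>h \<in> carrier H; subgroup K H; solvable (H\<lparr>carrier := K\<rparr>)\<rbrakk> \<Longrightarrow> h <# K \<in> cosets"
  unfolding cosets_def by blast

lemma cosets_subset:
  assumes "c \<in> cosets" shows "c \<subseteq> carrier H"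
proof -
  obtain h K where "c = h <# K" "h \<in> carrier H" "subgroup K H"
    using assms unfolding cosets_def by blast
  then show ?thesis using l_coset_subset_G[OF subgroup.subset] by simp
qed

lemma finite_cosets: "finite cosets"
  by (rule finite_subset[of _ "Pow (carrier H)"]) (use cosets_subset fin in auto)

lemma act_cosets:
  assumes "h \<in> carrier H" "c \<in> cosets" shows "h <# c \<in> cosets"
proof -
  obtain g K where c: "c = g <# K" "g \<in> carrier H" "subgroup K H" "solvable (H\<lparr>carrier := K\<rparr>)"
    using assms unfolding cosets_def by blast
  then have "h <# c = (h \<otimes> g) <# K"
    using assms lcos_m_assoc[OF subgroup.subset] by simp
  then show ?thesis using cosetsI[of "h \<otimes> g" K] c assms by simp
qed

lemma act_mult: "h \<in> carrier H \<Longrightarrow> k \<in> carrier H \<Longrightarrow> c \<in> cosets \<Longrightarrow> (h \<otimes> k) <# c = h <# (k <# c)"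
  by (rule lcos_m_assoc[symmetric, OF cosets_subset])

lemma act_one: "c \<in> cosets \<Longrightarrow> \<one> <# c = c"
  by (rule lcos_mult_one[OF cosets_subset])

lemma act_inj:
  assumes "h \<in> carrier H" "c \<in> cosets" "d \<in> cosets" "h <# c = h <# d" shows "c = d"
proof -
  have "inv h <# (h <# e) = e" if "e \<in> cosets" for e
    using act_mult[of "inv h" h e] act_one[OF that] that assms(1) by simp
  then show ?thesis using assms by metis
qed

lemma subgroup_coset_fixed:
  assumes "subgroup K H" "solvable (H\<lparr>carrier := K\<rparr>)"
  shows "K \<in> cosets" "k \<in> K \<Longrightarrow> k <# K = K"
proof -
  have "K \<subseteq> carrier H" using assms subgroup.subset by blast
  then show "K \<in> cosets"
    using cosetsI[OF one_closed assms] by (simp only: lcos_mult_one)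
  show "k <# K = K" if "k \<in> K"
    using coset_join3[OF _ assms(1) that] that \<open>K \<subseteq> carrier H\<close> by blast
qed

text \<open>If all of H fixed the coset gK, translation by the inverse of g would show that it is K
  itself; then K absorbs H from the left and equals H, which is unsolvable.\<close>

lemma not_all_fixed:
  assumes c: "c \<in> cosets"
  shows "\<exists>h\<in>carrier H. h <# c \<noteq> c"
proof (rule ccontr)
  assume neg: "\<not> ?thesis"
  obtain g K where gK: "c = g <# K" "g \<in> carrier H" "subgroup K H" "solvable (H\<lparr>carrier := K\<rparr>)"
    using c unfolding cosets_def by blast
  have K: "K \<subseteq> carrier H" using gK subgroup.subset by blast
  have "inv g <# c = K" using gK K by (simp add: lcos_m_assoc lcos_mult_one)
  then have cK: "c = K" using neg inv_closed[OF gK(2)] by auto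
  have "x \<in> K" if x: "x \<in> carrier H" for x
  proof -
    have "x <# K = K" using neg cK x by blast
    moreover have "x \<otimes> \<one> \<in> x <# K" using subgroup.one_closed[OF gK(3)] unfolding l_coset_def by blast
    ultimately show ?thesis using x by simp
  qed
  then have "K = carrier H" using K by blast
  then show False using gK(4) unsolvable by simp
qed

lemma singleton_coset: "h \<in> carrier H \<Longrightarrow> {h} \<in> cosets"
proof -
  assume h: "h \<in> carrier H"
  have "subgroup {\<one>} H" by (rule triv_subgroup)
  moreover have "solvable (H\<lparr>carrier := {\<one>}\<rparr>)"
    unfolding solvable_def using solvable_seq.unity[of "H\<lparr>carrier := {\<one>}\<rparr>"]
    by simp
  moreover have "h <# {\<one>} = {h}" using h by (simp add: l_coset_def)
  ultimately show ?thesis using cosetsI[OF h] by metis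
qed

section \<open>Injective words in cosets and labels\<close>

definition labels :: "('a set + nat) list \<Rightarrow> nat set"
  where "labels w = Inr -` set w"

definition words :: "('a set + nat) list set"
  where "words = {w. length w = card cosets \<and> distinct w \<and> Inl -` set w \<subseteq> cosets \<and>
    labels w = {..<card (labels w)}}"

definition label_count :: "('a set + nat) list \<Rightarrow> nat"
  where "label_count w = card (labels w)"

definition word_act :: "'a \<Rightarrow> ('a set + nat) list \<Rightarrow> ('a set + nat) list"
  where "word_act h = map (map_sum (\<lambda>c. h <# c) id)"

lemma wordsD:
  assumes "w \<in> words"
  shows "length w = card cosets" "distinct w" "\<And>c. Inl c \<in> set w \<Longrightarrow> c \<in> cosets"
    "\<And>k. Inr k \<in> set w \<longleftrightarrow> k < label_count w"
  using assms by (auto simp: words_def label_count_def labels_def)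

lemma wordsI:
  assumes "length w = card cosets" "distinct w" "\<And>c. Inl c \<in> set w \<Longrightarrow> c \<in> cosets"
    "\<And>k. Inr k \<in> set w \<longleftrightarrow> k < m"
  shows "w \<in> words" "label_count w = m"
proof -
  have "labels w = {..<m}" using assms(4) by (auto simp: labels_def)
  then show "w \<in> words" "label_count w = m"
    using assms by (auto simp: words_def label_count_def)
qed

lemma label_count_le: "w \<in> words \<Longrightarrow> label_count w \<le> card cosets"
proof -
  assume w: "w \<in> words"
  have "Inr ` {..<label_count w} \<subseteq> set w" using wordsD(4)[OF w] by auto
  then have "card (Inr ` {..<label_count w} :: ('a set + nat) set) \<le> card (set w)"
    by (intro card_mono) auto
  then show ?thesis
    using wordsD(1,2)[OF w] by (simp add: card_image inj_on_def distinct_card)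
qed

lemma finite_words: "finite words"
proof -
  have "words \<subseteq> {w. set w \<subseteq> Inl ` cosets \<union> Inr ` {..<card cosets} \<and> length w = card cosets}"
  proof safe
    fix w y assume w: "w \<in> words" and y: "y \<in> set w" "y \<notin> Inr ` {..<card cosets}"
    show "y \<in> Inl ` cosets"
    proof (cases y)
      case (Inl c) then show ?thesis using wordsD(3)[OF w] y by auto
    next
      case (Inr k) then show ?thesis using wordsD(4)[OF w] y label_count_le[OF w] by force
    qed
  qed (auto simp: words_def)
  then show ?thesis
    by (rule finite_subset) (intro finite_lists_length_eq finite_UnI finite_imageI finite_cosets, simp)
qed

lemma word_act:
  assumes h: "h \<in> carrier H" and w: "w \<in> words"
  shows "word_act h w \<in> words" "label_count (word_act h w) = label_count w"
proof -
  have "inj_on (map_sum (\<lambda>c. h <# c) id) (set w)"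
  proof (rule inj_onI)
    fix x y assume "x \<in> set w" "y \<in> set w" "map_sum (\<lambda>c. h <# c) id x = map_sum (\<lambda>c. h <# c) id y"
    then show "x = y" using act_inj[OF h wordsD(3)[OF w] wordsD(3)[OF w]]
      by (cases rule: sum.exhaust[of x]; cases rule: sum.exhaust[of y]) simp_all
  qed
  then have d: "distinct (word_act h w)"
    using wordsD(2)[OF w] by (simp add: word_act_def distinct_map)
  have l: "c \<in> cosets" if "Inl c \<in> set (word_act h w)" for c
  proof -
    obtain y where y: "y \<in> set w" "Inl c = map_sum (\<lambda>c. h <# c) id y"
      using \<open>Inl c \<in> _\<close> by (auto simp: word_act_def)
    then show ?thesis using wordsD(3)[OF w] act_cosets[OF h] by (cases rule: sum.exhaust[of y]) auto
  qed
  have r: "Inr k \<in> set (word_act h w) \<longleftrightarrow> k < label_count w" for k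
  proof -
    have "Inr k \<in> set (word_act h w) \<longleftrightarrow> Inr k \<in> set w"
      unfolding word_act_def set_map
    proof
      assume "Inr k \<in> map_sum (\<lambda>c. h <# c) id ` set w"
      then obtain y where "y \<in> set w" "Inr k = map_sum (\<lambda>c. h <# c) id y" by blast
      then show "Inr k \<in> set w" by (cases rule: sum.exhaust[of y]) auto
    qed force
    then show ?thesis using wordsD(4)[OF w] by simp
  qed
  show "word_act h w \<in> words" "label_count (word_act h w) = label_count w"
    using wordsI[of "word_act h w" "label_count w"] d l r wordsD(1)[OF w] by (auto simp: word_act_def)
qed

lemma word_act_mult:
  assumes "h \<in> carrier H" "k \<in> carrier H" "w \<in> words"
  shows "word_act (h \<otimes> k) w = word_act h (word_act k w)"
  unfolding word_act_def map_map
proof (rule map_cong[OF refl])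
  fix y assume "y \<in> set w"
  then show "map_sum (\<lambda>c. (h \<otimes> k) <# c) id y = (map_sum (\<lambda>c. h <# c) id \<circ> map_sum (\<lambda>c. k <# c) id) y"
    using act_mult[OF assms(1,2) wordsD(3)[OF assms(3)]] by (cases rule: sum.exhaust[of y]) simp_all
qed

lemma word_act_one: "w \<in> words \<Longrightarrow> word_act \<one> w = w"
  unfolding word_act_def
proof (rule map_idI)
  fix y assume "w \<in> words" "y \<in> set w"
  then show "map_sum (\<lambda>c. \<one> <# c) id y = y"
    using act_one[OF wordsD(3), of w] by (cases rule: sum.exhaust[of y]) simp_all
qed

text \<open>A sign-reversing involution on words: the coset \<open>z\<close> and the last label trade places. It commutes
  with every group element fixing \<open>z\<close>.\<close>

definition toggle_label :: "'a set \<Rightarrow> ('a set + nat) list \<Rightarrow> nat"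
  where "toggle_label z w = (if Inl z \<in> set w then label_count w else label_count w - 1)"

definition toggle :: "'a set \<Rightarrow> ('a set + nat) list \<Rightarrow> ('a set + nat) list"
  where "toggle z w = map (transpose (Inl z) (Inr (toggle_label z w))) w"

text \<open>Pigeonhole: a word has as many letters as there are cosets, and without z one coset
  fewer is available, so some letter is a label.\<close>

lemma label_count_pos:
  assumes w: "w \<in> words" and z: "z \<in> cosets" "Inl z \<notin> set w"
  shows "label_count w > 0"
proof (rule ccontr)
  assume "\<not> ?thesis"
  then have no_labels: "Inr k \<notin> set w" for k using wordsD(4)[OF w] by simp
  have "set w \<subseteq> Inl ` (cosets - {z})"
  proof
    fix y assume y: "y \<in> set w"
    show "y \<in> Inl ` (cosets - {z})"
    proof (cases y)
      case (Inl c)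
      then have "c \<in> cosets - {z}" using wordsD(3)[OF w] y z(2) by blast
      then show ?thesis unfolding Inl by (rule imageI)
    next
      case (Inr k) then show ?thesis using no_labels y by blast
    qed
  qed
  then have "card (set w) \<le> card (Inl ` (cosets - {z}) :: ('a set + nat) set)"
    using finite_cosets by (intro card_mono finite_imageI finite_Diff)
  also have "\<dots> \<le> card (cosets - {z})" by (rule card_image_le) (simp add: finite_cosets)
  also have "\<dots> < card cosets" by (rule card_Diff1_less[OF finite_cosets z(1)])
  finally show False using wordsD(1,2)[OF w] by (simp add: distinct_card)
qed

lemma toggle:
  assumes w: "w \<in> words" and z: "z \<in> cosets"
  shows "toggle z w \<in> words" "even (label_count (toggle z w)) \<longleftrightarrow> odd (label_count w)"
    "toggle z (toggle z w) = w"
proof -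
  let ?j = "toggle_label z w" and ?m = "if Inl z \<in> set w then Suc (label_count w) else label_count w - 1"
  let ?t = "transpose (Inl z) (Inr ?j) :: 'a set + nat \<Rightarrow> _"
  have mem: "y \<in> set (toggle z w) \<longleftrightarrow> ?t y \<in> set w" for y
  proof
    assume "y \<in> set (toggle z w)"
    then show "?t y \<in> set w" by (auto simp: toggle_def)
  next
    assume "?t y \<in> set w"
    then have "?t (?t y) \<in> ?t ` set w" by (rule imageI)
    then show "y \<in> set (toggle z w)" by (simp add: toggle_def)
  qed
  have "inj_on ?t (set w)" by (rule inj_on_inverseI[of _ ?t]) simp
  then have dist: "distinct (toggle z w)"
    unfolding toggle_def distinct_map using wordsD(2)[OF w] by blast
  have len: "length (toggle z w) = card cosets" unfolding toggle_def using wordsD(1)[OF w] by simp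
  have l: "c \<in> cosets" if c: "Inl c \<in> set (toggle z w)" for c
  proof (cases "c = z")
    case True then show ?thesis using z by simp
  next
    case False
    then have "?t (Inl c) = Inl c" by (simp add: transpose_def)
    then show ?thesis using c wordsD(3)[OF w] unfolding mem by metis
  qed
  have pos: "label_count w > 0" if "Inl z \<notin> set w" using label_count_pos[OF w z that] .
  have "Inr k \<in> set (toggle z w) \<longleftrightarrow> (if k = ?j then Inl z \<in> set w else k < label_count w)" for k
    unfolding mem wordsD(4)[OF w, symmetric] by (simp add: transpose_def)
  then have r: "Inr k \<in> set (toggle z w) \<longleftrightarrow> k < ?m" for k
    using pos by (cases "Inl z \<in> set w") (auto simp add: toggle_label_def)
  note tw = wordsI[OF len dist l r]
  show "toggle z w \<in> words" by (rule tw(1))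
  show "even (label_count (toggle z w)) \<longleftrightarrow> odd (label_count w)"
    using pos tw(2) by (cases "Inl z \<in> set w") simp_all
  have "Inl z \<in> set (toggle z w) \<longleftrightarrow> Inr ?j \<in> set w" by (simp add: mem)
  then have "Inl z \<in> set (toggle z w) \<longleftrightarrow> Inl z \<notin> set w"
    unfolding wordsD(4)[OF w] using pos by (cases "Inl z \<in> set w") (simp_all add: toggle_label_def)
  \<comment> \<open>The second toggle selects the same label, so the same transposition is applied
    twice.\<close>
  then have lab: "toggle_label z (toggle z w) = ?j"
    using tw(2) pos by (cases "Inl z \<in> set w") (simp_all add: toggle_label_def)
  have "toggle z (toggle z w) = map ?t (map ?t w)"
    unfolding toggle_def[of z "toggle z w"] lab by (simp only: toggle_def)
  also have "\<dots> = w" by (simp add: comp_def)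
  finally show "toggle z (toggle z w) = w" .
qed

text \<open>The action leaves labels alone, and since h fixes z it maps no other coset to z. Hence
  the same two letters are exchanged before and after acting.\<close>

lemma toggle_word_act:
  assumes w: "w \<in> words" and z: "z \<in> cosets" and h: "h \<in> carrier H" and fix_z: "h <# z = z"
  shows "toggle z (word_act h w) = word_act h (toggle z w)"
proof -
  have act_eq: "h <# c = z \<longleftrightarrow> c = z" if "c \<in> cosets" for c
    using act_inj[OF h that z] fix_z by auto
  have mem: "Inl z \<in> set (word_act h w) \<longleftrightarrow> Inl z \<in> set w"
  proof
    assume "Inl z \<in> set (word_act h w)"
    then obtain y where y: "y \<in> set w" "Inl z = map_sum (\<lambda>c. h <# c) id y"
      unfolding word_act_def set_map by blast
    from y(2) obtain c where c: "y = Inl c" "h <# c = z" by (cases rule: sum.exhaust[of y]) auto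
    then have "c = z" using act_eq wordsD(3)[OF w] y(1) by blast
    then show "Inl z \<in> set w" using c y(1) by simp
  next
    assume "Inl z \<in> set w"
    then have "map_sum (\<lambda>c. h <# c) id (Inl z) \<in> set (word_act h w)" unfolding word_act_def set_map by (rule imageI)
    then show "Inl z \<in> set (word_act h w)" using fix_z by simp
  qed
  then have lab: "toggle_label z (word_act h w) = toggle_label z w"
    unfolding toggle_label_def word_act(2)[OF h w] by simp
  show ?thesis
    unfolding toggle_def lab unfolding word_act_def map_map
  proof (rule map_cong[OF refl])
    fix y assume y: "y \<in> set w"
    show "(transpose (Inl z) (Inr (toggle_label z w)) \<circ> map_sum (\<lambda>c. h <# c) id) y =
        (map_sum (\<lambda>c. h <# c) id \<circ> transpose (Inl z) (Inr (toggle_label z w))) y"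
    proof (cases y)
      case (Inl c)
      then have "h <# c = z \<longleftrightarrow> c = z" using act_eq wordsD(3)[OF w] y by blast
      then show ?thesis using fix_z Inl by (simp add: transpose_def)
    next
      case (Inr k) then show ?thesis using fix_z by (simp add: transpose_def)
    qed
  qed
qed

end

text \<open>On a solvable subgroup one element t conjugates r to s pointwise, so it conjugates all
  image subgroups. For the whole group it is the images, not only the homomorphisms, that must fail
  to be conjugate, because conjugate subgroups have isomorphic fixed fields.\<close>

definition twin_homs ::
    "('a, 'c) monoid_scheme \<Rightarrow> ('b, 'd) monoid_scheme \<Rightarrow> ('a \<Rightarrow> 'b) \<Rightarrow> ('a \<Rightarrow> 'b) \<Rightarrow> bool"
  where "twin_homs H G r s \<longleftrightarrow>
    r \<in> hom H G \<and> s \<in> hom H G \<and> inj_on r (carrier H) \<and> inj_on s (carrier H) \<and>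
    (\<forall>K. subgroup K H \<and> solvable (H\<lparr>carrier := K\<rparr>) \<longrightarrow>
      (\<exists>t\<in>carrier G. \<forall>k\<in>K. s k = t \<otimes>\<^bsub>G\<^esub> r k \<otimes>\<^bsub>G\<^esub> inv\<^bsub>G\<^esub> t)) \<and>
    (\<forall>t\<in>carrier G. s ` carrier H \<noteq> (\<lambda>x. t \<otimes>\<^bsub>G\<^esub> x \<otimes>\<^bsub>G\<^esub> inv\<^bsub>G\<^esub> t) ` r ` carrier H)"

lemma permutesI_inverse:
  assumes "f \<circ> g = id" "g \<circ> f = id" "\<And>x. x \<notin> A \<Longrightarrow> f x = x"
  shows "f permutes A"
  using o_bij[OF assms(2,1)] assms(3) unfolding permutes_def bij_iff by blast

context unsolvable_finite_group
begin

text \<open>Words of the other parity are left fixed, so that both actions permute the same set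
  \<open>words\<close> and can be compared inside one permutation group.\<close>

definition part_act :: "bool \<Rightarrow> 'a \<Rightarrow> ('a set + nat) list \<Rightarrow> ('a set + nat) list"
  where "part_act par h w =
    (if w \<in> words \<and> (even (label_count w) \<longleftrightarrow> par) then word_act h w else w)"

definition toggle_perm :: "'a set \<Rightarrow> ('a set + nat) list \<Rightarrow> ('a set + nat) list"
  where "toggle_perm z w = (if w \<in> words then toggle z w else w)"

lemma part_act_mult:
  assumes "h \<in> carrier H" "k \<in> carrier H"
  shows "part_act par (h \<otimes> k) = part_act par h \<circ> part_act par k"
proof
  fix w
  show "part_act par (h \<otimes> k) w = (part_act par h \<circ> part_act par k) w"
    using word_act[OF assms(2), of w] word_act_mult[OF assms, of w]
    by (cases "w \<in> words \<and> (even (label_count w) \<longleftrightarrow> par)") (auto simp: part_act_def)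
qed

lemma part_act_one: "part_act par \<one> = id"
  by (rule ext) (simp add: part_act_def word_act_one)

lemma part_act_permutes:
  assumes h: "h \<in> carrier H"
  shows "part_act par h permutes words"
proof (rule permutesI_inverse)
  show "part_act par h \<circ> part_act par (inv h) = id" "part_act par (inv h) \<circ> part_act par h = id"
    using h by (simp_all only: part_act_mult[symmetric] inv_closed r_inv l_inv part_act_one)
qed (simp add: part_act_def)

lemma toggle_perm_permutes:
  assumes z: "z \<in> cosets"
  shows "toggle_perm z permutes words"
proof (rule permutesI_inverse)
  show "toggle_perm z \<circ> toggle_perm z = id" "toggle_perm z \<circ> toggle_perm z = id"
    using toggle(1,3)[OF _ z] by (auto simp: toggle_perm_def fun_eq_iff)
qed (simp add: toggle_perm_def)

lemma toggle_perm_part_act: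
  assumes z: "z \<in> cosets" and h: "h \<in> carrier H" and fix_z: "h <# z = z"
  shows "toggle_perm z \<circ> part_act True h = part_act False h \<circ> toggle_perm z"
proof
  fix w
  show "(toggle_perm z \<circ> part_act True h) w = (part_act False h \<circ> toggle_perm z) w"
  proof (cases "w \<in> words")
    case True
    show ?thesis
      using True toggle(1,2)[OF True z] word_act[OF h True] toggle_word_act[OF True z h fix_z]
      by (simp add: part_act_def toggle_perm_def)
  qed (simp add: part_act_def toggle_perm_def)
qed

text \<open>Every coset letter is moved by some element of H, so all letters of a fixed word are
  labels.\<close>

lemma fixed_word_label_count:
  assumes w: "w \<in> words" and fixed: "\<And>h. h \<in> carrier H \<Longrightarrow> word_act h w = w"
  shows "label_count w = card cosets"
proof -
  have no_coset: "Inl c \<notin> set w" for c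
  proof
    assume c: "Inl c \<in> set w"
    obtain h where h: "h \<in> carrier H" "h <# c \<noteq> c"
      using not_all_fixed[OF wordsD(3)[OF w c]] by blast
    have "map (map_sum (\<lambda>c. h <# c) id) w = map (\<lambda>y. y) w"
      using fixed[OF h(1)] by (simp add: word_act_def)
    then have "map_sum (\<lambda>c. h <# c) id (Inl c) = (Inl c :: 'a set + nat)"
      using c unfolding map_eq_conv by blast
    then show False using h(2) by simp
  qed
  have "set w \<subseteq> Inr ` {..<label_count w}"
  proof
    fix y assume y: "y \<in> set w"
    show "y \<in> Inr ` {..<label_count w}"
    proof (cases y)
      case (Inl c) then show ?thesis using no_coset y by blast
    next
      case (Inr k)
      then have "k < label_count w" using wordsD(4)[OF w] y by blast
      then show ?thesis using Inr by blast
    qed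
  qed
  then have "card (set w) \<le> card (Inr ` {..<label_count w} :: ('a set + nat) set)"
    by (intro card_mono finite_imageI) auto
  also have "\<dots> \<le> label_count w" using card_image_le[of "{..<label_count w}" Inr] by simp
  finally have "card (set w) \<le> label_count w" .
  then show ?thesis using label_count_le[OF w] wordsD(1,2)[OF w] by (simp add: distinct_card)
qed

lemma label_word: "map Inr [0..<card cosets] \<in> words" "label_count (map Inr [0..<card cosets]) = card cosets"
  by (rule wordsI; auto simp: distinct_map)+

lemma word_act_label_word: "word_act h (map Inr ks) = map Inr ks"
  by (simp add: word_act_def)

definition moved :: "bool \<Rightarrow> ('a set + nat) list set"
  where "moved par = {w. \<exists>h\<in>carrier H. part_act par h w \<noteq> w}"

lemma moved_eq:
  "moved par = {w \<in> words. (even (label_count w) \<longleftrightarrow> par) \<and> (\<exists>h\<in>carrier H. word_act h w \<noteq> w)}"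
  by (auto simp: moved_def part_act_def)

text \<open>Toggling at the coset of the identity matches the words of the two parities. Only the
  parity of \<open>card cosets\<close> contains words fixed by H, so it has fewer moved
  words.\<close>

lemma card_moved_neq: "card (moved True) \<noteq> card (moved False)"
proof -
  define W where "W par = {w \<in> words. even (label_count w) \<longleftrightarrow> par}" for par
  have finW: "finite (W par)" for par using finite_words by (simp add: W_def)
  have z: "{\<one>} \<in> cosets" by (rule singleton_coset) simp
  have "bij_betw (toggle {\<one>}) (W True) (W False)"
    by (rule bij_betw_byWitness[where f' = "toggle {\<one>}"]) (auto simp: W_def toggle[OF _ z])
  then have cardW: "card (W par) = card (W (\<not> par))" for par
    using bij_betw_same_card by (cases par) fastforce+
  let ?par = "even (card cosets)"
  have "moved (\<not> ?par) = W (\<not> ?par)"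
    using fixed_word_label_count by (fastforce simp: moved_eq W_def)
  moreover have "moved ?par \<subset> W ?par"
  proof -
    have "map Inr [0..<card cosets] \<in> W ?par" "map Inr [0..<card cosets] \<notin> moved ?par"
      using label_word by (simp_all add: W_def moved_eq word_act_label_word)
    moreover have "moved ?par \<subseteq> W ?par" by (auto simp: moved_eq W_def)
    ultimately show ?thesis by blast
  qed
  ultimately have "card (moved ?par) < card (moved (\<not> ?par))"
    using psubset_card_mono[OF finW] cardW[of ?par] by metis
  then show ?thesis by (cases ?par) auto
qed

text \<open>A nontrivial element moves the singleton coset of the identity, hence every word that
  contains it. Filling up one or two singleton cosets with labels produces such a word of either
  parity.\<close>

lemma part_act_faithful:
  assumes h: "h \<in> carrier H" "part_act par h = id"
  shows "h = \<one>"
proof (rule ccontr)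
  assume ne: "h \<noteq> \<one>"
  let ?z = "{\<one>}" and ?z' = "{h}" and ?N = "card cosets"
  have z: "?z \<in> cosets" "?z' \<in> cosets" using singleton_coset h by auto
  have hz: "h <# ?z = ?z'" using h by (simp add: l_coset_def)
  have "card {?z, ?z'} \<le> ?N" using z finite_cosets by (intro card_mono) auto
  then have N: "?N \<ge> 2" using ne by simp
  obtain w where w: "w \<in> words" "even (label_count w) \<longleftrightarrow> par" "Inl ?z \<in> set w"
  proof (cases "even (?N - 1) \<longleftrightarrow> par")
    case True
    let ?w = "Inl ?z # map Inr [0..<?N - 1]"
    have "?w \<in> words" "label_count ?w = ?N - 1"
      by (rule wordsI; use N z in \<open>auto simp: distinct_map\<close>)+
    then show thesis using True that[of ?w] by auto
  next
    case False
    let ?w = "Inl ?z # Inl ?z' # map Inr [0..<?N - 2]"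
    have "?w \<in> words" "label_count ?w = ?N - 2"
      by (rule wordsI; use N z ne in \<open>auto simp: distinct_map\<close>)+
    moreover have "even (?N - 2) \<longleftrightarrow> par" using False N by auto
    ultimately show thesis using that[of ?w] by auto
  qed
  have "word_act h w = w" using fun_cong[OF h(2), of w] w by (simp add: part_act_def)
  then have "map (map_sum (\<lambda>c. h <# c) id) w = map (\<lambda>y. y) w" by (simp add: word_act_def)
  then have "map_sum (\<lambda>c. h <# c) id (Inl ?z) = (Inl ?z :: 'a set + nat)"
    using w(3) unfolding map_eq_conv by blast
  then show False using hz ne by simp
qed

text \<open>Every word is doubled to make the permutations even.\<close>

theorem ex_twin_homs_alt_group:
  assumes n: "2 * card words \<le> n"
  shows "\<exists>r s. twin_homs H (alt_group n) r s"
proof -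
  let ?D = "words \<times> (UNIV :: bool set)"
  interpret G: group "alt_group n" by (rule alt_group_is_group)
  have finD: "finite ?D" using finite_words by simp
  have "card ?D \<le> card {1..n}" using n by (simp add: card_cartesian_product)
  then obtain e where e: "e ` ?D \<subseteq> {1..n}" "inj_on e ?D"
    using card_le_inj[OF finD finite_atLeastAtMost] by blast
  define lift where "lift f = map_permutation ?D e (map_prod f id)" for f
  have lift_app: "lift f (e (w, b)) = e (f w, b)" if "w \<in> words" for f w b
    using map_permutation_apply[OF e(2), of "(w, b)"] that by (simp add: lift_def)
  have lift_out: "lift f m = m" if "m \<notin> e ` ?D" for f m
    using that by (simp add: lift_def map_permutation_def restrict_id_def)
  have lift_alt: "lift f \<in> carrier (alt_group n)" if f: "f permutes words" for f
  proof -
    note D = evenperm_map_prod_bool[OF f finite_words]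
    have "lift f permutes e ` ?D"
      unfolding lift_def by (rule map_permutation_permutes[OF _ D(1)]) (simp add: e(2) bij_betw_def)
    moreover have "evenperm (lift f)"
      unfolding lift_def using evenperm_map_permutation[OF e(2) D(1) finD] D(2) by simp
    ultimately show ?thesis using permutes_subset[OF _ e(1)] by (simp add: alt_group_carrier)
  qed
  have lift_comp: "lift (f \<circ> g) = lift f \<circ> lift g" if g: "g permutes words" for f g
  proof -
    have "map_prod (f \<circ> g) id = map_prod f id \<circ> (map_prod g id :: _ \<times> bool \<Rightarrow> _)" by (auto simp: fun_eq_iff)
    then show ?thesis
      using map_permutation_compose'[OF e(2) evenperm_map_prod_bool(1)[OF g finite_words]]
      by (simp add: lift_def)
  qed
  have lift_inj: "f = id" if f: "f permutes words" "lift f = id" for f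
  proof
    fix w show "f w = id w"
    proof (cases "w \<in> words")
      case True
      then have "e (f w, True) = e (w, True)" using lift_app[OF True, of f True] f(2) by simp
      then have "(f w, True) = (w, True)"
        using inj_onD[OF e(2)] True permutes_in_image[OF f(1)] by blast
      then show ?thesis by simp
    next
      case False then show ?thesis using f(1) by (simp add: permutes_def)
    qed
  qed
  define r where "r par h = lift (part_act par h)" for par h
  have r_hom: "r par \<in> hom H (alt_group n)" for par
    by (rule homI)
      (simp_all add: r_def lift_alt part_act_permutes part_act_mult lift_comp alt_group_mult)
  have r_inj: "inj_on (r par) (carrier H)" for par
  proof -
    interpret r: group_hom H "alt_group n" "r par"
      using r_hom by unfold_locales
    have "h = \<one>" if "h \<in> carrier H" "r par h = \<one>\<^bsub>alt_group n\<^esub>" for h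
      using that lift_inj[OF part_act_permutes[OF that(1), of par]] part_act_faithful[OF that(1), of par]
      by (simp add: r_def alt_group_one)
    then have "kernel H (alt_group n) (r par) = {\<one>}"
      using r.hom_one by (auto simp: kernel_def)
    then show ?thesis by (rule r.trivial_ker_imp_inj)
  qed
  have r_closed: "r par h \<in> carrier (alt_group n)" if "h \<in> carrier H" for par h
    using r_hom that by (rule hom_in_carrier)
  have conj: "\<exists>t\<in>carrier (alt_group n). \<forall>k\<in>K. r False k =
      t \<otimes>\<^bsub>alt_group n\<^esub> r True k \<otimes>\<^bsub>alt_group n\<^esub> inv\<^bsub>alt_group n\<^esub> t"
    if K: "subgroup K H" "solvable (H\<lparr>carrier := K\<rparr>)" for K
  proof (intro bexI ballI)
    note KC = subgroup_coset_fixed[OF K]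
    \<comment> \<open>K, as a coset, is fixed by its own elements, so toggling at K intertwines the
      two actions of K.\<close>
    let ?t = "lift (toggle_perm K)"
    show t: "?t \<in> carrier (alt_group n)" by (rule lift_alt[OF toggle_perm_permutes[OF KC(1)]])
    fix k assume k: "k \<in> K"
    then have kH: "k \<in> carrier H" using subgroup.subset[OF K(1)] by blast
    have "?t \<circ> r True k = r False k \<circ> ?t"
      unfolding r_def lift_comp[OF part_act_permutes[OF kH], symmetric]
        lift_comp[OF toggle_perm_permutes[OF KC(1)], symmetric]
        toggle_perm_part_act[OF KC(1) kH KC(2)[OF k]] ..
    then have "?t \<otimes>\<^bsub>alt_group n\<^esub> r True k = r False k \<otimes>\<^bsub>alt_group n\<^esub> ?t"
      by (simp only: alt_group_mult)
    then show "r False k = ?t \<otimes>\<^bsub>alt_group n\<^esub> r True k \<otimes>\<^bsub>alt_group n\<^esub> inv\<^bsub>alt_group n\<^esub> ?t"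
      using G.inv_solve_right[OF r_closed[OF kH] _ t] r_closed[OF kH] t by (metis G.m_closed)
  qed
  \<comment> \<open>The points moved by the image subgroup: conjugation carries them along, so their
    number is an invariant of the conjugacy class.\<close>
  define M where "M par = {m. \<exists>h\<in>carrier H. r par h m \<noteq> m}" for par
  have M_eq: "M par = e ` (moved par \<times> UNIV)" for par
  proof (rule Set.set_eqI)
    fix m
    show "m \<in> M par \<longleftrightarrow> m \<in> e ` (moved par \<times> UNIV)"
    proof (cases "m \<in> e ` ?D")
      case False
      have "moved par \<subseteq> words" by (auto simp: moved_eq)
      then have "m \<notin> e ` (moved par \<times> UNIV)" using False by blast
      then show ?thesis using lift_out[OF False] by (simp add: M_def r_def)
    next
      case True
      then obtain w b where w: "w \<in> words" "m = e (w, b)" by blast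
      have "r par h m \<noteq> m \<longleftrightarrow> part_act par h w \<noteq> w" if "h \<in> carrier H" for h
      proof -
        have "part_act par h w \<in> words" using permutes_in_image[OF part_act_permutes[OF that]] w by blast
        then show ?thesis
          using lift_app[OF w(1)] inj_on_eq_iff[OF e(2), of "(part_act par h w, b)" "(w, b)"] w
          by (simp add: r_def)
      qed
      then have "m \<in> M par \<longleftrightarrow> w \<in> moved par" by (auto simp: M_def moved_def)
      moreover have "m \<in> e ` (moved par \<times> UNIV) \<longleftrightarrow> (w, b) \<in> moved par \<times> UNIV"
        unfolding w(2) using w(1)
        by (intro inj_on_image_mem_iff[OF e(2)]) (auto simp: moved_eq)
      ultimately show ?thesis by simp
    qed
  qed
  have card_M: "card (M par) = 2 * card (moved par)" for par
  proof -
    have "moved par \<times> UNIV \<subseteq> ?D" by (auto simp: moved_eq)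
    then show ?thesis
      unfolding M_eq using inj_on_subset[OF e(2)] by (subst card_image) (auto simp: card_cartesian_product)
  qed
  have nonconj: "r False ` carrier H \<noteq>
      (\<lambda>x. t \<otimes>\<^bsub>alt_group n\<^esub> x \<otimes>\<^bsub>alt_group n\<^esub> inv\<^bsub>alt_group n\<^esub> t) ` r True ` carrier H"
    if t: "t \<in> carrier (alt_group n)" for t
  proof
    assume eq: "r False ` carrier H =
      (\<lambda>x. t \<otimes>\<^bsub>alt_group n\<^esub> x \<otimes>\<^bsub>alt_group n\<^esub> inv\<^bsub>alt_group n\<^esub> t) ` r True ` carrier H"
    have t_bij: "bij t" using t permutes_bij by (auto simp: alt_group_carrier)
    have M_alt: "M par = {m. \<exists>x\<in>r par ` carrier H. x m \<noteq> m}" for par by (auto simp: M_def)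
    have "m \<in> M False \<longleftrightarrow> inv' t m \<in> M True" for m
    proof -
      have "m \<in> M False \<longleftrightarrow> (\<exists>x\<in>r True ` carrier H. t (x (inv' t m)) \<noteq> m)"
        unfolding M_alt eq using t by (simp add: alt_group_mult alt_group_inv_equality)
      also have "\<dots> \<longleftrightarrow> (\<exists>x\<in>r True ` carrier H. x (inv' t m) \<noteq> inv' t m)"
        using bij_inv_eq_iff[OF t_bij] by metis
      finally show ?thesis unfolding M_alt by simp
    qed
    then have "M False = {m. inv' t m \<in> M True}" by blast
    also have "\<dots> = t ` M True"
      using bij_image_Collect_eq[OF t_bij, of "\<lambda>m. m \<in> M True"] by simp
    finally have "card (M False) = card (M True)"
      using card_image[of t "M True"] bij_is_inj[OF t_bij] by (simp add: inj_on_subset)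
    then show False using card_moved_neq by (simp add: card_M)
  qed
  have "twin_homs H (alt_group n) (r True) (r False)"
    unfolding twin_homs_def using r_hom r_inj conj nonconj by blast
  then show ?thesis by blast
qed

end

subsection \<open>Algebraic integers and prime ideals\<close>

definition int_span :: "complex set \<Rightarrow> complex set"
  where "int_span S = {z. \<exists>c. z = (\<Sum>s\<in>S. of_int (c s) * s)}"

lemma int_span_base: "finite S \<Longrightarrow> s \<in> S \<Longrightarrow> s \<in> int_span S"
  unfolding int_span_def
  by (intro CollectI exI[of _ "\<lambda>t. if t = s then 1 else 0"]) (simp add: if_distrib if_distribR cong: if_cong)

lemma int_span_add:
  assumes "z \<in> int_span S" "w \<in> int_span S" shows "z + w \<in> int_span S"
proof -
  obtain c d where cd: "z = (\<Sum>s\<in>S. of_int (c s) * s)" "w = (\<Sum>s\<in>S. of_int (d s) * s)"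
    using assms unfolding int_span_def by blast
  have "z + w = (\<Sum>s\<in>S. of_int (c s + d s) * s)"
    unfolding cd by (simp add: sum.distrib distrib_right)
  then show ?thesis
    unfolding int_span_def by (intro CollectI exI[of _ "\<lambda>s. c s + d s"])
qed

lemma int_span_scale:
  assumes "z \<in> int_span S" shows "of_int a * z \<in> int_span S"
proof -
  obtain c where c: "z = (\<Sum>s\<in>S. of_int (c s) * s)" using assms unfolding int_span_def by blast
  have "of_int a * z = (\<Sum>s\<in>S. of_int (a * c s) * s)"
    unfolding c by (simp add: sum_distrib_left mult.assoc)
  then show ?thesis
    unfolding int_span_def by (intro CollectI exI[of _ "\<lambda>s. a * c s"])
qed

lemma int_span_zero: "0 \<in> int_span S"
  unfolding int_span_def by (intro CollectI exI[of _ "\<lambda>s. 0"]) simp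

lemma int_span_sum: "(\<And>i. i \<in> I \<Longrightarrow> f i \<in> int_span S) \<Longrightarrow> sum f I \<in> int_span S"
  by (induction I rule: infinite_finite_induct) (auto simp: int_span_zero int_span_add)

lemma int_span_mult:
  assumes "\<And>s. s \<in> S \<Longrightarrow> r * s \<in> int_span S" "z \<in> int_span S"
  shows "r * z \<in> int_span S"
proof -
  obtain c where c: "z = (\<Sum>s\<in>S. of_int (c s) * s)" using assms unfolding int_span_def by blast
  have "r * z = (\<Sum>s\<in>S. of_int (c s) * (r * s))"
    unfolding c by (simp add: sum_distrib_left mult.left_commute)
  also have "\<dots> \<in> int_span S" using assms(1) by (intro int_span_sum int_span_scale)
  finally show ?thesis .
qed

text \<open>Cayley--Hamilton: \<open>r\<close> is an eigenvalue of the integer matrix describing multiplication by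
  \<open>r\<close> on the finitely generated module.\<close>

lemma algebraic_int_if_finite_module:
  assumes S: "finite S" "s0 \<in> S" "s0 \<noteq> 0" and r: "\<And>s. s \<in> S \<Longrightarrow> r * s \<in> int_span S"
  shows "algebraic_int r"
proof -
  obtain bs where bs: "set bs = S" "distinct bs" using finite_distinct_list[OF S(1)] by blast
  let ?n = "length bs"
  have "\<forall>s\<in>S. \<exists>c. r * s = (\<Sum>t\<in>S. of_int (c t) * t)" using r unfolding int_span_def by blast
  then obtain c where c: "\<And>s. s \<in> S \<Longrightarrow> r * s = (\<Sum>t\<in>S. of_int (c s t) * t)" by metis
  define A where "A = mat ?n ?n (\<lambda>(i, j). c (bs ! i) (bs ! j))"
  define A' where "A' = (map_mat of_int A :: complex mat)"
  define v where "v = vec ?n (\<lambda>i. bs ! i)"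
  have A: "A \<in> carrier_mat ?n ?n" "A' \<in> carrier_mat ?n ?n" by (auto simp: A_def A'_def)
  have "A' *\<^sub>v v = r \<cdot>\<^sub>v v"
  proof (rule eq_vecI)
    show "dim_vec (A' *\<^sub>v v) = dim_vec (r \<cdot>\<^sub>v v)" by (simp add: A'_def A_def v_def)
    fix i assume "i < dim_vec (r \<cdot>\<^sub>v v)"
    then have i: "i < ?n" by (simp add: v_def)
    have "(A' *\<^sub>v v) $ i = (\<Sum>j<?n. of_int (c (bs ! i) (bs ! j)) * bs ! j)"
      using i by (simp add: A'_def A_def v_def scalar_prod_def atLeast0LessThan)
    also have "\<dots> = (\<Sum>t\<in>S. of_int (c (bs ! i) t) * t)"
      using sum.reindex_bij_betw[OF bij_betw_nth[OF bs(2) refl bs(1)[symmetric]], of "\<lambda>t. of_int (c (bs ! i) t) * t"] by simp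
    also have "\<dots> = r * bs ! i" using c[of "bs ! i"] i bs(1) nth_mem by metis
    finally show "(A' *\<^sub>v v) $ i = (r \<cdot>\<^sub>v v) $ i" using i by (simp add: v_def)
  qed
  moreover have "v \<noteq> 0\<^sub>v ?n"
  proof
    assume v0: "v = 0\<^sub>v ?n"
    obtain i where i: "i < ?n" "bs ! i = s0" using S(2) bs(1) in_set_conv_nth by metis
    have "v $ i = 0" unfolding v0 using i(1) by simp
    then show False using i S(3) by (simp add: v_def)
  qed
  ultimately have "eigenvalue A' r"
    using A(2) unfolding eigenvalue_def eigenvector_def
    by (intro exI[of _ v]) (auto simp: v_def A'_def A_def)
  then have "poly (char_poly A') r = 0" using eigenvalue_root_char_poly[OF A(2)] by simp
  then have "poly (map_poly of_int (char_poly A)) r = 0"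
    unfolding A'_def of_int_hom.char_poly_hom[OF A(1)] .
  moreover have "lead_coeff (char_poly A) = 1" using degree_monic_char_poly[OF A(1)] by simp
  ultimately show ?thesis unfolding algebraic_int_altdef_ipoly by blast
qed

lemma algebraic_int_power_relation:
  assumes "algebraic_int (x :: complex)"
  obtains n c where "n > 0" "x ^ n = (\<Sum>i<n. of_int (c i) * x ^ i)"
proof -
  obtain p :: "int poly" where p: "poly (map_poly of_int p) x = 0" "lead_coeff p = 1"
    using assms unfolding algebraic_int_altdef_ipoly by blast
  let ?n = "Polynomial.degree p"
  have "(\<Sum>i\<le>?n. of_int (coeff p i) * x ^ i) = 0"
    using p(1) by (simp add: poly_altdef)
  then have "x ^ ?n + (\<Sum>i<?n. of_int (coeff p i) * x ^ i) = 0"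
    using p(2) by (simp add: lessThan_Suc_atMost[symmetric] add.commute)
  then have eq: "x ^ ?n = (\<Sum>i<?n. of_int (- coeff p i) * x ^ i)"
    by (simp add: sum_negf eq_neg_iff_add_eq_0)
  moreover have "?n > 0" using eq by (cases "?n = 0") auto
  ultimately show thesis by (intro that[of ?n "\<lambda>i. - coeff p i"]) auto
qed

text \<open>The monomials x^i y^j below the two degrees span a module that is stable under
  multiplication by x and by y, hence by their sum and product.\<close>

lemma algebraic_int_add_mult:
  assumes x: "algebraic_int (x :: complex)" and y: "algebraic_int y"
  shows "algebraic_int (x + y)" "algebraic_int (x * y)"
proof -
  obtain n c where n: "n > 0" "x ^ n = (\<Sum>i<n. of_int (c i) * x ^ i)"
    using algebraic_int_power_relation[OF x] by metis
  obtain m d where m: "m > 0" "y ^ m = (\<Sum>j<m. of_int (d j) * y ^ j)"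
    using algebraic_int_power_relation[OF y] by metis
  define S where "S = (\<lambda>(i, j). x ^ i * y ^ j) ` ({..<n} \<times> {..<m})"
  have fin: "finite S" by (simp add: S_def)
  have mem: "x ^ i * y ^ j \<in> int_span S" if "i < n" "j < m" for i j
    using that by (intro int_span_base[OF fin]) (auto simp: S_def)
  have xS: "x * s \<in> int_span S" if sS: "s \<in> S" for s
  proof -
    obtain i j where s: "s = x ^ i * y ^ j" "i < n" "j < m" using sS unfolding S_def by force
    show ?thesis
    proof (cases "Suc i < n")
      case True
      then show ?thesis using mem[of "Suc i" j] s by (simp add: mult.assoc)
    next
      case False
      then have "x * s = x ^ n * y ^ j" using s by (metis Suc_lessI mult.assoc power_Suc)
      also have "\<dots> = (\<Sum>i<n. of_int (c i) * (x ^ i * y ^ j))"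
        by (simp add: n(2) sum_distrib_right mult.assoc)
      also have "\<dots> \<in> int_span S" using mem s by (intro int_span_sum int_span_scale) auto
      finally show ?thesis .
    qed
  qed
  have yS: "y * s \<in> int_span S" if sS: "s \<in> S" for s
  proof -
    obtain i j where s: "s = x ^ i * y ^ j" "i < n" "j < m" using sS unfolding S_def by force
    show ?thesis
    proof (cases "Suc j < m")
      case True
      then show ?thesis using mem[of i "Suc j"] s by (simp add: mult.left_commute)
    next
      case False
      then have "y * s = x ^ i * y ^ m" using s by (metis Suc_lessI mult.left_commute power_Suc)
      also have "\<dots> = (\<Sum>j<m. of_int (d j) * (x ^ i * y ^ j))"
        by (simp add: m(2) sum_distrib_left mult.left_commute)
      also have "\<dots> \<in> int_span S" using mem s by (intro int_span_sum int_span_scale) auto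
      finally show ?thesis .
    qed
  qed
  have one: "1 \<in> S" using n(1) m(1) by (force simp: S_def)
  have "(x + y) * s \<in> int_span S" if "s \<in> S" for s
    using int_span_add[OF xS[OF that] yS[OF that]] by (simp add: distrib_right)
  then show "algebraic_int (x + y)"
    by (intro algebraic_int_if_finite_module[OF fin one]) auto
  have "(x * y) * s \<in> int_span S" if "s \<in> S" for s
    using int_span_mult[OF xS yS[OF that]] by (simp add: mult.assoc)
  then show "algebraic_int (x * y)"
    by (intro algebraic_int_if_finite_module[OF fin one]) auto
qed

lemma algebraic_int_diff: "algebraic_int (x :: complex) \<Longrightarrow> algebraic_int y \<Longrightarrow> algebraic_int (x - y)"
  using algebraic_int_add_mult(1)[of x "- y"] by (simp add: algebraic_int_minus)

lemma algebraic_int_of_int: "algebraic_int (of_int a :: complex)"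
  by (rule int_imp_algebraic_int) simp

lemma algebraic_int_sum: "(\<And>i. i \<in> I \<Longrightarrow> algebraic_int (f i :: complex)) \<Longrightarrow> algebraic_int (sum f I)"
  by (induction I rule: infinite_finite_induct) (auto intro: algebraic_int_add_mult)

lemma algebraic_int_rat: "algebraic_int (x :: complex) \<Longrightarrow> x \<in> \<rat> \<Longrightarrow> x \<in> \<int>"
  by (rule rational_algebraic_int_is_int)

definition int_domain :: "complex set \<Rightarrow> bool"
  where "int_domain R \<longleftrightarrow> 1 \<in> R \<and> (\<forall>x\<in>R. \<forall>y\<in>R. x - y \<in> R \<and> x * y \<in> R)"

definition prime_ideal_of :: "complex set \<Rightarrow> complex set \<Rightarrow> bool"
  where "prime_ideal_of R P \<longleftrightarrow> P \<subseteq> R \<and> 0 \<in> P \<and> 1 \<notin> P \<and> (\<forall>x\<in>P. \<forall>y\<in>P. x - y \<in> P) \<and>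
    (\<forall>r\<in>R. \<forall>x\<in>P. r * x \<in> P) \<and> (\<forall>x\<in>R. \<forall>y\<in>R. x * y \<in> P \<longrightarrow> x \<in> P \<or> y \<in> P)"

text \<open>By Zorn there is an ideal maximal among those that contain q and avoid 1, the principal
  ideal of the non-unit q being one of them. Such an ideal is maximal, hence prime.\<close>

lemma ex_prime_ideal:
  assumes R: "int_domain R" and q: "q \<in> R" "\<And>r. r \<in> R \<Longrightarrow> q * r \<noteq> 1"
  shows "\<exists>P. prime_ideal_of R P \<and> q \<in> P"
proof -
  have one: "1 \<in> R" and diff: "\<And>x y. x \<in> R \<Longrightarrow> y \<in> R \<Longrightarrow> x - y \<in> R"
    and mult: "\<And>x y. x \<in> R \<Longrightarrow> y \<in> R \<Longrightarrow> x * y \<in> R"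
    using R by (auto simp: int_domain_def)
  have zero: "0 \<in> R" using diff[OF one one] by simp
  have add: "x + y \<in> R" if "x \<in> R" "y \<in> R" for x y
    using diff[OF that(1) diff[OF zero that(2)]] by simp
  define \<A> where "\<A> = {I. I \<subseteq> R \<and> q \<in> I \<and> 1 \<notin> I \<and> (\<forall>x\<in>I. \<forall>y\<in>I. x - y \<in> I) \<and> (\<forall>r\<in>R. \<forall>x\<in>I. r * x \<in> I)}"
  have "(*) q ` R \<in> \<A>"
    unfolding \<A>_def
  proof (intro CollectI conjI ballI)
    show "(*) q ` R \<subseteq> R" using mult q(1) by auto
    show "q \<in> (*) q ` R" using one by force
    show "1 \<notin> (*) q ` R" using q(2) by (metis imageE)
    show "x - y \<in> (*) q ` R" if xy: "x \<in> (*) q ` R" "y \<in> (*) q ` R" for x y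
    proof -
      obtain a b where "x = q * a" "y = q * b" "a \<in> R" "b \<in> R" using xy by blast
      then have "x - y = q * (a - b)" "a - b \<in> R" by (auto simp: right_diff_distrib diff)
      then show ?thesis by blast
    qed
    show "r * x \<in> (*) q ` R" if rx: "r \<in> R" "x \<in> (*) q ` R" for r x
    proof -
      obtain a where "x = q * a" "a \<in> R" using rx by blast
      then have "r * x = q * (r * a)" "r * a \<in> R" using rx by (auto simp: mult)
      then show ?thesis by blast
    qed
  qed
  then have ne: "\<A> \<noteq> {}" by blast
  have chain: "\<Union>C \<in> \<A>" if C: "C \<noteq> {}" "subset.chain \<A> C" for C
  proof -
    have sub: "I \<in> \<A>" if "I \<in> C" for I using C(2) that by (auto simp: subset.chain_def)
    have tot: "I \<subseteq> J \<or> J \<subseteq> I" if "I \<in> C" "J \<in> C" for I J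
      using C(2) that by (auto simp: subset.chain_def)
    have "x - y \<in> \<Union>C" if xy: "x \<in> \<Union>C" "y \<in> \<Union>C" for x y
    proof -
      obtain I J where IJ: "x \<in> I" "I \<in> C" "y \<in> J" "J \<in> C" using xy by blast
      define M where "M = (if I \<subseteq> J then J else I)"
      have M: "M \<in> C" "x \<in> M" "y \<in> M" using tot[of I J] IJ by (auto simp: M_def)
      then have "x - y \<in> M" using sub[OF M(1)] by (simp add: \<A>_def)
      then show ?thesis using M(1) by blast
    qed
    moreover have "r * x \<in> \<Union>C" if "r \<in> R" "x \<in> \<Union>C" for r x
      using that sub unfolding \<A>_def by blast
    moreover have "\<Union>C \<subseteq> R" "q \<in> \<Union>C" "1 \<notin> \<Union>C" using C(1) sub unfolding \<A>_def by blast+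
    ultimately show ?thesis unfolding \<A>_def by blast
  qed
  obtain P where P: "P \<in> \<A>" and max: "\<And>I. I \<in> \<A> \<Longrightarrow> P \<subseteq> I \<Longrightarrow> I = P"
    using subset_Zorn_nonempty[OF ne chain] by metis
  have PD: "P \<subseteq> R" "q \<in> P" "1 \<notin> P" "\<And>x y. x \<in> P \<Longrightarrow> y \<in> P \<Longrightarrow> x - y \<in> P"
      "\<And>r x. r \<in> R \<Longrightarrow> x \<in> P \<Longrightarrow> r * x \<in> P"
    using P by (auto simp: \<A>_def)
  have P0: "0 \<in> P" using PD(4)[OF PD(2,2)] by simp
  have Padd: "x + y \<in> P" if "x \<in> P" "y \<in> P" for x y
    using PD(4)[OF that(1) PD(4)[OF P0 that(2)]] by simp
  have ext: "\<exists>p\<in>P. \<exists>r\<in>R. p + r * a = 1" if a: "a \<in> R" "a \<notin> P" for a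
  proof (rule ccontr)
    assume neg: "\<not> ?thesis"
    define I where "I = {p + r * a | p r. p \<in> P \<and> r \<in> R}"
    have "I \<in> \<A>"
      unfolding \<A>_def
    proof (intro CollectI conjI ballI)
      show "I \<subseteq> R" unfolding I_def using PD(1) add mult a(1) by blast
      show "q \<in> I" unfolding I_def using PD(2) zero by force
      show "1 \<notin> I" unfolding I_def using neg by fastforce
      show "x - y \<in> I" if xy: "x \<in> I" "y \<in> I" for x y
      proof -
        obtain p r p' r' where "x = p + r * a" "y = p' + r' * a" "p \<in> P" "p' \<in> P" "r \<in> R" "r' \<in> R"
          using xy unfolding I_def by blast
        then have "x - y = (p - p') + (r - r') * a" "p - p' \<in> P" "r - r' \<in> R"
          by (auto simp: left_diff_distrib PD(4) diff)
        then show ?thesis unfolding I_def by blast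
      qed
      show "s * x \<in> I" if sx: "s \<in> R" "x \<in> I" for s x
      proof -
        obtain p r where "x = p + r * a" "p \<in> P" "r \<in> R" using sx unfolding I_def by blast
        then have "s * x = s * p + (s * r) * a" "s * p \<in> P" "s * r \<in> R"
          using sx by (auto simp: distrib_left mult.assoc PD(5) mult)
        then show ?thesis unfolding I_def by blast
      qed
    qed
    moreover have "P \<subseteq> I" unfolding I_def using zero by force
    ultimately have "I = P" by (rule max)
    moreover have "a \<in> I" unfolding I_def using P0 one by force
    ultimately show False using a(2) by simp
  qed
  have "x \<in> P \<or> y \<in> P" if xy: "x \<in> R" "y \<in> R" "x * y \<in> P" for x y
  proof (rule ccontr)
    assume "\<not> ?thesis"
    then obtain p r p' r' where pr: "p \<in> P" "r \<in> R" "p + r * x = 1" "p' \<in> P" "r' \<in> R" "p' + r' * y = 1"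
      using ext xy by metis
    have "1 = (p + r * x) * (p' + r' * y)" using pr by simp
    also have "\<dots> = (p' + r' * y) * p + ((r * x) * p' + (r * r') * (x * y))" by (simp add: algebra_simps)
    also have "\<dots> \<in> P"
    proof -
      have "p' + r' * y \<in> R" using pr xy PD(1) add mult by blast
      then have "(p' + r' * y) * p \<in> P" using PD(5) pr by blast
      moreover have "(r * x) * p' \<in> P" "(r * r') * (x * y) \<in> P" using PD(5) mult pr xy by blast+
      ultimately show ?thesis using Padd by blast
    qed
    finally show False using PD(3) by simp
  qed
  then have "prime_ideal_of R P" using PD P0 by (auto simp: prime_ideal_of_def)
  then show ?thesis using PD(2) by blast
qed

subsection \<open>Subfields of the complex numbers\<close>

lemma CC_simps [simp]:
  "carrier \<CC> = UNIV" "x \<otimes>\<^bsub>\<CC>\<^esub> y = x * y" "x \<oplus>\<^bsub>\<CC>\<^esub> y = x + y" "\<one>\<^bsub>\<CC>\<^esub> = 1" "\<zero>\<^bsub>\<CC>\<^esub> = 0"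
  by (simp_all add: ring_of_type_algebra_def)

lemma CC_field: "field \<CC>" by (rule field_from_type_algebra)
lemma CC_ring: "ring \<CC>" by (rule ring_from_type_algebra)

lemma CC_uminus: "\<ominus>\<^bsub>\<CC>\<^esub> x = - x"
proof -
  interpret ring \<CC> by (rule CC_ring)
  show ?thesis by (rule minus_equality) simp_all
qed

lemma CC_inverse: "x \<noteq> 0 \<Longrightarrow> inv\<^bsub>\<CC>\<^esub> x = inverse x"
proof -
  interpret field \<CC> by (rule CC_field)
  assume "x \<noteq> 0"
  then show ?thesis by (intro comm_inv_char) simp_all
qed

text \<open>Closure under \<open>inverse\<close> carries no nonzero condition because
  \<open>inverse 0 = 0\<close>.\<close>

definition complex_subfield :: "complex set \<Rightarrow> bool"
  where "complex_subfield K \<longleftrightarrow>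
    1 \<in> K \<and> (\<forall>x\<in>K. \<forall>y\<in>K. x - y \<in> K \<and> x * y \<in> K) \<and> (\<forall>x\<in>K. inverse x \<in> K)"

lemma complex_subfieldD:
  assumes "complex_subfield K"
  shows "1 \<in> K" "0 \<in> K" "x \<in> K \<Longrightarrow> y \<in> K \<Longrightarrow> x + y \<in> K" "x \<in> K \<Longrightarrow> y \<in> K \<Longrightarrow> x - y \<in> K"
    "x \<in> K \<Longrightarrow> y \<in> K \<Longrightarrow> x * y \<in> K" "x \<in> K \<Longrightarrow> inverse x \<in> K" "x \<in> K \<Longrightarrow> - x \<in> K"
    "x \<in> K \<Longrightarrow> y \<in> K \<Longrightarrow> x / y \<in> K"
proof -
  have d: "a - b \<in> K" "a * b \<in> K" if "a \<in> K" "b \<in> K" for a b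
    using assms that by (auto simp: complex_subfield_def)
  show one: "1 \<in> K" using assms by (simp add: complex_subfield_def)
  show zero: "0 \<in> K" using d(1)[OF one one] by simp
  have neg: "- a \<in> K" if "a \<in> K" for a using d(1)[OF zero that] by simp
  have inv: "inverse a \<in> K" if "a \<in> K" for a using assms that by (simp add: complex_subfield_def)
  show "x + y \<in> K" if "x \<in> K" "y \<in> K" using d(1)[OF that(1) neg[OF that(2)]] by simp
  show "x / y \<in> K" if "x \<in> K" "y \<in> K" using d(2)[OF that(1) inv[OF that(2)]] by (simp add: divide_inverse)
  show "x \<in> K \<Longrightarrow> y \<in> K \<Longrightarrow> x - y \<in> K" "x \<in> K \<Longrightarrow> y \<in> K \<Longrightarrow> x * y \<in> K"
    "x \<in> K \<Longrightarrow> inverse x \<in> K" "x \<in> K \<Longrightarrow> - x \<in> K"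
    using d neg inv by auto
qed

lemma subfield_CC_iff: "subfield K \<CC> \<longleftrightarrow> complex_subfield K"
proof
  interpret field \<CC> by (rule CC_field)
  assume K: "subfield K \<CC>"
  note sr = subringE[OF subfieldE(1)[OF K], unfolded CC_simps]
  have "x - y \<in> K" if "x \<in> K" "y \<in> K" for x y
    using sr(7)[OF that(1) sr(5)[OF that(2)]] by (simp add: CC_uminus)
  moreover have "inverse x \<in> K" if "x \<in> K" for x
  proof (cases "x = 0")
    case False
    then have "inv\<^bsub>\<CC>\<^esub> x \<in> K" using subfield_m_inv(1)[OF K, of x] that by simp
    then show ?thesis using False by (simp add: CC_inverse)
  qed (use that in simp)
  ultimately show "complex_subfield K" using sr by (auto simp: complex_subfield_def)
next
  interpret field \<CC> by (rule CC_field)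
  assume K: "complex_subfield K"
  note D = complex_subfieldD[OF K]
  have "subring K \<CC>"
    by (rule subringI) (use D in \<open>auto simp: CC_uminus\<close>)
  then show "subfield K \<CC>"
    by (rule subfieldI') (use D in \<open>auto simp: CC_inverse\<close>)
qed

lemma complex_subfield_sum:
  "complex_subfield K \<Longrightarrow> (\<And>i. i \<in> I \<Longrightarrow> f i \<in> K) \<Longrightarrow> sum f I \<in> K"
  by (induction I rule: infinite_finite_induct) (auto simp: complex_subfieldD)

lemma complex_subfield_prod:
  "complex_subfield K \<Longrightarrow> (\<And>i. i \<in> I \<Longrightarrow> f i \<in> K) \<Longrightarrow> prod f I \<in> K"
  by (induction I rule: infinite_finite_induct) (auto simp: complex_subfieldD)

lemma complex_subfield_power: "complex_subfield K \<Longrightarrow> x \<in> K \<Longrightarrow> x ^ n \<in> K"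
  by (induction n) (auto simp: complex_subfieldD)

lemma complex_subfield_of_nat: "complex_subfield K \<Longrightarrow> of_nat n \<in> K"
  by (induction n) (auto simp: complex_subfieldD)

lemma complex_subfield_of_int: "complex_subfield K \<Longrightarrow> of_int n \<in> K"
  using complex_subfield_of_nat complex_subfieldD(7) by (cases n rule: int_cases2) auto

lemma complex_subfield_of_rat: "complex_subfield K \<Longrightarrow> of_rat r \<in> K"
  by (cases r) (simp add: of_rat_rat complex_subfieldD(8) complex_subfield_of_int)

lemma complex_subfield_Rats: "complex_subfield K \<Longrightarrow> \<rat> \<subseteq> K"
  using complex_subfield_of_rat by (auto elim!: Rats_cases)

lemma complex_subfield_rat: "complex_subfield \<rat>"
  by (auto simp: complex_subfield_def)

definition rpoly :: "rat poly \<Rightarrow> complex \<Rightarrow> complex"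
  where "rpoly p z = poly (map_poly of_rat p) z"

lemma rpoly_simps [simp]:
  "rpoly (p + q) z = rpoly p z + rpoly q z" "rpoly (p * q) z = rpoly p z * rpoly q z"
  "rpoly (p - q) z = rpoly p z - rpoly q z" "rpoly (- p) z = - rpoly p z"
  "rpoly 0 z = 0" "rpoly 1 z = 1" "rpoly [:c:] z = of_rat c" "rpoly [:0, 1:] z = z"
proof -
  have mult: "map_poly of_rat (p * q) = map_poly of_rat p * (map_poly of_rat q :: complex poly)" for p q
    by (intro poly_eqI) (simp add: coeff_map_poly coeff_mult of_rat_sum of_rat_mult)
  have diff: "map_poly of_rat (p - q) = map_poly of_rat p - (map_poly of_rat q :: complex poly)" for p q
    by (intro poly_eqI) (simp add: coeff_map_poly of_rat_diff)
  have add: "map_poly of_rat (p + q) = map_poly of_rat p + (map_poly of_rat q :: complex poly)" for p q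
    by (intro poly_eqI) (simp add: coeff_map_poly of_rat_add)
  have minus: "map_poly of_rat (- p) = - (map_poly of_rat p :: complex poly)" for p
    by (intro poly_eqI) (simp add: coeff_map_poly of_rat_minus)
  show "rpoly (p + q) z = rpoly p z + rpoly q z" "rpoly (p * q) z = rpoly p z * rpoly q z"
    "rpoly (p - q) z = rpoly p z - rpoly q z" "rpoly (- p) z = - rpoly p z"
    by (simp_all add: rpoly_def mult diff add minus)
  have "map_poly of_rat [:c:] = [:of_rat c :: complex:]" "map_poly of_rat [:0, 1:] = [:0, 1 :: complex:]"
    by (intro poly_eqI; simp add: coeff_map_poly coeff_pCons split: nat.splits)+
  then show "rpoly [:c:] z = of_rat c" "rpoly [:0, 1:] z = z" by (simp_all add: rpoly_def)
qed (simp_all add: rpoly_def)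

lemma rpoly_smult [simp]: "rpoly (smult c p) z = of_rat c * rpoly p z"
  using rpoly_simps(2)[of "[:c:]" p z] by simp

lemma rpoly_altdef: "rpoly p z = (\<Sum>i\<le>Polynomial.degree p. of_rat (coeff p i) * z ^ i)"
  by (simp add: rpoly_def poly_altdef)

lemma rpoly_in_subfield: "complex_subfield K \<Longrightarrow> z \<in> K \<Longrightarrow> rpoly p z \<in> K"
  unfolding rpoly_altdef
  by (intro complex_subfield_sum complex_subfieldD(5) complex_subfield_of_rat complex_subfield_power)

lemma rational_poly_obtain:
  fixes P :: "complex poly"
  assumes "\<And>i. coeff P i \<in> \<rat>"
  obtains p where "P = map_poly of_rat p"
proof -
  define p where "p = Abs_poly (\<lambda>i. inv_into UNIV of_rat (coeff P i) :: rat)"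
  have inv: "of_rat (inv_into UNIV of_rat (coeff P i)) = coeff P i" for i
    using assms[of i] by (intro f_inv_into_f) (simp add: Rats_def)
  have "inv_into UNIV of_rat (0 :: complex) = (0 :: rat)"
    using inv_f_f[of "of_rat :: rat \<Rightarrow> complex" 0] by (simp add: inj_def)
  then have "\<forall>\<^sub>\<infinity>i. inv_into UNIV of_rat (coeff P i) = (0 :: rat)"
    by (intro eventually_mono[OF MOST_coeff_eq_0[of P]]) simp
  then have "coeff p i = inv_into UNIV of_rat (coeff P i)" for i by (simp add: p_def Abs_poly_inverse)
  then have "P = map_poly of_rat p" by (intro poly_eqI) (simp add: inv coeff_map_poly)
  then show thesis by (rule that)
qed

definition Qadj :: "complex \<Rightarrow> complex set"
  where "Qadj a = range (\<lambda>p. rpoly p a)"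

definition algebraic_rat :: "complex \<Rightarrow> bool"
  where "algebraic_rat a \<longleftrightarrow> (\<exists>p. p \<noteq> 0 \<and> rpoly p a = 0)"

lemma algebraic_rat_if_algebraic_int: "algebraic_int a \<Longrightarrow> algebraic_rat a"
proof -
  assume "algebraic_int a"
  then obtain p :: "int poly" where p: "poly (map_poly of_int p) a = 0" "lead_coeff p = 1"
    unfolding algebraic_int_altdef_ipoly by blast
  have "rpoly (map_poly of_int p) a = 0"
    using p(1) by (simp add: rpoly_def map_poly_map_poly comp_def)
  moreover have "map_poly of_int p \<noteq> (0 :: rat poly)" using p(2) by (auto simp: hom_distribs)
  ultimately show ?thesis unfolding algebraic_rat_def by blast
qed

lemma ex_min_poly:
  assumes "algebraic_rat a"
  shows "\<exists>m. m \<noteq> 0 \<and> (\<forall>p. rpoly p a = 0 \<longleftrightarrow> m dvd p)"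
proof -
  let ?Q = "\<lambda>p. p \<noteq> 0 \<and> rpoly p a = 0"
  obtain m where m: "?Q m" "\<And>p. ?Q p \<Longrightarrow> Polynomial.degree m \<le> Polynomial.degree p"
    using assms ex_has_least_nat[of ?Q _ Polynomial.degree] unfolding algebraic_rat_def by metis
  have "m dvd p" if "rpoly p a = 0" for p
  proof (rule ccontr)
    assume "\<not> m dvd p"
    then have ne: "p mod m \<noteq> 0" by (simp add: dvd_eq_mod_eq_0)
    have "rpoly (p mod m) a = rpoly (p - p div m * m) a" by (simp add: minus_div_mult_eq_mod)
    then have "rpoly (p mod m) a = 0" using m(1) that by simp
    then have "Polynomial.degree m \<le> Polynomial.degree (p mod m)" using m(2) ne by blast
    moreover have "Polynomial.degree (p mod m) < Polynomial.degree m"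
      using degree_mod_less[of m p] m(1) ne by auto
    ultimately show False by simp
  qed
  moreover have "rpoly p a = 0" if "m dvd p" for p using that m(1) by (auto elim!: dvdE)
  ultimately show ?thesis using m(1) by blast
qed

text \<open>As gcd(p, m) does not vanish at \<open>a\<close>, its cofactor in m does. So m divides
  this cofactor, and the gcd is a unit.\<close>

lemma bezout_min_poly:
  assumes m: "m \<noteq> 0" "\<And>p. rpoly p a = 0 \<longleftrightarrow> m dvd p" and p: "rpoly p a \<noteq> 0"
  obtains u v where "u * p + v * m = 1"
proof -
  obtain u v where uv: "u * p + v * m = gcd p m"
    using bezout_coefficients_fst_snd[of p m] by blast
  obtain e where e: "m = gcd p m * e" using gcd_dvd2[of p m] by (elim dvdE)
  have "rpoly (gcd p m) a \<noteq> 0"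
    using m(2) p dvd_trans[OF _ gcd_dvd1[of p m]] by blast
  moreover have "rpoly m a = 0" using m(2) by simp
  ultimately have "rpoly e a = 0" using e rpoly_simps(2)[of "gcd p m" e a] by simp
  then obtain k where "e = m * k" using m(2) by (auto elim: dvdE)
  then have "m * 1 = m * (gcd p m * k)" using e by (simp add: ac_simps)
  then have "gcd p m * k = 1" using m(1) by (simp only: mult_cancel_left) simp
  then have "(k * u) * p + (k * v) * m = 1" using uv by (metis (no_types, lifting) distrib_left mult.assoc mult.commute)
  then show thesis by (rule that)
qed

lemma Qadj_base: "a \<in> Qadj a" "of_rat r \<in> Qadj a"
  unfolding Qadj_def using rpoly_simps(7,8) by (metis rangeI)+

lemma Qadj_subfield:
  assumes "algebraic_rat a"
  shows "complex_subfield (Qadj a)"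
proof -
  obtain m where m: "m \<noteq> 0" "\<And>p. rpoly p a = 0 \<longleftrightarrow> m dvd p" using ex_min_poly[OF assms] by blast
  have "inverse x \<in> Qadj a" if xQ: "x \<in> Qadj a" for x
  proof (cases "x = 0")
    case True then show ?thesis using xQ by simp
  next
    case False
    obtain p where p: "x = rpoly p a" using xQ by (auto simp: Qadj_def)
    obtain u v where uv: "u * p + v * m = 1"
      using bezout_min_poly[OF m, of p] False p by blast
    have "rpoly (u * p + v * m) a = 1" unfolding uv by simp
    then have "rpoly u a * x = 1" using m(2)[of m] p by simp
    then have "inverse x = rpoly u a" by (metis inverse_unique mult.commute)
    then show ?thesis by (simp add: Qadj_def)
  qed
  moreover have "x - y \<in> Qadj a" "x * y \<in> Qadj a" if xy: "x \<in> Qadj a" "y \<in> Qadj a" for x y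
  proof -
    obtain p q where "x = rpoly p a" "y = rpoly q a" using xy by (auto simp: Qadj_def)
    then have "x - y = rpoly (p - q) a" "x * y = rpoly (p * q) a" by simp_all
    then show "x - y \<in> Qadj a" "x * y \<in> Qadj a" unfolding Qadj_def by blast+
  qed
  moreover have "1 \<in> Qadj a" using Qadj_base(2)[of 1] by simp
  ultimately show ?thesis by (simp add: complex_subfield_def)
qed

lemma Qadj_least: "complex_subfield K \<Longrightarrow> a \<in> K \<Longrightarrow> Qadj a \<subseteq> K"
  using rpoly_in_subfield by (auto simp: Qadj_def)

subsection \<open>Primitive elements\<close>

definition coeffs_in :: "complex set \<Rightarrow> complex poly \<Rightarrow> bool"
  where "coeffs_in K p \<longleftrightarrow> (\<forall>i. coeff p i \<in> K)"

lemma coeffs_in_mult: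
  "complex_subfield K \<Longrightarrow> coeffs_in K p \<Longrightarrow> coeffs_in K q \<Longrightarrow> coeffs_in K (p * q)"
  by (auto simp: coeffs_in_def coeff_mult intro!: complex_subfield_sum complex_subfieldD(5))

lemma coeffs_in_diff:
  "complex_subfield K \<Longrightarrow> coeffs_in K p \<Longrightarrow> coeffs_in K q \<Longrightarrow> coeffs_in K (p - q)"
  by (auto simp: coeffs_in_def complex_subfieldD)

lemma coeffs_in_add:
  "complex_subfield K \<Longrightarrow> coeffs_in K p \<Longrightarrow> coeffs_in K q \<Longrightarrow> coeffs_in K (p + q)"
  by (auto simp: coeffs_in_def complex_subfieldD)

lemma coeffs_in_const: "complex_subfield K \<Longrightarrow> c \<in> K \<Longrightarrow> coeffs_in K [:c:]"
  by (auto simp: coeffs_in_def coeff_pCons complex_subfieldD split: nat.splits)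

lemma coeffs_in_rat: "complex_subfield K \<Longrightarrow> coeffs_in K (map_poly of_rat p)"
  by (auto simp: coeffs_in_def coeff_map_poly complex_subfield_of_rat)

lemma coeffs_in_linear: "complex_subfield K \<Longrightarrow> a \<in> K \<Longrightarrow> b \<in> K \<Longrightarrow> coeffs_in K [:a, b:]"
  by (auto simp: coeffs_in_def coeff_pCons complex_subfieldD split: nat.splits)

lemma coeffs_in_monom: "complex_subfield K \<Longrightarrow> c \<in> K \<Longrightarrow> coeffs_in K (Polynomial.monom c n)"
  by (auto simp: coeffs_in_def complex_subfieldD)

lemma coeffs_in_pcompose:
  assumes K: "complex_subfield K" and p: "coeffs_in K p" and q: "coeffs_in K q"
  shows "coeffs_in K (pcompose p q)"
  using p
proof (induction p)
  case 0 then show ?case by (simp add: coeffs_in_def complex_subfieldD[OF K])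
next
  case (pCons a p)
  have "a \<in> K" using pCons(3) unfolding coeffs_in_def by (metis coeff_pCons_0)
  moreover have "coeffs_in K p" using pCons(3) unfolding coeffs_in_def by (metis coeff_pCons_Suc)
  ultimately show ?case
    unfolding pcompose_pCons using pCons(2) K q by (intro coeffs_in_add coeffs_in_const coeffs_in_mult)
qed

text \<open>The minimal polynomial \<open>m\<close> of \<open>b\<close> over \<open>K\<close> divides all \<open>g\<close> below, so \<open>b\<close> is its only root:
  \<open>m\<close> is a power of \<open>x - b\<close>, and its second highest coefficient puts \<open>b\<close> into \<open>K\<close>.\<close>

lemma mem_subfield_if_unique_common_root:
  assumes K: "complex_subfield K" and g: "coeffs_in K g1" "coeffs_in K g2" "g1 \<noteq> 0"
    and root: "poly g1 b = 0" "poly g2 b = 0"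
    and unique: "\<And>z. poly g1 z = 0 \<Longrightarrow> poly g2 z = 0 \<Longrightarrow> z = b"
  shows "b \<in> K"
proof -
  note KD = complex_subfieldD[OF K]
  let ?Q = "\<lambda>p. p \<noteq> 0 \<and> coeffs_in K p \<and> poly p b = 0"
  obtain m0 where m0: "?Q m0" "\<And>p. ?Q p \<Longrightarrow> Polynomial.degree m0 \<le> Polynomial.degree p"
    using g root ex_has_least_nat[of ?Q g1 Polynomial.degree] by metis
  define m where "m = [:inverse (lead_coeff m0):] * m0"
  have lc: "lead_coeff m0 \<noteq> 0" using m0(1) by simp
  have "lead_coeff m0 \<in> K" using m0(1) by (simp add: coeffs_in_def)
  then have mK: "coeffs_in K m" unfolding m_def
    using m0(1) K by (intro coeffs_in_mult coeffs_in_const KD(6)) auto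
  have mlc: "lead_coeff m = 1" using lc by (simp add: m_def lead_coeff_mult)
  have mdeg: "Polynomial.degree m = Polynomial.degree m0" using lc by (simp add: m_def)
  have mb: "poly m b = 0" using m0(1) by (simp add: m_def)
  \<comment> \<open>Division with remainder by the monic m, carried out by induction on the degree
    since K is a set and not a type. Minimality of m lets a multiple q of m cancel the leading
    term.\<close>
  have dvd: "m dvd p" if "coeffs_in K p" "poly p b = 0" for p
    using that
  proof (induction "Polynomial.degree p" arbitrary: p rule: less_induct)
    case less
    show ?case
    proof (cases "p = 0")
      case False
      let ?d = "Polynomial.degree p - Polynomial.degree m"
      define q where "q = Polynomial.monom (lead_coeff p) ?d * m"
      have le: "Polynomial.degree m \<le> Polynomial.degree p"
        using m0(2)[of p] less False by (simp add: mdeg)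
      have lp: "lead_coeff p \<noteq> 0" using False by simp
      have m_ne: "m \<noteq> 0" using mlc by auto
      have qdeg: "Polynomial.degree q = Polynomial.degree p"
      proof -
        have "Polynomial.degree q = Polynomial.degree (Polynomial.monom (lead_coeff p) ?d) + Polynomial.degree m"
          unfolding q_def using lp m_ne by (intro degree_mult_eq) (simp_all add: monom_eq_0_iff)
        then show ?thesis using le by (simp only: degree_monom_eq[OF lp])
      qed
      have qlc: "lead_coeff q = lead_coeff p"
      proof -
        have "lead_coeff (Polynomial.monom (lead_coeff p) ?d) = lead_coeff p"
          unfolding degree_monom_eq[OF lp] by simp
        then show ?thesis unfolding q_def lead_coeff_mult mlc by simp
      qed
      have pqK: "coeffs_in K (p - q)"
        unfolding q_def using less(2) mK K by (intro coeffs_in_diff coeffs_in_mult coeffs_in_monom) (auto simp: coeffs_in_def)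
      have pq0: "poly (p - q) b = 0" using less(3) mb by (simp add: q_def)
      have "m dvd p - q"
      proof (cases "p - q = 0")
        case True then show ?thesis by simp
      next
        case ne: False
        have "coeff (p - q) (Polynomial.degree p) = 0" using qlc qdeg by simp
        moreover have "Polynomial.degree (p - q) \<le> Polynomial.degree p" using qdeg by (intro degree_diff_le) auto
        ultimately have "Polynomial.degree (p - q) < Polynomial.degree p"
          using ne by (metis leading_coeff_neq_0 le_neq_implies_less)
        then show ?thesis using less(1) pqK pq0 by blast
      qed
      moreover have "m dvd q" by (simp add: q_def)
      ultimately show ?thesis by (metis dvd_add diff_add_cancel)
    qed simp
  qed
  have roots: "z = b" if "poly m z = 0" for z
    using unique[of z] that dvd[OF g(1) root(1)] dvd[OF g(2) root(2)] by (metis dvd_trans poly_eq_0_iff_dvd)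
  obtain k where k: "m = [:- b, 1:] ^ k"
  proof -
    obtain as where as: "smult (lead_coeff m) (\<Prod>a\<leftarrow>as. [:- a, 1:]) = m" "length as = Polynomial.degree m"
      using fundamental_theorem_algebra_factorized[of m] by blast
    have "set as \<subseteq> {b}"
    proof
      fix a assume a: "a \<in> set as"
      have "poly m a = 0"
        using a by (subst as(1)[symmetric]) (auto simp: poly_prod_list prod_list_zero_iff)
      then show "a \<in> {b}" using roots by simp
    qed
    then have "as = replicate (length as) b" by (metis replicate_eqI singletonD subsetD)
    then have "(\<Prod>a\<leftarrow>as. [:- a, 1:]) = [:- b, 1:] ^ length as" by (metis map_replicate prod_list_replicate)
    then show thesis using that[of "length as"] as(1) mlc by simp
  qed
  have "k > 0" using mb k by (cases k) auto
  have "coeff m (k - 1) = - of_nat k * b"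
  proof -
    have "k choose (k - 1) = k" using \<open>k > 0\<close> by (cases k) simp_all
    then show ?thesis unfolding k using \<open>k > 0\<close> by (simp add: coeff_linear_poly_power)
  qed
  then have "- (coeff m (k - 1)) / of_nat k = b" using \<open>k > 0\<close> by (simp add: field_simps)
  moreover have "- (coeff m (k - 1)) / of_nat k \<in> K"
    using mK KD complex_subfield_of_nat[OF K] by (auto simp: coeffs_in_def)
  ultimately show ?thesis by simp
qed

text \<open>With t = a + c b, the polynomials q(X) and p(t - c X) share the root b. Another common
  root would make c a quotient (a' - a) / (b - b') with roots a' of p and b' of q; \<open>B\<close>
  collects these finitely many values.\<close>

lemma primitive_element_two:
  assumes a: "algebraic_rat a" and b: "algebraic_rat b"
    and sum: "\<And>c :: nat. algebraic_rat (a + of_nat c * b)"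
  shows "\<exists>c :: nat. a \<in> Qadj (a + of_nat c * b) \<and> b \<in> Qadj (a + of_nat c * b)"
proof -
  obtain p q where p: "p \<noteq> 0" "rpoly p a = 0" and q: "q \<noteq> 0" "rpoly q b = 0"
    using a b by (auto simp: algebraic_rat_def)
  let ?p = "map_poly of_rat p :: complex poly" and ?q = "map_poly of_rat q :: complex poly"
  have ne: "?p \<noteq> 0" "?q \<noteq> 0" using p q by (simp_all add: hom_distribs)
  define B where "B = (\<lambda>(z, w). (z - a) / (b - w)) ` ({z. poly ?p z = 0} \<times> {w. poly ?q w = 0})"
  have "finite B" unfolding B_def using poly_roots_finite[OF ne(1)] poly_roots_finite[OF ne(2)] by simp
  then have "finite {c :: nat. of_nat c \<in> B}" by (intro finite_inverse_image) (auto simp: inj_on_def)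
  then obtain c :: nat where c: "of_nat c \<notin> B" using infinite_UNIV_nat by (metis UNIV_eq_I mem_Collect_eq)
  let ?t = "a + of_nat c * b"
  let ?K = "Qadj ?t"
  have K: "complex_subfield ?K" by (rule Qadj_subfield[OF sum])
  note KD = complex_subfieldD[OF K]
  have t: "?t \<in> ?K" by (rule Qadj_base)
  have bK: "b \<in> ?K"
  proof (rule mem_subfield_if_unique_common_root[OF K, of ?q "pcompose ?p [:?t, - of_nat c:]"])
    show "coeffs_in ?K ?q" by (rule coeffs_in_rat[OF K])
    show "coeffs_in ?K (pcompose ?p [:?t, - of_nat c:])"
      by (intro coeffs_in_pcompose coeffs_in_rat coeffs_in_linear K t KD(7) complex_subfield_of_nat)
    show "?q \<noteq> 0" by (rule ne)
    show "poly ?q b = 0" using q by (simp add: rpoly_def)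
    show "poly (pcompose ?p [:?t, - of_nat c:]) b = 0" using p by (simp add: poly_pcompose rpoly_def)
    fix z assume z: "poly ?q z = 0" "poly (pcompose ?p [:?t, - of_nat c:]) z = 0"
    show "z = b"
    proof (rule ccontr)
      assume "z \<noteq> b"
      let ?a' = "?t - of_nat c * z"
      have "poly ?p ?a' = 0" using z(2) by (simp add: poly_pcompose algebra_simps)
      then have "(?a' - a) / (b - z) \<in> B" using z(1) unfolding B_def by force
      moreover have "?a' - a = of_nat c * (b - z)" by (simp add: algebra_simps)
      ultimately show False using c \<open>z \<noteq> b\<close> by simp
    qed
  qed
  have "?t - of_nat c * b \<in> ?K" using t bK KD(4,5) complex_subfield_of_nat[OF K] by blast
  then have "a \<in> ?K" by simp
  then show ?thesis using bK by blast
qed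

text \<open>Natural coefficients keep the generator an algebraic integer and ensure that an
  automorphism fixing A pointwise fixes the generator.\<close>

lemma ex_primitive_element:
  assumes "finite A" "\<And>a. a \<in> A \<Longrightarrow> algebraic_int a"
  shows "\<exists>c :: complex \<Rightarrow> nat. A \<subseteq> Qadj (\<Sum>a\<in>A. of_nat (c a) * a)"
  using assms
proof (induction A)
  case empty then show ?case by simp
next
  case (insert b A)
  obtain c :: "complex \<Rightarrow> nat" where c: "A \<subseteq> Qadj (\<Sum>a\<in>A. of_nat (c a) * a)" using insert by auto
  let ?g = "\<Sum>a\<in>A. of_nat (c a) * a"
  have nat_int: "algebraic_int (of_nat k :: complex)" for k
    using algebraic_int_of_int[of "int k"] by simp
  have ai: "algebraic_int ?g" "algebraic_int b"
    using insert(4) by (auto intro!: algebraic_int_sum algebraic_int_add_mult(2) nat_int)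
  have "algebraic_rat (?g + of_nat k * b)" for k
    by (intro algebraic_rat_if_algebraic_int algebraic_int_add_mult ai nat_int)
  then obtain k :: nat where k: "?g \<in> Qadj (?g + of_nat k * b)" "b \<in> Qadj (?g + of_nat k * b)"
      and alg: "algebraic_rat (?g + of_nat k * b)"
    using primitive_element_two[OF algebraic_rat_if_algebraic_int[OF ai(1)] algebraic_rat_if_algebraic_int[OF ai(2)]] by blast
  have "insert b A \<subseteq> Qadj (?g + of_nat k * b)"
    using c k Qadj_least[OF Qadj_subfield[OF alg] k(1)] by blast
  moreover have "?g + of_nat k * b = (\<Sum>a\<in>insert b A. of_nat ((c(b := k)) a) * a)"
    using insert(1,2) by (simp add: add.commute, intro sum.cong) auto
  ultimately show ?case by metis
qed

subsection \<open>Galois groups over the rationals\<close>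

lemma poly_eq_sum_le:
  fixes p :: "'a :: comm_semiring_1 poly"
  assumes "Polynomial.degree p \<le> n"
  shows "poly p z = (\<Sum>i\<le>n. coeff p i * z ^ i)"
  unfolding poly_altdef using assms
  by (intro sum.mono_neutral_left) (auto simp: coeff_eq_0)

lemma rpoly_pCons: "rpoly (pCons c p) z = of_rat c + z * rpoly p z"
  by (cases "pCons c p = 0") (auto simp: rpoly_def map_poly_pCons)

lemma rpoly_pcompose: "rpoly (pcompose q p) z = rpoly q (rpoly p z)"
  by (induction q) (simp_all add: pcompose_pCons rpoly_pCons)

lemma hom_of_rat:
  assumes K: "complex_subfield K" and one: "\<sigma> 1 = (1 :: complex)"
    and add: "\<And>x y. x \<in> K \<Longrightarrow> y \<in> K \<Longrightarrow> \<sigma> (x + y) = \<sigma> x + \<sigma> y"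
    and mult: "\<And>x y. x \<in> K \<Longrightarrow> y \<in> K \<Longrightarrow> \<sigma> (x * y) = \<sigma> x * \<sigma> y"
  shows "\<sigma> (of_rat r) = of_rat r"
proof -
  note D = complex_subfieldD[OF K]
  have zero: "\<sigma> 0 = 0" using add[OF D(2,2)] by simp
  have nat: "\<sigma> (of_nat n) = of_nat n" for n
    by (induction n) (simp_all add: zero one add D(1) complex_subfield_of_nat[OF K])
  have int: "\<sigma> (of_int n) = of_int n" for n
  proof (cases n rule: int_cases2)
    case (nonpos k)
    have "\<sigma> (of_nat k) + \<sigma> (- of_nat k) = 0"
      using add[OF complex_subfield_of_nat[OF K] D(7)[OF complex_subfield_of_nat[OF K]], of k k] zero by simp
    then show ?thesis by (simp add: nonpos nat add_eq_0_iff)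
  qed (simp add: nat)
  obtain a b where r: "r = Rat.Fract a b" "b > 0" by (cases r)
  have q: "of_rat r * of_int b = (of_int a :: complex)" using r by (simp add: of_rat_rat)
  have "\<sigma> (of_rat r) * of_int b = \<sigma> (of_rat r * of_int b)"
    using mult[OF complex_subfield_of_rat[OF K] complex_subfield_of_int[OF K]] by (simp add: int)
  also have "\<dots> = of_rat r * of_int b" by (simp add: q int)
  finally show ?thesis using r(2) by simp
qed

lemma hom_rpoly:
  assumes K: "complex_subfield K" and one: "\<sigma> 1 = (1 :: complex)"
    and add: "\<And>x y. x \<in> K \<Longrightarrow> y \<in> K \<Longrightarrow> \<sigma> (x + y) = \<sigma> x + \<sigma> y"
    and mult: "\<And>x y. x \<in> K \<Longrightarrow> y \<in> K \<Longrightarrow> \<sigma> (x * y) = \<sigma> x * \<sigma> y" and x: "x \<in> K"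
  shows "\<sigma> (rpoly p x) = rpoly p (\<sigma> x)"
proof (induction p)
  case 0
  show ?case using hom_of_rat[OF assms(1-4), of 0] by simp
next
  case (pCons c p)
  have r: "rpoly p x \<in> K" by (rule rpoly_in_subfield[OF K x])
  have "\<sigma> (of_rat c + x * rpoly p x) = \<sigma> (of_rat c) + \<sigma> x * \<sigma> (rpoly p x)"
    using add[OF complex_subfield_of_rat[OF K] complex_subfieldD(5)[OF K x r]] mult[OF x r] by simp
  then show ?case using pCons hom_of_rat[OF assms(1-4)] by (simp add: rpoly_pCons)
qed

lemma Gal_iff:
  assumes "complex_subfield L" "1 \<in> F" "F \<subseteq> L"
  shows "\<sigma> \<in> carrier (Gal L F) \<longleftrightarrow> \<sigma> \<in> extensional L \<and> bij_betw \<sigma> L L \<and>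
    (\<forall>x\<in>L. \<forall>y\<in>L. \<sigma> (x + y) = \<sigma> x + \<sigma> y \<and> \<sigma> (x * y) = \<sigma> x * \<sigma> y) \<and> (\<forall>x\<in>F. \<sigma> x = x)"
proof
  assume "\<sigma> \<in> carrier (Gal L F)"
  then have s: "\<sigma> \<in> Ring.ring_hom (\<CC>\<lparr>carrier := L\<rparr>) (\<CC>\<lparr>carrier := L\<rparr>)" "\<sigma> \<in> Bij L" "\<forall>x\<in>F. \<sigma> x = x"
    by (auto simp: Gal_def ring_iso_def)
  have "\<sigma> (x + y) = \<sigma> x + \<sigma> y" "\<sigma> (x * y) = \<sigma> x * \<sigma> y" if "x \<in> L" "y \<in> L" for x y
    using ring_hom_add[OF s(1), of x y] ring_hom_mult[OF s(1), of x y] that by simp_all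
  then show "\<sigma> \<in> extensional L \<and> bij_betw \<sigma> L L \<and>
    (\<forall>x\<in>L. \<forall>y\<in>L. \<sigma> (x + y) = \<sigma> x + \<sigma> y \<and> \<sigma> (x * y) = \<sigma> x * \<sigma> y) \<and> (\<forall>x\<in>F. \<sigma> x = x)"
    using s by (simp add: Bij_def)
next
  assume s: "\<sigma> \<in> extensional L \<and> bij_betw \<sigma> L L \<and>
    (\<forall>x\<in>L. \<forall>y\<in>L. \<sigma> (x + y) = \<sigma> x + \<sigma> y \<and> \<sigma> (x * y) = \<sigma> x * \<sigma> y) \<and> (\<forall>x\<in>F. \<sigma> x = x)"
  then have img: "\<sigma> x \<in> L" if "x \<in> L" for x using that by (auto simp: bij_betw_def)
  have "\<sigma> \<in> Ring.ring_hom (\<CC>\<lparr>carrier := L\<rparr>) (\<CC>\<lparr>carrier := L\<rparr>)"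
    by (rule ring_hom_memI) (use s img assms(2) in simp_all)
  then show "\<sigma> \<in> carrier (Gal L F)" using s by (simp add: Gal_def ring_iso_def Bij_def)
qed

lemma GalD:
  assumes L: "complex_subfield L" and F: "\<rat> \<subseteq> F" "F \<subseteq> L" and s: "\<sigma> \<in> carrier (Gal L F)"
  shows "\<sigma> \<in> extensional L" "bij_betw \<sigma> L L"
    "x \<in> L \<Longrightarrow> y \<in> L \<Longrightarrow> \<sigma> (x + y) = \<sigma> x + \<sigma> y" "x \<in> L \<Longrightarrow> y \<in> L \<Longrightarrow> \<sigma> (x * y) = \<sigma> x * \<sigma> y"
    "x \<in> F \<Longrightarrow> \<sigma> x = x" "x \<in> L \<Longrightarrow> \<sigma> x \<in> L" "x \<in> L \<Longrightarrow> y \<in> L \<Longrightarrow> \<sigma> x = \<sigma> y \<longleftrightarrow> x = y"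
proof -
  have "1 \<in> F" using F by auto
  then have D: "\<sigma> \<in> extensional L \<and> bij_betw \<sigma> L L \<and>
    (\<forall>x\<in>L. \<forall>y\<in>L. \<sigma> (x + y) = \<sigma> x + \<sigma> y \<and> \<sigma> (x * y) = \<sigma> x * \<sigma> y) \<and> (\<forall>x\<in>F. \<sigma> x = x)"
    using s Gal_iff[OF L _ F(2)] by blast
  then show "\<sigma> \<in> extensional L" "bij_betw \<sigma> L L"
    "x \<in> L \<Longrightarrow> y \<in> L \<Longrightarrow> \<sigma> (x + y) = \<sigma> x + \<sigma> y" "x \<in> L \<Longrightarrow> y \<in> L \<Longrightarrow> \<sigma> (x * y) = \<sigma> x * \<sigma> y"
    "x \<in> F \<Longrightarrow> \<sigma> x = x" by blast+
  show "x \<in> L \<Longrightarrow> \<sigma> x \<in> L" using D by (auto simp: bij_betw_def)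
  show "x \<in> L \<Longrightarrow> y \<in> L \<Longrightarrow> \<sigma> x = \<sigma> y \<longleftrightarrow> x = y" using D by (auto simp: bij_betw_def inj_on_def)
qed

lemma Gal_mult:
  assumes "\<sigma> \<in> carrier (Gal L F)" "\<tau> \<in> carrier (Gal L F)" "x \<in> L"
  shows "(\<sigma> \<otimes>\<^bsub>Gal L F\<^esub> \<tau>) x = \<sigma> (\<tau> x)"
  using assms by (simp add: Gal_def BijGroup_def compose_def)

lemma Gal_one: "x \<in> L \<Longrightarrow> \<one>\<^bsub>Gal L F\<^esub> x = x"
  by (simp add: Gal_def BijGroup_def)

lemma Gal_eqI:
  assumes "complex_subfield L" "\<rat> \<subseteq> F" "F \<subseteq> L" "\<sigma> \<in> carrier (Gal L F)" "\<tau> \<in> carrier (Gal L F)"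
    "\<And>x. x \<in> L \<Longrightarrow> \<sigma> x = \<tau> x"
  shows "\<sigma> = \<tau>"
  using extensionalityI[of \<sigma> L \<tau>] GalD(1) assms by blast

lemma Gal_group: "complex_subfield L \<Longrightarrow> F \<subseteq> L \<Longrightarrow> group (Gal L F)"
  by (rule group_Gal) (simp_all add: subfield_CC_iff)

lemma Gal_inv:
  assumes L: "complex_subfield L" "F \<subseteq> L" and s: "\<sigma> \<in> carrier (Gal L F)" "x \<in> L"
  shows "(inv\<^bsub>Gal L F\<^esub> \<sigma>) (\<sigma> x) = x" "\<sigma> ((inv\<^bsub>Gal L F\<^esub> \<sigma>) x) = x"
proof -
  interpret group "Gal L F" by (rule Gal_group[OF L])
  show "(inv\<^bsub>Gal L F\<^esub> \<sigma>) (\<sigma> x) = x"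
    using Gal_mult[OF inv_closed[OF s(1)] s(1) s(2)] s Gal_one[OF s(2), of F] by simp
  show "\<sigma> ((inv\<^bsub>Gal L F\<^esub> \<sigma>) x) = x"
    using Gal_mult[OF s(1) inv_closed[OF s(1)] s(2)] s Gal_one[OF s(2), of F] by simp
qed

lemma complex_subfield_subalgebra:
  assumes K: "complex_subfield K" shows "subalgebra \<rat> K \<CC>"
proof -
  interpret field \<CC> by (rule CC_field)
  note D = complex_subfieldD[OF K]
  have "subgroup K (add_monoid \<CC>)"
  proof (rule add.subgroupI)
    show "K \<subseteq> carrier \<CC>" by simp
    show "K \<noteq> {}" using D(1) by blast
    show "\<ominus>\<^bsub>\<CC>\<^esub> x \<in> K" if "x \<in> K" for x using D(7)[OF that] by (simp add: CC_uminus)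
    show "x \<oplus>\<^bsub>\<CC>\<^esub> y \<in> K" if "x \<in> K" "y \<in> K" for x y using D(3)[OF that] by simp
  qed
  moreover have "subalgebra_axioms \<rat> K \<CC>"
  proof
    show "k \<otimes>\<^bsub>\<CC>\<^esub> v \<in> K" if "k \<in> \<rat>" "v \<in> K" for k v
      using D(5)[of k v] complex_subfield_Rats[OF K] that by auto
  qed
  ultimately show ?thesis by (rule subalgebra.intro)
qed

locale field_over_rat =
  fixes L :: "complex set"
  assumes L: "complex_subfield L"
begin

abbreviation "G \<equiv> Gal L \<rat>"

lemma rat_sub: "\<rat> \<subseteq> L" by (rule complex_subfield_Rats[OF L])

sublocale group G by (rule Gal_group[OF L rat_sub])

lemmas LD = complex_subfieldD[OF L]
lemmas G_D = GalD[OF L order_refl rat_sub]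
lemmas G_mult = Gal_mult[of _ L \<rat>]
lemmas G_one = Gal_one[of _ L \<rat>]
lemmas G_inv = Gal_inv[OF L rat_sub]
lemmas G_eqI = Gal_eqI[OF L order_refl rat_sub]

lemma G_uminus: "\<sigma> \<in> carrier G \<Longrightarrow> x \<in> L \<Longrightarrow> \<sigma> (- x) = - \<sigma> x"
proof -
  assume s: "\<sigma> \<in> carrier G" "x \<in> L"
  have "\<sigma> x + \<sigma> (- x) = \<sigma> (x + - x)" using G_D(3)[OF s(1,2) LD(7)[OF s(2)]] by (simp only:)
  also have "\<dots> = 0" using G_D(5)[OF s(1), of 0] by simp
  finally show ?thesis by (simp add: add_eq_0_iff)
qed

lemma G_diff: "\<sigma> \<in> carrier G \<Longrightarrow> x \<in> L \<Longrightarrow> y \<in> L \<Longrightarrow> \<sigma> (x - y) = \<sigma> x - \<sigma> y"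
  using G_D(3)[of \<sigma> x "- y"] G_uminus[of \<sigma> y] LD(7)[of y] by simp

lemma G_sum:
  assumes "\<sigma> \<in> carrier G" "\<And>i. i \<in> I \<Longrightarrow> f i \<in> L"
  shows "\<sigma> (sum f I) = (\<Sum>i\<in>I. \<sigma> (f i))"
  using assms(2)
proof (induction I rule: infinite_finite_induct)
  case (insert i I)
  have "sum f I \<in> L" using insert(4) by (intro complex_subfield_sum[OF L]) blast
  then have "\<sigma> (f i + sum f I) = \<sigma> (f i) + \<sigma> (sum f I)" using insert(4) by (intro G_D(3)[OF assms(1)]) auto
  then show ?case using insert by simp
qed (use G_D(5)[OF assms(1), of 0] in simp_all)

lemma G_prod:
  assumes "\<sigma> \<in> carrier G" "\<And>i. i \<in> I \<Longrightarrow> f i \<in> L"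
  shows "\<sigma> (prod f I) = (\<Prod>i\<in>I. \<sigma> (f i))"
  using assms(2)
proof (induction I rule: infinite_finite_induct)
  case (insert i I)
  have "prod f I \<in> L" using insert(4) by (intro complex_subfield_prod[OF L]) blast
  then have "\<sigma> (f i * prod f I) = \<sigma> (f i) * \<sigma> (prod f I)" using insert(4) by (intro G_D(4)[OF assms(1)]) auto
  then show ?case using insert by simp
qed (use G_D(5)[OF assms(1), of 1] in simp_all)

lemma G_power: "\<sigma> \<in> carrier G \<Longrightarrow> x \<in> L \<Longrightarrow> \<sigma> (x ^ k) = \<sigma> x ^ k"
  using G_prod[of \<sigma> "{..<k}" "\<lambda>_. x"] by simp

lemma G_rpoly: "\<sigma> \<in> carrier G \<Longrightarrow> x \<in> L \<Longrightarrow> \<sigma> (rpoly p x) = rpoly p (\<sigma> x)"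
  using G_D(5)[of \<sigma> 1] by (intro hom_rpoly[OF L]) (simp_all add: G_D(3,4))

lemma G_bij_mult: "g \<in> carrier G \<Longrightarrow> bij_betw (\<lambda>s. g \<otimes>\<^bsub>G\<^esub> s) (carrier G) (carrier G)"
  by (rule bij_betwI[where g = "\<lambda>s. inv\<^bsub>G\<^esub> g \<otimes>\<^bsub>G\<^esub> s"]) (auto simp: m_assoc[symmetric])

lemma G_coeff_mult:
  assumes g: "g \<in> carrier G" and p: "coeffs_in L p" and q: "coeffs_in L q"
  shows "map_poly g (p * q) = map_poly g p * map_poly g q"
proof (rule poly_eqI)
  fix i
  have g0: "g 0 = 0" using G_D(5)[OF g, of 0] by simp
  have m: "coeff p j * coeff q k \<in> L" for j k using p q LD(5) by (simp add: coeffs_in_def)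
  have "coeff (map_poly g (p * q)) i = g (\<Sum>j\<le>i. coeff p j * coeff q (i - j))"
    by (simp add: coeff_map_poly g0 coeff_mult)
  also have "\<dots> = (\<Sum>j\<le>i. g (coeff p j) * g (coeff q (i - j)))"
    using m G_D(4)[OF g] p q by (simp add: G_sum[OF g] coeffs_in_def)
  also have "\<dots> = coeff (map_poly g p * map_poly g q) i"
    by (simp add: coeff_mult coeff_map_poly g0)
  finally show "coeff (map_poly g (p * q)) i = coeff (map_poly g p * map_poly g q) i" .
qed

lemma coeffs_in_prod: "(\<And>i. i \<in> I \<Longrightarrow> coeffs_in L (f i)) \<Longrightarrow> coeffs_in L (prod f I)"
proof (induction I rule: infinite_finite_induct)
  case (insert i I) then show ?case by (simp add: coeffs_in_mult[OF L])
qed (auto simp: coeffs_in_def LD coeff_1)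

lemma G_coeff_prod:
  assumes g: "g \<in> carrier G" and f: "\<And>i. i \<in> I \<Longrightarrow> coeffs_in L (f i)"
  shows "map_poly g (prod f I) = (\<Prod>i\<in>I. map_poly g (f i))"
  using f
proof (induction I rule: infinite_finite_induct)
  case (insert i I)
  then show ?case using G_coeff_mult[OF g] coeffs_in_prod[of I f] by simp
qed (use G_D(5)[OF g, of 1] in simp_all)

lemma G_coeff_linear: "g \<in> carrier G \<Longrightarrow> x \<in> L \<Longrightarrow> map_poly g [:- x, 1:] = [:- g x, 1:]"
  using G_D(5)[of g 0] G_D(5)[of g 1] by (simp add: map_poly_pCons G_uminus)

definition orbit :: "complex \<Rightarrow> complex set"
  where "orbit x = (\<lambda>g. g x) ` carrier G"

lemma orbit_subset: "x \<in> L \<Longrightarrow> orbit x \<subseteq> L"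
  using G_D(6) by (auto simp: orbit_def)

lemma orbit_self: "x \<in> L \<Longrightarrow> x \<in> orbit x"
  unfolding orbit_def using G_one one_closed by (metis imageI)

lemma finite_orbit:
  assumes x: "x \<in> L" "algebraic_rat x"
  shows "finite (orbit x)"
proof -
  obtain p where p: "p \<noteq> 0" "rpoly p x = 0" using x(2) by (auto simp: algebraic_rat_def)
  have "map_poly of_rat p \<noteq> (0 :: complex poly)" using p(1) by (simp add: hom_distribs)
  then have "finite {z. rpoly p z = 0}" unfolding rpoly_def by (rule poly_roots_finite)
  moreover have "orbit x \<subseteq> {z. rpoly p z = 0}"
  proof
    fix z assume "z \<in> orbit x"
    then obtain g where g: "g \<in> carrier G" "z = g x" by (auto simp: orbit_def)
    then show "z \<in> {z. rpoly p z = 0}" using G_rpoly[OF g(1) x(1), of p] p(2) G_D(5)[OF g(1), of 0] by simp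
  qed
  ultimately show ?thesis by (rule finite_subset[rotated])
qed

lemma bij_betw_orbit:
  assumes g: "g \<in> carrier G" and x: "x \<in> L"
  shows "bij_betw g (orbit x) (orbit x)"
proof -
  have "g ` orbit x = orbit x"
  proof -
    have "g ` orbit x = (\<lambda>s. (g \<otimes>\<^bsub>G\<^esub> s) x) ` carrier G"
      unfolding orbit_def image_image using G_mult[OF g _ x] by (intro image_cong) simp_all
    also have "\<dots> = (\<lambda>s. s x) ` (\<lambda>s. g \<otimes>\<^bsub>G\<^esub> s) ` carrier G" by (simp only: image_image)
    also have "\<dots> = orbit x" using bij_betw_imp_surj_on[OF G_bij_mult[OF g]] by (simp add: orbit_def)
    finally show ?thesis .
  qed
  moreover have "inj_on g (orbit x)"
    using G_D(2)[OF g] orbit_subset[OF x] by (auto simp: bij_betw_def intro: inj_on_subset)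
  ultimately show ?thesis by (simp add: bij_betw_def)
qed

end

text \<open>Finiteness of the group is not assumed, so that every competitor in the definition of a
  Galois closure is an instance at once; finite orbits come from algebraicity of the
  element.\<close>

locale galois_over_rat = field_over_rat +
  assumes fixed_rat: "\<And>x. x \<in> L \<Longrightarrow> (\<And>\<sigma>. \<sigma> \<in> carrier G \<Longrightarrow> \<sigma> x = x) \<Longrightarrow> x \<in> \<rat>"
begin

lemma coeffs_rat_if_invariant:
  assumes p: "coeffs_in L p" and inv: "\<And>g i. g \<in> carrier G \<Longrightarrow> g (coeff p i) = coeff p i"
  shows "\<exists>q. p = map_poly of_rat q"
proof -
  have "coeff p i \<in> \<rat>" for i
    using p inv by (intro fixed_rat) (auto simp: coeffs_in_def)
  then show ?thesis using rational_poly_obtain[of p] by metis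
qed

text \<open>Automorphisms permute the orbit and hence the linear factors, so the coefficients are
  fixed and therefore rational.\<close>

lemma orbit_poly_rat:
  assumes x: "x \<in> L"
  shows "\<exists>q. (\<Prod>z\<in>orbit x. [:- z, 1:]) = map_poly of_rat q"
proof -
  let ?P = "\<Prod>z\<in>orbit x. [:- z, 1:]"
  have lin: "coeffs_in L [:- z, 1:]" if "z \<in> orbit x" for z
    using coeffs_in_linear[OF L] LD(1,7) orbit_subset[OF x] that by blast
  have inv: "g (coeff ?P i) = coeff ?P i" if g: "g \<in> carrier G" for g i
  proof -
    have "map_poly g ?P = (\<Prod>z\<in>orbit x. map_poly g [:- z, 1:])"
      using lin by (rule G_coeff_prod[OF g])
    also have "\<dots> = (\<Prod>z\<in>orbit x. [:- g z, 1:])"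
      using G_coeff_linear[OF g] orbit_subset[OF x] by (intro prod.cong) auto
    also have "\<dots> = ?P" by (rule prod.reindex_bij_betw[OF bij_betw_orbit[OF g x]])
    finally show ?thesis using G_D(5)[OF g, of 0] by (metis coeff_map_poly Rats_0)
  qed
  show ?thesis by (intro coeffs_rat_if_invariant coeffs_in_prod lin inv)
qed

text \<open>The orbit polynomial is rational and vanishes at x, hence at z; its only roots are the
  points of the orbit.\<close>

lemma conjugate_in_orbit:
  assumes x: "x \<in> L" "algebraic_rat x" and z: "\<And>q. rpoly q x = 0 \<Longrightarrow> rpoly q z = 0"
  shows "z \<in> orbit x"
proof -
  obtain q where q: "(\<Prod>z\<in>orbit x. [:- z, 1:]) = map_poly of_rat q" using orbit_poly_rat[OF x(1)] by blast
  have val: "rpoly q w = (\<Prod>z\<in>orbit x. w - z)" for w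
    unfolding rpoly_def q[symmetric] by (simp add: poly_prod)
  have "rpoly q x = 0" unfolding val using orbit_self[OF x(1)] finite_orbit[OF x] by (intro prod_zero) auto
  then have "rpoly q z = 0" by (rule z)
  then have "(\<Prod>y\<in>orbit x. z - y) = 0" unfolding val .
  then show ?thesis using finite_orbit[OF x] by auto
qed

end

locale finite_galois_over_rat = galois_over_rat +
  assumes fin_Gal: "finite (carrier G)"
begin

text \<open>Lagrange interpolation: if the conjugates of \<open>d\<close> are distinct, every \<open>x\<close> is a rational function of
  \<open>d\<close>.\<close>

lemma mem_subfield_if_trivial_stabilizer:
  assumes M: "complex_subfield M" and d: "d \<in> L" "d \<in> M"
    and triv: "\<And>g. g \<in> carrier G \<Longrightarrow> g d = d \<Longrightarrow> g = \<one>\<^bsub>G\<^esub>" and x: "x \<in> L"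
  shows "x \<in> M"
proof -
  have dist: "s d \<noteq> t d" if "s \<in> carrier G" "t \<in> carrier G" "s \<noteq> t" for s t
  proof
    assume "s d = t d"
    then have "(inv\<^bsub>G\<^esub> t \<otimes>\<^bsub>G\<^esub> s) d = d"
      using that d G_inv(1)[of t d] by (simp add: G_mult[OF inv_closed])
    then have "inv\<^bsub>G\<^esub> t \<otimes>\<^bsub>G\<^esub> s = \<one>\<^bsub>G\<^esub>" using triv that by simp
    then have "t \<otimes>\<^bsub>G\<^esub> (inv\<^bsub>G\<^esub> t \<otimes>\<^bsub>G\<^esub> s) = t" using that by simp
    then show False using that by (simp add: m_assoc[symmetric])
  qed
  \<comment> \<open>An interpolation polynomial without denominators. At d only the summand of the
    identity survives, giving y times a factor independent of y; dividing by the value for y = 1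
    removes that factor. Automorphisms permute the summands, so the coefficients are
    rational.\<close>
  define N where "N y = (\<Sum>s\<in>carrier G. [:s y:] * (\<Prod>t\<in>carrier G - {s}. [:- t d, 1:]))" for y
  have lin: "coeffs_in L [:- g d, 1:]" if "g \<in> carrier G" for g
    using coeffs_in_linear[OF L] LD(1,7) G_D(6)[OF that d(1)] by blast
  have term_in: "coeffs_in L ([:s y:] * (\<Prod>t\<in>carrier G - {s}. [:- t d, 1:]))"
    if "s \<in> carrier G" "y \<in> L" for s y
    using that G_D(6) lin by (intro coeffs_in_mult[OF L] coeffs_in_const[OF L] coeffs_in_prod) auto
  have N_val: "poly (N y) d = y * (\<Prod>t\<in>carrier G - {\<one>\<^bsub>G\<^esub>}. d - t d)" if y: "y \<in> L" for y
  proof -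
    have "poly (N y) d = (\<Sum>s\<in>carrier G. s y * (\<Prod>t\<in>carrier G - {s}. d - t d))"
      by (simp add: N_def poly_sum poly_prod)
    also have "\<dots> = (\<Sum>s\<in>{\<one>\<^bsub>G\<^esub>}. s y * (\<Prod>t\<in>carrier G - {s}. d - t d))"
    proof (rule sum.mono_neutral_right[OF fin_Gal], simp, rule ballI)
      fix s assume "s \<in> carrier G - {\<one>\<^bsub>G\<^esub>}"
      then have "\<one>\<^bsub>G\<^esub> \<in> carrier G - {s}" by auto
      moreover have "d - \<one>\<^bsub>G\<^esub> d = 0" using G_one[OF d(1)] by simp
      ultimately have "(\<Prod>t\<in>carrier G - {s}. d - t d) = 0" using fin_Gal by (meson finite_Diff prod_zero)
      then show "s y * (\<Prod>t\<in>carrier G - {s}. d - t d) = 0" by simp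
    qed
    also have "\<dots> = y * (\<Prod>t\<in>carrier G - {\<one>\<^bsub>G\<^esub>}. d - t d)" using G_one[OF y] by simp
    finally show ?thesis .
  qed
  have N_rat: "\<exists>q. N y = map_poly of_rat q" if y: "y \<in> L" for y
  proof -
    have cN: "coeffs_in L (N y)"
      unfolding N_def coeffs_in_def coeff_sum
      using term_in y by (intro allI complex_subfield_sum[OF L]) (auto simp: coeffs_in_def)
    have inv: "g (coeff (N y) i) = coeff (N y) i" if g: "g \<in> carrier G" for g i
    proof -
      have g0: "g 0 = 0" using G_D(5)[OF g, of 0] by simp
      have t: "map_poly g ([:s y:] * (\<Prod>t\<in>carrier G - {s}. [:- t d, 1:])) =
          [:(g \<otimes>\<^bsub>G\<^esub> s) y:] * (\<Prod>t\<in>carrier G - {g \<otimes>\<^bsub>G\<^esub> s}. [:- t d, 1:])"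
        if s: "s \<in> carrier G" for s
      proof -
        have c: "coeffs_in L [:s y:]" by (rule coeffs_in_const[OF L G_D(6)[OF s y]])
        have p: "coeffs_in L (\<Prod>t\<in>carrier G - {s}. [:- t d, 1:])"
          by (rule coeffs_in_prod) (use lin in auto)
        have e: "map_poly g (\<Prod>t\<in>carrier G - {s}. [:- t d, 1:]) =
            (\<Prod>t\<in>carrier G - {s}. map_poly g [:- t d, 1:])"
          by (rule G_coeff_prod[OF g]) (use lin in auto)
        have "map_poly g ([:s y:] * (\<Prod>t\<in>carrier G - {s}. [:- t d, 1:])) =
            map_poly g [:s y:] * (\<Prod>t\<in>carrier G - {s}. map_poly g [:- t d, 1:])"
          using G_coeff_mult[OF g c p] by (simp only: e)
        also have "map_poly g [:s y:] = [:(g \<otimes>\<^bsub>G\<^esub> s) y:]"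
          using g0 G_mult[OF g s y]
          by (intro poly_eqI) (simp add: coeff_map_poly coeff_pCons split: nat.split)
        also have "(\<Prod>t\<in>carrier G - {s}. map_poly g [:- t d, 1:]) =
            (\<Prod>t\<in>carrier G - {s}. [:- (g \<otimes>\<^bsub>G\<^esub> t) d, 1:])"
          using G_coeff_linear[OF g] G_D(6) d(1) by (intro prod.cong) (simp_all add: G_mult[OF g])
        also have "\<dots> = (\<Prod>t\<in>carrier G - {g \<otimes>\<^bsub>G\<^esub> s}. [:- t d, 1:])"
        proof (rule prod.reindex_bij_betw)
          have "(\<lambda>t. g \<otimes>\<^bsub>G\<^esub> t) ` (carrier G - {s}) = carrier G - {g \<otimes>\<^bsub>G\<^esub> s}"
            using inj_on_image_set_diff[OF bij_betw_imp_inj_on[OF G_bij_mult[OF g]], of "carrier G" "{s}"] s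
              bij_betw_imp_surj_on[OF G_bij_mult[OF g]] by simp
          then show "bij_betw (\<lambda>t. g \<otimes>\<^bsub>G\<^esub> t) (carrier G - {s}) (carrier G - {g \<otimes>\<^bsub>G\<^esub> s})"
            using inj_on_subset[OF bij_betw_imp_inj_on[OF G_bij_mult[OF g]]] by (auto simp: bij_betw_def)
        qed
        finally show ?thesis .
      qed
      have "g (coeff (N y) i) = (\<Sum>s\<in>carrier G. coeff (map_poly g ([:s y:] * (\<Prod>t\<in>carrier G - {s}. [:- t d, 1:]))) i)"
        unfolding N_def coeff_sum using term_in y
        by (subst G_sum[OF g]) (auto simp: coeffs_in_def coeff_map_poly g0)
      also have "\<dots> = (\<Sum>s\<in>carrier G. coeff ([:(g \<otimes>\<^bsub>G\<^esub> s) y:] * (\<Prod>t\<in>carrier G - {g \<otimes>\<^bsub>G\<^esub> s}. [:- t d, 1:])) i)"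
        by (rule sum.cong) (simp_all only: t)
      also have "\<dots> = coeff (N y) i"
        unfolding N_def coeff_sum by (rule sum.reindex_bij_betw[OF G_bij_mult[OF g]])
      finally show ?thesis .
    qed
    show ?thesis by (intro coeffs_rat_if_invariant cN inv)
  qed
  let ?D = "\<Prod>t\<in>carrier G - {\<one>\<^bsub>G\<^esub>}. d - t d"
  have D_ne: "?D \<noteq> 0"
    using fin_Gal dist[of "\<one>\<^bsub>G\<^esub>"] G_one[OF d(1)] by (auto simp: prod_zero_iff)
  have N_M: "poly (N y) d \<in> M" if y: "y \<in> L" for y
    using N_rat[OF y] rpoly_in_subfield[OF M d(2)] by (auto simp: rpoly_def)
  have "poly (N x) d / poly (N 1) d \<in> M" using N_M[OF x] N_M[OF LD(1)] complex_subfieldD(8)[OF M] by blast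
  moreover have "poly (N x) d / poly (N 1) d = x" using N_val[OF x] N_val[OF LD(1)] D_ne by simp
  ultimately show ?thesis by simp
qed

end

subsection \<open>Splitting fields\<close>

text \<open>In characteristic 0 the nonzero derivative of m has smaller degree, so m does not divide
  it. A Bezout identity between m and m' then excludes a common root at any complex number, so all
  roots of m are simple.\<close>

lemma rpoly_ge_degree_roots:
  assumes m: "m \<noteq> 0" "\<And>p. rpoly p a = 0 \<longleftrightarrow> m dvd p"
  shows "card {z. rpoly m z = 0} = Polynomial.degree m" "finite {z. rpoly m z = 0}"
proof -
  let ?M = "map_poly of_rat m :: complex poly"
  have deg: "Polynomial.degree ?M = Polynomial.degree m" and ne: "?M \<noteq> 0"
    using m(1) by (simp_all add: hom_distribs)
  show "finite {z. rpoly m z = 0}" unfolding rpoly_def using poly_roots_finite[OF ne] .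
  have "Polynomial.degree m \<noteq> 0"
  proof
    assume "Polynomial.degree m = 0"
    then obtain c where c: "m = [:c:]" by (elim degree_eq_zeroE)
    have "rpoly m a = 0" using m(2) by simp
    then show False using m(1) by (simp add: c)
  qed
  then have "pderiv m \<noteq> 0" "\<not> m dvd pderiv m"
    using pderiv_eq_0_iff[of m] by (auto simp: degree_pderiv dest!: dvd_imp_degree_le)
  then have "rpoly (pderiv m) a \<noteq> 0" using m(2) by blast
  then obtain u v where uv: "u * pderiv m + v * m = 1" using bezout_min_poly[OF m] by blast
  have "rsquarefree ?M"
    unfolding rsquarefree_roots
  proof (intro allI notI)
    fix z assume z: "poly ?M z = 0 \<and> poly (pderiv ?M) z = 0"
    have "rpoly (u * pderiv m + v * m) z = 0"
      using z by (simp add: rpoly_def[of m] rpoly_def[of "pderiv m"] hom_distribs)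
    then show False unfolding uv by simp
  qed
  then have "?M = smult (lead_coeff ?M) (\<Prod>z | poly ?M z = 0. [:- z, 1:])"
    by (rule complex_poly_decompose_rsquarefree[symmetric])
  then have "Polynomial.degree ?M = Polynomial.degree (\<Prod>z | poly ?M z = 0. [:- z, 1:])"
    using ne by (metis degree_smult_eq leading_coeff_0_iff)
  also have "\<dots> = card {z. poly ?M z = 0}" by (subst degree_prod_eq_sum_degree) auto
  finally show "card {z. rpoly m z = 0} = Polynomial.degree m" by (simp add: rpoly_def deg)
qed

lemma Qadj_finite_dimension:
  assumes "algebraic_rat a"
  shows "ring.finite_dimension \<CC> \<rat> (Qadj a)"
proof -
  interpret field \<CC> by (rule CC_field)
  have Q: "subfield \<rat> \<CC>" by (simp add: subfield_CC_iff complex_subfield_rat)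
  obtain m where m: "m \<noteq> 0" "\<And>p. rpoly p a = 0 \<longleftrightarrow> m dvd p" using ex_min_poly[OF assms] by blast
  let ?Us = "map (\<lambda>i. a ^ i) [0..<Polynomial.degree m]"
  have Us: "set ?Us \<subseteq> carrier \<CC>" by simp
  have sum_in: "sum f I \<in> Span \<rat> ?Us" if "\<And>i. i \<in> I \<Longrightarrow> f i \<in> Span \<rat> ?Us" for f and I :: "nat set"
    using that
    by (induction I rule: infinite_finite_induct)
      (use Span_subgroup_props(2,3)[OF Q Us] in \<open>auto\<close>)
  have "Qadj a \<subseteq> Span \<rat> ?Us"
  proof
    fix x assume "x \<in> Qadj a"
    then obtain p where p: "x = rpoly p a" by (auto simp: Qadj_def)
    let ?r = "p mod m"
    have "rpoly ?r a = rpoly (p - p div m * m) a" by (simp add: minus_div_mult_eq_mod)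
    then have x: "x = rpoly ?r a" using p m(2)[of m] by simp
    show "x \<in> Span \<rat> ?Us"
    proof (cases "?r = 0")
      case True then show ?thesis using x Span_subgroup_props(2)[OF Q Us] by simp
    next
      case False
      then have deg: "Polynomial.degree ?r < Polynomial.degree m" using degree_mod_less[OF m(1), of p] by blast
      have "of_rat (poly.coeff ?r i) * a ^ i \<in> Span \<rat> ?Us" if "i \<in> {..Polynomial.degree ?r}" for i
      proof -
        have "a ^ i \<in> Span \<rat> ?Us" using Span_base_incl[OF Q Us] that deg by auto
        then show ?thesis using Span_smult_closed[OF Q Us, of "of_rat (poly.coeff ?r i)" "a ^ i"] by simp
      qed
      then show ?thesis unfolding x rpoly_altdef by (rule sum_in)
    qed
  qed
  moreover have "subalgebra \<rat> (Qadj a) \<CC>"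
    by (rule complex_subfield_subalgebra[OF Qadj_subfield[OF assms]])
  ultimately show ?thesis
    using subalbegra_incl_imp_finite_dimension[OF Q Span_finite_dimension[OF Q Us]] by blast
qed

text \<open>An embedding of \<open>Q(a)\<close>
  permutes \<open>A\<close>, and \<open>a\<close> is an integer combination of \<open>A\<close>, so all conjugates of \<open>a\<close> lie in \<open>Q(a)\<close>.\<close>

theorem splitting_field:
  assumes A: "finite A" "\<And>z. z \<in> A \<Longrightarrow> algebraic_int z" and q: "A = {z. rpoly q z = 0}"
  shows "\<exists>a. algebraic_rat a \<and> A \<subseteq> Qadj a \<and> finite_galois_over_rat (Qadj a) \<and>
    (\<forall>g\<in>carrier (Gal (Qadj a) \<rat>). (\<forall>z\<in>A. g z = z) \<longrightarrow> g = \<one>\<^bsub>Gal (Qadj a) \<rat>\<^esub>) \<and>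
    (\<forall>g\<in>carrier (Gal (Qadj a) \<rat>). g a = a \<longrightarrow> g = \<one>\<^bsub>Gal (Qadj a) \<rat>\<^esub>)"
proof -
  have "\<exists>c :: complex \<Rightarrow> nat. A \<subseteq> Qadj (\<Sum>z\<in>A. of_nat (c z) * z)"
    by (rule ex_primitive_element[OF A(1)]) (rule A(2))
  then obtain c :: "complex \<Rightarrow> nat" where c: "A \<subseteq> Qadj (\<Sum>z\<in>A. of_nat (c z) * z)" ..
  define a where "a = (\<Sum>z\<in>A. of_nat (c z) * z)"
  have nat_int: "algebraic_int (of_nat k :: complex)" for k
    using algebraic_int_of_int[of "int k"] by simp
  have alg: "algebraic_rat a"
    unfolding a_def
    by (intro algebraic_rat_if_algebraic_int algebraic_int_sum algebraic_int_add_mult(2) nat_int A(2))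
  let ?L = "Qadj a"
  interpret field_over_rat ?L by unfold_locales (rule Qadj_subfield[OF alg])
  have aL: "a \<in> ?L" by (rule Qadj_base)
  have AL: "A \<subseteq> ?L" using c by (simp add: a_def)
  obtain m where m: "m \<noteq> 0" "\<And>p. rpoly p a = 0 \<longleftrightarrow> m dvd p" using ex_min_poly[OF alg] by blast
  let ?R = "{z. rpoly m z = 0}"
  have transfer: "rpoly p b = 0" if "b \<in> ?R" "rpoly p a = 0" for p b
    using that m(2)[of p] by (auto elim!: dvdE)
  \<comment> \<open>All roots of m satisfy the same rational relations as \<open>a\<close>; this
    makes substituting b for \<open>a\<close> well defined and injective.\<close>
  have transfer_iff: "rpoly p b = 0 \<longleftrightarrow> rpoly p a = 0" if b: "b \<in> ?R" for p b
  proof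
    assume p: "rpoly p b = 0"
    show "rpoly p a = 0"
    proof (rule ccontr)
      assume "rpoly p a \<noteq> 0"
      then obtain u v where uv: "u * p + v * m = 1" using bezout_min_poly[OF m] by blast
      have "rpoly (u * p + v * m) b = 0" using p b by simp
      then show False unfolding uv by simp
    qed
  qed (rule transfer[OF b])
  have eq_iff: "rpoly p b = rpoly p' b \<longleftrightarrow> rpoly p a = rpoly p' a" if "b \<in> ?R" for p p' b
    using transfer_iff[OF that, of "p - p'"] by simp
  have R_L: "b \<in> ?L" if b: "b \<in> ?R" for b
  proof -
    have "\<forall>z\<in>A. \<exists>p. z = rpoly p a" using AL by (auto simp: Qadj_def)
    then obtain P where P: "\<And>z. z \<in> A \<Longrightarrow> z = rpoly (P z) a" by metis
    have PA: "rpoly (P z) b \<in> A" if z: "z \<in> A" for z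
    proof -
      have "rpoly (pcompose q (P z)) a = 0" using P[OF z] z q by (simp add: rpoly_pcompose)
      then have "rpoly (pcompose q (P z)) b = 0" by (rule transfer[OF b])
      then show ?thesis using q by (simp add: rpoly_pcompose)
    qed
    have rs: "rpoly (sum f B) w = (\<Sum>z\<in>B. rpoly (f z) w)" for f and B :: "complex set" and w
      by (induction B rule: infinite_finite_induct) simp_all
    let ?s = "\<Sum>z\<in>A. [:of_nat (c z):] * P z"
    have "rpoly ?s a = a"
      unfolding rs by (subst (2) a_def) (intro sum.cong, simp_all add: P[symmetric])
    then have "rpoly (?s - [:0, 1:]) a = 0" by simp
    then have "rpoly (?s - [:0, 1:]) b = 0" by (rule transfer[OF b])
    then have "b = (\<Sum>z\<in>A. of_nat (c z) * rpoly (P z) b)" by (simp add: rs)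
    also have "\<dots> \<in> ?L"
      using PA AL by (intro complex_subfield_sum[OF L] LD(5) complex_subfield_of_nat[OF L]) blast
    finally show ?thesis .
  qed
  \<comment> \<open>Substitution of b for \<open>a\<close>. By \<open>eq_iff\<close> the choice of
    the polynomial that represents x does not matter.\<close>
  define T where "T b = (\<lambda>x\<in>?L. rpoly (SOME p. x = rpoly p a) b)" for b
  have T: "T b (rpoly p a) = rpoly p b" if b: "b \<in> ?R" for b p
  proof -
    have "rpoly p a = rpoly (SOME p'. rpoly p a = rpoly p' a) a" by (rule someI[of _ p]) simp
    then have "rpoly p b = rpoly (SOME p'. rpoly p a = rpoly p' a) b" using eq_iff[OF b] by blast
    then show ?thesis by (simp add: T_def Qadj_def)
  qed
  have T_a: "T b a = b" if "b \<in> ?R" for b using T[OF that, of "[:0, 1:]"] by simp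
  have T_L: "T b x \<in> ?L" if b: "b \<in> ?R" and x: "x \<in> ?L" for b x
  proof -
    obtain p where "x = rpoly p a" using x by (auto simp: Qadj_def)
    then show ?thesis using T[OF b] rpoly_in_subfield[OF L R_L[OF b]] by simp
  qed
  have T_inj: "inj_on (T b) ?L" if b: "b \<in> ?R" for b
  proof (rule inj_onI)
    fix x y assume xy: "x \<in> ?L" "y \<in> ?L" "T b x = T b y"
    obtain p p' where "x = rpoly p a" "y = rpoly p' a" using xy by (auto simp: Qadj_def)
    then show "x = y" using xy(3) T[OF b] eq_iff[OF b] by simp
  qed
  have T_rpoly: "T b (rpoly p x) = rpoly p (T b x)" if b: "b \<in> ?R" and x: "x \<in> ?L" for b x p
  proof -
    obtain p' where "x = rpoly p' a" using x by (auto simp: Qadj_def)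
    then show ?thesis using T[OF b, of p'] T[OF b, of "pcompose p p'"] by (simp add: rpoly_pcompose)
  qed
  \<comment> \<open>T b maps the finite root set of m injectively into itself, so it hits
    \<open>a\<close>, and with it the whole field generated by \<open>a\<close>.\<close>
  have T_surj: "T b ` ?L = ?L" if b: "b \<in> ?R" for b
  proof
    show "T b ` ?L \<subseteq> ?L" using T_L[OF b] by blast
    have "T b ` ?R \<subseteq> ?R"
    proof
      fix w assume "w \<in> T b ` ?R"
      then obtain z where z: "z \<in> ?R" "w = T b z" by blast
      have "T b 0 = 0" using T[OF b, of 0] by simp
      then show "w \<in> ?R" using T_rpoly[OF b R_L[OF z(1)], of m] z by simp
    qed
    moreover have "inj_on (T b) ?R" using T_inj[OF b] R_L by (auto intro: inj_on_subset)
    ultimately have "T b ` ?R = ?R" using rpoly_ge_degree_roots(2)[OF m] by (intro endo_inj_surj)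
    moreover have "a \<in> ?R" using m(2)[of m] by simp
    ultimately have "a \<in> T b ` ?R" by simp
    then obtain a' where a': "a' \<in> ?R" "T b a' = a" by (elim imageE) simp
    show "?L \<subseteq> T b ` ?L"
    proof
      fix x assume "x \<in> ?L"
      then obtain p where "x = rpoly p a" by (auto simp: Qadj_def)
      then have "x = T b (rpoly p a')" using T_rpoly[OF b R_L[OF a'(1)]] a'(2) by simp
      then show "x \<in> T b ` ?L" using rpoly_in_subfield[OF L R_L[OF a'(1)]] by blast
    qed
  qed
  have T_Gal: "T b \<in> carrier G" if b: "b \<in> ?R" for b
    unfolding Gal_iff[OF L Rats_1 rat_sub]
  proof (intro conjI ballI)
    show "T b \<in> extensional ?L" by (simp add: T_def)
    show "bij_betw (T b) ?L ?L" using T_inj[OF b] T_surj[OF b] by (simp add: bij_betw_def)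
    fix x y assume xy: "x \<in> ?L" "y \<in> ?L"
    obtain p p' where p: "x = rpoly p a" "y = rpoly p' a" using xy by (auto simp: Qadj_def)
    show "T b (x + y) = T b x + T b y" "T b (x * y) = T b x * T b y"
      using T[OF b, of "p + p'"] T[OF b, of "p * p'"] T[OF b, of p] T[OF b, of p'] p by simp_all
  next
    fix x :: complex assume "x \<in> \<rat>"
    then obtain r where "x = of_rat r" by (auto elim: Rats_cases)
    then show "T b x = x" using T[OF b, of "[:r:]"] by simp
  qed
  have G_a: "g = h" if "g \<in> carrier G" "h \<in> carrier G" "g a = h a" for g h
  proof (rule G_eqI[OF that(1,2)])
    fix x assume "x \<in> ?L"
    then obtain p where "x = rpoly p a" by (auto simp: Qadj_def)
    then show "g x = h x" using G_rpoly[OF that(1) aL] G_rpoly[OF that(2) aL] that(3) by simp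
  qed
  have fixed: "x \<in> \<rat>" if x: "x \<in> ?L" and fix_x: "\<And>g. g \<in> carrier G \<Longrightarrow> g x = x" for x
  proof -
    obtain p where p: "x = rpoly p a" using x by (auto simp: Qadj_def)
    let ?r = "p mod m"
    have "rpoly ?r a = rpoly (p - p div m * m) a" by (simp add: minus_div_mult_eq_mod)
    then have xr: "x = rpoly ?r a" using p m(2)[of m] by simp
    \<comment> \<open>The remainder r has smaller degree than m, yet r - x vanishes at all roots of
      m, which are as many as the degree of m; so r is the constant x.\<close>
    let ?D = "map_poly of_rat ?r - [:x:]"
    have roots: "poly ?D b = 0" if b: "b \<in> ?R" for b
      using fix_x[OF T_Gal[OF b]] T[OF b, of ?r] xr by (simp add: rpoly_def)
    have "?D = 0"
    proof (rule ccontr)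
      assume ne: "?D \<noteq> 0"
      have "?R \<subseteq> {z. poly ?D z = 0}" using roots by blast
      then have "card ?R \<le> card {z. poly ?D z = 0}" by (rule card_mono[OF poly_roots_finite[OF ne]])
      also have "\<dots> \<le> Polynomial.degree ?D" by (rule card_poly_roots_bound[OF ne])
      also have "\<dots> \<le> Polynomial.degree ?r"
      proof (rule degree_diff_le)
        show "Polynomial.degree (map_poly of_rat ?r :: complex poly) \<le> Polynomial.degree ?r"
          by (rule degree_map_poly_le)
      qed simp
      finally have le: "Polynomial.degree m \<le> Polynomial.degree ?r"
        using rpoly_ge_degree_roots(1)[OF m] by simp
      have "?r = 0" using degree_mod_less[OF m(1), of p] le by auto
      then have "Polynomial.degree m = 0" using le by simp
      then obtain k where k: "m = [:k:]" by (elim degree_eq_zeroE)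
      have "rpoly m a = 0" using m(2)[of m] by simp
      then show False using m(1) by (simp add: k)
    qed
    then have "coeff ?D 0 = 0" by simp
    then have "x = of_rat (coeff ?r 0)" by (simp add: coeff_map_poly)
    then show ?thesis by simp
  qed
  have "(\<lambda>g. g a) ` carrier G \<subseteq> ?R"
  proof
    fix w assume "w \<in> (\<lambda>g. g a) ` carrier G"
    then obtain g where g: "g \<in> carrier G" "w = g a" by blast
    then show "w \<in> ?R" using G_rpoly[OF g(1) aL, of m] m(2)[of m] G_D(5)[OF g(1), of 0] by simp
  qed
  then have "finite ((\<lambda>g. g a) ` carrier G)" using rpoly_ge_degree_roots(2)[OF m] by (rule finite_subset)
  moreover have "inj_on (\<lambda>g. g a) (carrier G)" using G_a by (auto simp: inj_on_def)
  ultimately have fin: "finite (carrier G)" by (rule finite_imageD)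
  have gal: "finite_galois_over_rat ?L"
    by unfold_locales (use fixed fin in auto)
  have triv_a: "g = \<one>\<^bsub>G\<^esub>" if "g \<in> carrier G" "g a = a" for g
    using G_a[OF that(1) one_closed] that(2) G_one[OF aL] by simp
  have triv: "g = \<one>\<^bsub>G\<^esub>" if g: "g \<in> carrier G" and "\<forall>z\<in>A. g z = z" for g
  proof (rule triv_a[OF g])
    have nat_L: "of_nat (c z) \<in> ?L" for z by (rule complex_subfield_of_nat[OF L])
    have "g a = (\<Sum>z\<in>A. g (of_nat (c z) * z))"
      unfolding a_def using LD(5)[OF nat_L] AL by (intro G_sum[OF g, unfolded a_def]) (auto simp: a_def)
    also have "\<dots> = a"
      unfolding a_def using that(2) AL G_D(4)[OF g nat_L] G_D(5)[OF g]
      by (intro sum.cong) (auto simp: a_def)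
    finally show "g a = a" .
  qed
  show ?thesis using alg AL gal triv triv_a by blast
qed

subsection \<open>Solvable equivalence of fixed fields\<close>

text \<open>Subgroups of the image are the images of their preimages, and injectivity carries
  solvability in both directions.\<close>

lemma solvable_subgroups_hom_image:
  assumes H: "group H" and G: "group G" and r: "r \<in> hom H G" and inj: "inj_on r (carrier H)"
  shows "solvable_subgroups G (r ` carrier H) =
    (\<lambda>K. r ` K) ` {K. subgroup K H \<and> solvable (H\<lparr>carrier := K\<rparr>)}"
    (is "?A = ?B")
proof -
  interpret H: group H by (rule H)
  interpret G: group G by (rule G)
  interpret r: group_hom H G r using r by unfold_locales
  have im: "subgroup (r ` carrier H) G" by (rule r.img_is_subgroup)
  have sub_hom: "group_hom (H\<lparr>carrier := K\<rparr>) (G\<lparr>carrier := r ` K\<rparr>) r"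
    if K: "subgroup K H" for K
  proof -
    have "group (H\<lparr>carrier := K\<rparr>)" "group (G\<lparr>carrier := r ` K\<rparr>)"
      using subgroup.subgroup_is_group[OF K H] subgroup.subgroup_is_group[OF r.subgroup_img_is_subgroup[OF K] G] .
    moreover have "r \<in> hom (H\<lparr>carrier := K\<rparr>) (G\<lparr>carrier := r ` K\<rparr>)"
      using r.hom_mult subgroup.subset[OF K] by (intro homI) (auto simp: subset_iff)
    ultimately show ?thesis by (simp add: group_hom_def group_hom_axioms_def)
  qed
  have solv: "solvable (H\<lparr>carrier := K\<rparr>) \<longleftrightarrow> solvable (G\<lparr>carrier := r ` K\<rparr>)" if K: "subgroup K H" for K
  proof -
    interpret k: group_hom "H\<lparr>carrier := K\<rparr>" "G\<lparr>carrier := r ` K\<rparr>" r by (rule sub_hom[OF K])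
    have "inj_on r (carrier (H\<lparr>carrier := K\<rparr>))"
      using inj_on_subset[OF inj] subgroup.subset[OF K] by simp
    then show ?thesis using k.inj_hom_imp_solvable k.surj_hom_imp_solvable by auto
  qed
  show ?thesis
  proof
    show "?A \<subseteq> ?B"
    proof
      fix K' assume "K' \<in> ?A"
      then have K': "subgroup K' (G\<lparr>carrier := r ` carrier H\<rparr>)" "solvable (G\<lparr>carrier := K'\<rparr>)"
        by (simp_all add: solvable_subgroups_def)
      have sG: "subgroup K' G" using G.incl_subgroup[OF im K'(1)] .
      have sub: "K' \<subseteq> r ` carrier H" using subgroup.subset[OF K'(1)] by simp
      define K where "K = {h \<in> carrier H. r h \<in> K'}"
      have rK: "r ` K = K'" using sub by (auto simp: K_def)
      have K: "subgroup K H"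
      proof (rule H.subgroupI)
        show "K \<subseteq> carrier H" by (auto simp: K_def)
        show "K \<noteq> {}" using subgroup.one_closed[OF sG] r.hom_one by (auto simp: K_def)
      qed (auto simp: K_def subgroup.m_inv_closed[OF sG] subgroup.m_closed[OF sG])
      then show "K' \<in> ?B" using solv[OF K] K'(2) rK by blast
    qed
    show "?B \<subseteq> ?A"
    proof
      fix K' assume "K' \<in> ?B"
      then obtain K where K: "K' = r ` K" "subgroup K H" "solvable (H\<lparr>carrier := K\<rparr>)" by blast
      have "subgroup K' (G\<lparr>carrier := r ` carrier H\<rparr>)"
        unfolding K(1) by (intro G.subgroup_incl r.subgroup_img_is_subgroup K im image_mono subgroup.subset)
      then show "K' \<in> ?A" using K solv by (simp add: solvable_subgroups_def)
    qed
  qed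
qed

lemma twin_homsD:
  assumes "twin_homs H G r s"
  shows "r \<in> hom H G" "s \<in> hom H G" "inj_on r (carrier H)" "inj_on s (carrier H)"
    "\<lbrakk>subgroup K H; solvable (H\<lparr>carrier := K\<rparr>)\<rbrakk> \<Longrightarrow>
      \<exists>t\<in>carrier G. \<forall>k\<in>K. s k = t \<otimes>\<^bsub>G\<^esub> r k \<otimes>\<^bsub>G\<^esub> inv\<^bsub>G\<^esub> t"
    "t \<in> carrier G \<Longrightarrow> s ` carrier H \<noteq> (\<lambda>x. t \<otimes>\<^bsub>G\<^esub> x \<otimes>\<^bsub>G\<^esub> inv\<^bsub>G\<^esub> t) ` r ` carrier H"
  using assms unfolding twin_homs_def by blast+

text \<open>The bijection sends the image of K under r to its image under s, for each solvable K;
  the conjugating element is the one that \<open>twin_homs\<close> supplies for K.\<close>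

lemma solvably_equivalent_if_twin_homs:
  assumes H: "group H" and G: "group G" "finite (carrier G)" and tw: "twin_homs H G r s"
  shows "solvably_equivalent_subgroups G (r ` carrier H) (s ` carrier H)"
proof -
  interpret H: group H by (rule H)
  interpret G: group G by (rule G)
  note rs = twin_homsD(1-4)[OF tw] and conj = twin_homsD(5)[OF tw]
  interpret r: group_hom H G r using rs by unfold_locales
  interpret s: group_hom H G s using rs by unfold_locales
  define S where "S = {K. subgroup K H \<and> solvable (H\<lparr>carrier := K\<rparr>)}"
  have S_sub: "K \<subseteq> carrier H" if "K \<in> S" for K using that subgroup.subset by (auto simp: S_def)
  have bij: "bij_betw (\<lambda>K. f ` K) S (solvable_subgroups G (f ` carrier H))"
    if "f \<in> hom H G" "inj_on f (carrier H)" for f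
    unfolding bij_betw_def solvable_subgroups_hom_image[OF H G(1) that] S_def[symmetric]
    using inj_on_image_eq_iff[OF that(2)] S_sub by (auto simp: inj_on_def[of _ S])
  define \<phi> where "\<phi> = (\<lambda>K. s ` K) \<circ> inv_into S (\<lambda>K. r ` K)"
  have "bij_betw \<phi> (solvable_subgroups G (r ` carrier H)) (solvable_subgroups G (s ` carrier H))"
    unfolding \<phi>_def by (rule bij_betw_trans[OF bij_betw_inv_into[OF bij[OF rs(1,3)]] bij[OF rs(2,4)]])
  moreover have "\<exists>g\<in>carrier G. \<phi> K' = g <#\<^bsub>G\<^esub> K' #>\<^bsub>G\<^esub> inv\<^bsub>G\<^esub> g"
    if K': "K' \<in> solvable_subgroups G (r ` carrier H)" for K'
  proof -
    have "K' \<in> (\<lambda>K. r ` K) ` S"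
      using K' bij_betw_imp_surj_on[OF bij[OF rs(1,3)]] by simp
    then obtain K where K: "K' = r ` K" "K \<in> S" by (elim imageE)
    then have "\<phi> K' = s ` K"
      using bij_betw_inv_into_left[OF bij[OF rs(1,3)] K(2)] unfolding \<phi>_def K(1) by simp
    moreover obtain t where t: "t \<in> carrier G" "\<forall>k\<in>K. s k = t \<otimes>\<^bsub>G\<^esub> r k \<otimes>\<^bsub>G\<^esub> inv\<^bsub>G\<^esub> t"
      using conj K(2) unfolding S_def by blast
    moreover have "t <#\<^bsub>G\<^esub> K' #>\<^bsub>G\<^esub> inv\<^bsub>G\<^esub> t = (\<lambda>k. t \<otimes>\<^bsub>G\<^esub> r k \<otimes>\<^bsub>G\<^esub> inv\<^bsub>G\<^esub> t) ` K"
      unfolding K(1) l_coset_def r_coset_def by auto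
    ultimately show ?thesis by (intro bexI[of _ t]) auto
  qed
  ultimately show ?thesis
    unfolding solvably_equivalent_subgroups_def
    using G r.img_is_subgroup s.img_is_subgroup by blast
qed

lemma twin_homs_compose_iso:
  assumes tw: "twin_homs H G r s" and f: "f \<in> iso G G'" and H: "group H" and G: "group G" and G': "group G'"
  shows "twin_homs H G' (f \<circ> r) (f \<circ> s)"
proof -
  interpret G: group G by (rule G)
  interpret G': group G' by (rule G')
  interpret f: group_hom G G' f using f by unfold_locales (simp add: iso_def)
  have inj: "inj_on f (carrier G)" and surj: "f ` carrier G = carrier G'"
    using f by (auto simp: iso_def bij_betw_def)
  note rs = twin_homsD(1-4)[OF tw] and conj = twin_homsD(5)[OF tw] and nonconj = twin_homsD(6)[OF tw]
  have rG: "r h \<in> carrier G" "s h \<in> carrier G" if "h \<in> carrier H" for h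
    by (rule hom_in_carrier[OF rs(1) that], rule hom_in_carrier[OF rs(2) that])
  have f_conj: "f (t \<otimes>\<^bsub>G\<^esub> x \<otimes>\<^bsub>G\<^esub> inv\<^bsub>G\<^esub> t) = f t \<otimes>\<^bsub>G'\<^esub> f x \<otimes>\<^bsub>G'\<^esub> inv\<^bsub>G'\<^esub> f t"
    if "t \<in> carrier G" "x \<in> carrier G" for t x
    using that by (simp add: f.hom_mult f.hom_inv)
  show ?thesis
    unfolding twin_homs_def
  proof (intro conjI allI impI ballI)
    show "f \<circ> r \<in> hom H G'" "f \<circ> s \<in> hom H G'"
      by (rule hom_compose[OF rs(1) f.homh], rule hom_compose[OF rs(2) f.homh])
    show "inj_on (f \<circ> r) (carrier H)" "inj_on (f \<circ> s) (carrier H)"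
      by (intro comp_inj_on rs inj_on_subset[OF inj] image_subsetI rG; assumption)+
  next
    fix K assume K: "subgroup K H \<and> solvable (H\<lparr>carrier := K\<rparr>)"
    then obtain t where t: "t \<in> carrier G" "\<forall>k\<in>K. s k = t \<otimes>\<^bsub>G\<^esub> r k \<otimes>\<^bsub>G\<^esub> inv\<^bsub>G\<^esub> t"
      using conj[of K] by blast
    have "K \<subseteq> carrier H" using K subgroup.subset by blast
    then show "\<exists>t\<in>carrier G'. \<forall>k\<in>K. (f \<circ> s) k = t \<otimes>\<^bsub>G'\<^esub> (f \<circ> r) k \<otimes>\<^bsub>G'\<^esub> inv\<^bsub>G'\<^esub> t"
      using t f_conj rG by (intro bexI[of _ "f t"]) auto
  next
    fix t' assume "t' \<in> carrier G'"
    then obtain t where t: "t \<in> carrier G" "t' = f t" using surj by blast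
    show "(f \<circ> s) ` carrier H \<noteq> (\<lambda>x. t' \<otimes>\<^bsub>G'\<^esub> x \<otimes>\<^bsub>G'\<^esub> inv\<^bsub>G'\<^esub> t') ` (f \<circ> r) ` carrier H"
    proof
      assume eq: "(f \<circ> s) ` carrier H = (\<lambda>x. t' \<otimes>\<^bsub>G'\<^esub> x \<otimes>\<^bsub>G'\<^esub> inv\<^bsub>G'\<^esub> t') ` (f \<circ> r) ` carrier H"
      let ?C = "(\<lambda>x. t \<otimes>\<^bsub>G\<^esub> x \<otimes>\<^bsub>G\<^esub> inv\<^bsub>G\<^esub> t) ` r ` carrier H"
      have im: "f ` s ` carrier H = f ` ?C"
        using eq f_conj[OF t(1)] rG by (simp add: image_image image_comp[symmetric] t(2) cong: image_cong)
      have sub: "s ` carrier H \<subseteq> carrier G" "?C \<subseteq> carrier G" using rG t(1) by auto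
      have "s ` carrier H = ?C" using im unfolding inj_on_image_eq_iff[OF inj sub] .
      then show False using nonconj[OF t(1)] by blast
    qed
  qed
qed

section \<open>Fixed fields, their Galois closures and their isomorphisms\<close>

locale generated_galois = finite_galois_over_rat +
  fixes c :: complex
  assumes c: "c \<in> L" and c_triv: "\<And>g. g \<in> carrier G \<Longrightarrow> g c = c \<Longrightarrow> g = \<one>\<^bsub>G\<^esub>"
    and fin_dim: "ring.finite_dimension \<CC> \<rat> L"
begin

lemma algebraic: "x \<in> L \<Longrightarrow> algebraic_rat x"
proof -
  assume x: "x \<in> L"
  obtain q where q: "(\<Prod>z\<in>orbit x. [:- z, 1:]) = map_poly of_rat q" using orbit_poly_rat[OF x] by blast
  have fin: "finite (orbit x)" using fin_Gal by (simp add: orbit_def)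
  have "rpoly q x = (\<Prod>z\<in>orbit x. x - z)" unfolding rpoly_def q[symmetric] by (simp add: poly_prod)
  also have "\<dots> = 0" using orbit_self[OF x] fin by (intro prod_zero) auto
  finally have "rpoly q x = 0" .
  moreover have "q \<noteq> 0"
  proof
    assume "q = 0"
    then have "(\<Prod>z\<in>orbit x. [:- z, 1:]) = 0" using q by simp
    then show False using fin by simp
  qed
  ultimately show ?thesis by (auto simp: algebraic_rat_def)
qed

definition fixed_field :: "(complex \<Rightarrow> complex) set \<Rightarrow> complex set"
  where "fixed_field S = {x \<in> L. \<forall>g\<in>S. g x = x}"

lemma fixed_field_subfield:
  assumes S: "S \<subseteq> carrier G"
  shows "complex_subfield (fixed_field S)"
proof -
  have "g (inverse x) = inverse x" if g: "g \<in> carrier G" and x: "x \<in> L" "g x = x" for g x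
  proof (cases "x = 0")
    case False
    have "g x * g (inverse x) = g (x * inverse x)" using G_D(4)[OF g x(1) LD(6)[OF x(1)]] by simp
    also have "\<dots> = 1" using False G_D(5)[OF g, of 1] by simp
    finally show ?thesis using x(2) inverse_unique[of x "g (inverse x)"] by simp
  qed (use G_D(5)[OF g, of 0] in simp)
  moreover have "g (x - y) = x - y" "g (x * y) = x * y"
    if "g \<in> carrier G" "x \<in> L" "y \<in> L" "g x = x" "g y = y" for g x y
    using G_diff[OF that(1-3)] G_D(4)[OF that(1-3)] that(4,5) by simp_all
  moreover have "g 1 = 1" if "g \<in> carrier G" for g using G_D(5)[OF that] by simp
  ultimately show ?thesis
    using S LD by (simp add: complex_subfield_def fixed_field_def subset_iff)
qed

lemma fixed_field_number_field:
  assumes "S \<subseteq> carrier G"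
  shows "number_field (fixed_field S)"
proof -
  interpret field \<CC> by (rule CC_field)
  have Q: "subfield \<rat> \<CC>" by (simp add: subfield_CC_iff complex_subfield_rat)
  have K: "complex_subfield (fixed_field S)" by (rule fixed_field_subfield[OF assms])
  have "finite_dimension \<rat> (fixed_field S)"
    by (rule subalbegra_incl_imp_finite_dimension[OF Q fin_dim complex_subfield_subalgebra[OF K]])
      (auto simp: fixed_field_def)
  then show ?thesis using K by (simp add: number_field_def subfield_CC_iff)
qed

text \<open>For all but finitely many integers \<open>t\<close>, the value at \<open>t\<close> of the polynomial with roots \<open>S c\<close> has
  stabilizer \<open>S\<close>.\<close>

lemma ex_stabilizer:
  assumes S: "subgroup S G"
  shows "\<exists>b\<in>fixed_field S. \<forall>g\<in>carrier G. g b = b \<longrightarrow> g \<in> S"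
proof -
  have SG: "S \<subseteq> carrier G" using S subgroup.subset by blast
  have finS: "finite S" using SG fin_Gal finite_subset by blast
  define P where "P g = (\<Prod>h\<in>S. [:- (g \<otimes>\<^bsub>G\<^esub> h) c, 1:])" for g
  have P_val: "poly (P g) w = (\<Prod>h\<in>S. w - (g \<otimes>\<^bsub>G\<^esub> h) c)" for g w by (simp add: P_def poly_prod)
  \<comment> \<open>c is a root of the polynomial attached to the identity. Were it a root of the
    one attached to g, triviality of its stabilizer would put g into S.\<close>
  have P_ne: "P g - P \<one>\<^bsub>G\<^esub> \<noteq> 0" if g: "g \<in> carrier G" "g \<notin> S" for g
  proof
    assume "P g - P \<one>\<^bsub>G\<^esub> = 0"
    then have "poly (P g) c = poly (P \<one>\<^bsub>G\<^esub>) c" by simp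
    also have "\<dots> = 0"
      unfolding P_val using subgroup.one_closed[OF S] finS G_one[OF c]
      by (intro prod_zero bexI[of _ "\<one>\<^bsub>G\<^esub>"]) simp_all
    finally obtain h where h: "h \<in> S" "(g \<otimes>\<^bsub>G\<^esub> h) c = c" unfolding P_val using finS by auto
    then have "g \<otimes>\<^bsub>G\<^esub> h = \<one>\<^bsub>G\<^esub>" using c_triv g SG by blast
    then have "g = inv\<^bsub>G\<^esub> h" using g h SG by (intro inv_equality[symmetric]) auto
    then show False using g h subgroup.m_inv_closed[OF S] by blast
  qed
  let ?B = "\<Union>g\<in>carrier G - S. {w. poly (P g - P \<one>\<^bsub>G\<^esub>) w = 0}"
  have "finite ?B" using fin_Gal poly_roots_finite[OF P_ne] by auto
  then have "finite {t :: nat. of_nat t \<in> ?B}" by (intro finite_inverse_image) (auto simp: inj_on_def)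
  then obtain t :: nat where t: "of_nat t \<notin> ?B" using infinite_UNIV_nat by (metis UNIV_eq_I mem_Collect_eq)
  define b where "b = poly (P \<one>\<^bsub>G\<^esub>) (of_nat t)"
  have b_alt: "b = (\<Prod>h\<in>S. of_nat t - h c)" unfolding b_def P_val using SG by (intro prod.cong) auto
  have hL: "of_nat t - h c \<in> L" if "h \<in> S" for h
    using that SG G_D(6)[OF _ c] by (intro LD(4) complex_subfield_of_nat[OF L]) auto
  have bL: "b \<in> L" unfolding b_alt using hL by (rule complex_subfield_prod[OF L])
  have gb: "g b = poly (P g) (of_nat t)" if g: "g \<in> carrier G" for g
  proof -
    have "g b = (\<Prod>h\<in>S. g (of_nat t - h c))" unfolding b_alt using hL by (rule G_prod[OF g])
    also have "\<dots> = (\<Prod>h\<in>S. of_nat t - (g \<otimes>\<^bsub>G\<^esub> h) c)"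
    proof (rule prod.cong[OF refl])
      fix h assume "h \<in> S"
      then have h: "h \<in> carrier G" using SG by blast
      then show "g (of_nat t - h c) = of_nat t - (g \<otimes>\<^bsub>G\<^esub> h) c"
        using G_diff[OF g complex_subfield_of_nat[OF L] G_D(6)[OF h c], of t] G_D(5)[OF g, of "of_nat t"]
          G_mult[OF g h c] by simp
    qed
    finally show ?thesis by (simp add: P_val)
  qed
  have "g b = b" if g: "g \<in> S" for g
  proof -
    have gG: "g \<in> carrier G" using g SG by blast
    have "bij_betw (\<lambda>h. g \<otimes>\<^bsub>G\<^esub> h) S S"
      by (rule bij_betwI[where g = "\<lambda>h. inv\<^bsub>G\<^esub> g \<otimes>\<^bsub>G\<^esub> h"])
        (use g gG SG subgroup.m_closed[OF S] subgroup.m_inv_closed[OF S] in \<open>auto simp: m_assoc[symmetric] subset_iff\<close>)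
    then have "(\<Prod>h\<in>S. of_nat t - (g \<otimes>\<^bsub>G\<^esub> h) c) = b"
      unfolding b_alt by (rule prod.reindex_bij_betw)
    then show ?thesis using gb[OF gG] by (simp add: P_val)
  qed
  moreover have "g \<in> S" if "g \<in> carrier G" "g b = b" for g
  proof (rule ccontr)
    assume "g \<notin> S"
    then have "poly (P g - P \<one>\<^bsub>G\<^esub>) (of_nat t) \<noteq> 0" using t that(1) by blast
    then show False using gb[OF that(1)] that(2) by (simp add: b_def)
  qed
  ultimately show ?thesis using bL by (intro bexI[of _ b]) (auto simp: fixed_field_def)
qed

text \<open>The element b with stabilizer S lies in the fixed field, and every automorphism outside
  S moves it.\<close>

lemma Gal_fixed_field:
  assumes S: "subgroup S G"
  shows "carrier (Gal L (fixed_field S)) = S"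
proof -
  have SG: "S \<subseteq> carrier G" using S subgroup.subset by blast
  have K: "complex_subfield (fixed_field S)" by (rule fixed_field_subfield[OF SG])
  have KL: "fixed_field S \<subseteq> L" by (auto simp: fixed_field_def)
  have one: "1 \<in> fixed_field S" by (rule complex_subfieldD(1)[OF K])
  note iff = Gal_iff[OF L one KL] Gal_iff[OF L Rats_1 rat_sub]
  obtain b where b: "b \<in> fixed_field S" "\<forall>g\<in>carrier G. g b = b \<longrightarrow> g \<in> S" using ex_stabilizer[OF S] by blast
  show ?thesis
  proof
    show "S \<subseteq> carrier (Gal L (fixed_field S))"
    proof
      fix g assume g: "g \<in> S"
      then have "g \<in> carrier G" using SG by blast
      then show "g \<in> carrier (Gal L (fixed_field S))"
        using g unfolding iff by (auto simp: fixed_field_def)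
    qed
    show "carrier (Gal L (fixed_field S)) \<subseteq> S"
    proof
      fix g assume g: "g \<in> carrier (Gal L (fixed_field S))"
      then have "g \<in> carrier G" using complex_subfield_Rats[OF K] unfolding iff by blast
      moreover have "g b = b" using g b(1) unfolding iff by blast
      ultimately show "g \<in> S" using b(2) by blast
    qed
  qed
qed

lemma galois_extension_rat: "galois_extension \<rat> L"
  using L fin_dim rat_sub fixed_rat G_D(5)
  by (auto simp: galois_extension_def subfield_CC_iff complex_subfield_rat)

text \<open>A Galois field M that contains the fixed field contains all conjugates of b. An
  automorphism fixing all of them lies in every conjugate of S and is trivial by
  \<open>core\<close>. A generic combination d of the conjugates therefore has trivial stabilizer,
  and interpolation at d puts L into M.\<close>

lemma galois_closure_fixed_field:
  assumes S: "subgroup S G"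
    and core: "\<And>s. s \<in> carrier G \<Longrightarrow> (\<And>g. g \<in> carrier G \<Longrightarrow> inv\<^bsub>G\<^esub> g \<otimes>\<^bsub>G\<^esub> s \<otimes>\<^bsub>G\<^esub> g \<in> S) \<Longrightarrow> s = \<one>\<^bsub>G\<^esub>"
  shows "is_galois_closure (fixed_field S) L"
proof -
  obtain b where b: "b \<in> fixed_field S" "\<forall>g\<in>carrier G. g b = b \<longrightarrow> g \<in> S" using ex_stabilizer[OF S] by blast
  then have bL: "b \<in> L" by (simp add: fixed_field_def)
  have "L \<subseteq> M" if M: "galois_extension \<rat> M" "fixed_field S \<subseteq> M" for M
  proof -
    have Msub: "complex_subfield M" using M by (simp add: galois_extension_def subfield_CC_iff)
    interpret M: galois_over_rat M
      by unfold_locales (use M Msub in \<open>auto simp: galois_extension_def\<close>)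
    have bM: "b \<in> M" using b M by blast
    have conj: "g b \<in> M" if g: "g \<in> carrier G" for g
    proof -
      have "g b \<in> M.orbit b"
      proof (rule M.conjugate_in_orbit[OF bM algebraic[OF bL]])
        fix q assume "rpoly q b = 0"
        then show "rpoly q (g b) = 0" using G_rpoly[OF g bL, of q] G_D(5)[OF g, of 0] by simp
      qed
      then show ?thesis using M.orbit_subset[OF bM] by blast
    qed
    obtain gs where gs: "set gs = carrier G" "distinct gs" using finite_distinct_list[OF fin_Gal] by blast
    \<comment> \<open>A polynomial in t whose value is s d - d for the combination d formed with the
      powers of t. It is nonzero for nontrivial s, so all but finitely many t give a d with trivial
      stabilizer.\<close>
    define D where "D s = Poly (map (\<lambda>g. s (g b) - g b) gs)" for s :: "complex \<Rightarrow> complex"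
    have D_ne: "D s \<noteq> 0" if s: "s \<in> carrier G" "s \<noteq> \<one>\<^bsub>G\<^esub>" for s
    proof
      assume "D s = 0"
      have "s (g b) = g b" if g: "g \<in> carrier G" for g
      proof -
        obtain i where i: "i < length gs" "gs ! i = g" using g gs(1) by (metis in_set_conv_nth)
        have "coeff (D s) i = s (g b) - g b" unfolding D_def using i by (simp add: coeff_Poly nth_default_def)
        then show ?thesis using \<open>D s = 0\<close> by simp
      qed
      then have "(inv\<^bsub>G\<^esub> g \<otimes>\<^bsub>G\<^esub> s \<otimes>\<^bsub>G\<^esub> g) b = b" if g: "g \<in> carrier G" for g
        using that s bL G_D(6)[OF that bL] G_inv(1)[OF that bL]
        by (simp add: G_mult)
      then have "inv\<^bsub>G\<^esub> g \<otimes>\<^bsub>G\<^esub> s \<otimes>\<^bsub>G\<^esub> g \<in> S" if "g \<in> carrier G" for g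
        using b(2) s that by simp
      then show False using core s by blast
    qed
    let ?B = "\<Union>s\<in>carrier G - {\<one>\<^bsub>G\<^esub>}. {w. poly (D s) w = 0}"
    have "finite ?B" using fin_Gal poly_roots_finite[OF D_ne] by auto
    then have "finite {t :: nat. of_nat t \<in> ?B}" by (intro finite_inverse_image) (auto simp: inj_on_def)
    then obtain t :: nat where t: "of_nat t \<notin> ?B" using infinite_UNIV_nat by (metis UNIV_eq_I mem_Collect_eq)
    define d where "d = (\<Sum>i<length gs. (gs ! i) b * of_nat t ^ i)"
    have gsi: "gs ! i \<in> carrier G" if "i < length gs" for i using gs that nth_mem by blast
    have tL: "of_nat t ^ i \<in> L" "of_nat t ^ i \<in> M" for i
      using complex_subfield_power complex_subfield_of_nat L Msub by blast+
    have termL: "(gs ! i) b * of_nat t ^ i \<in> L" if "i \<in> {..<length gs}" for i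
      using LD(5)[OF G_D(6)[OF gsi bL] tL(1)] that by simp
    have dL: "d \<in> L" unfolding d_def using termL by (rule complex_subfield_sum[OF L])
    have dM: "d \<in> M" unfolding d_def
      using conj gsi tL(2) by (intro complex_subfield_sum[OF Msub] complex_subfieldD(5)[OF Msub]) auto
    have triv: "s = \<one>\<^bsub>G\<^esub>" if s: "s \<in> carrier G" "s d = d" for s
    proof (rule ccontr)
      assume ne: "s \<noteq> \<one>\<^bsub>G\<^esub>"
      have "s d = (\<Sum>i<length gs. s ((gs ! i) b * of_nat t ^ i))"
        unfolding d_def using termL by (rule G_sum[OF s(1)])
      also have "\<dots> = (\<Sum>i<length gs. s ((gs ! i) b) * of_nat t ^ i)"
      proof (rule sum.cong[OF refl])
        fix i assume "i \<in> {..<length gs}"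
        then show "s ((gs ! i) b * of_nat t ^ i) = s ((gs ! i) b) * of_nat t ^ i"
          using G_D(4)[OF s(1) G_D(6)[OF gsi bL] tL(1)] G_D(5)[OF s(1), of "of_nat t ^ i"] by simp
      qed
      finally have "(\<Sum>i<length gs. (s ((gs ! i) b) - (gs ! i) b) * of_nat t ^ i) = 0"
        using s(2) by (simp add: d_def left_diff_distrib sum_subtractf)
      also have "(\<Sum>i<length gs. (s ((gs ! i) b) - (gs ! i) b) * of_nat t ^ i) = poly (D s) (of_nat t)"
      proof -
        have deg: "Polynomial.degree (D s) \<le> length gs"
          unfolding D_def by (rule order_trans[OF degree_Poly]) simp
        have "poly (D s) (of_nat t) = (\<Sum>i\<le>length gs. coeff (D s) i * of_nat t ^ i)"
          by (rule poly_eq_sum_le[OF deg])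
        also have "\<dots> = (\<Sum>i<length gs. coeff (D s) i * of_nat t ^ i)"
          unfolding lessThan_Suc_atMost[symmetric] by (simp add: D_def coeff_Poly nth_default_def)
        also have "\<dots> = (\<Sum>i<length gs. (s ((gs ! i) b) - (gs ! i) b) * of_nat t ^ i)"
          by (intro sum.cong) (simp_all add: D_def coeff_Poly nth_default_def)
        finally show ?thesis by simp
      qed
      finally show False using t s(1) ne by blast
    qed
    show "L \<subseteq> M" using mem_subfield_if_trivial_stabilizer[OF Msub dL dM triv] by blast
  qed
  then show ?thesis
    using galois_extension_rat by (auto simp: is_galois_closure_def fixed_field_def)
qed

text \<open>The isomorphism sends b to a conjugate g b that T fixes. So T lies in the conjugate of S
  by g, and equal cardinality makes the inclusion an equality.\<close>

lemma conjugate_if_fixed_fields_isomorphic: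
  assumes S: "subgroup S G" and T: "subgroup T G" and card: "card S = card T"
    and iso: "fields_isomorphic (fixed_field S) (fixed_field T)"
  shows "\<exists>g\<in>carrier G. T = (\<lambda>x. g \<otimes>\<^bsub>G\<^esub> x \<otimes>\<^bsub>G\<^esub> inv\<^bsub>G\<^esub> g) ` S"
proof -
  have SG: "S \<subseteq> carrier G" "T \<subseteq> carrier G" using S T subgroup.subset by blast+
  let ?K = "fixed_field S" and ?K' = "fixed_field T"
  obtain f where "f \<in> ring_iso (\<CC>\<lparr>carrier := ?K\<rparr>) (\<CC>\<lparr>carrier := ?K'\<rparr>)"
    using iso by (auto simp: fields_isomorphic_def is_ring_iso_def)
  then have f: "f \<in> Ring.ring_hom (\<CC>\<lparr>carrier := ?K\<rparr>) (\<CC>\<lparr>carrier := ?K'\<rparr>)"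
    by (simp add: ring_iso_def)
  have K: "complex_subfield ?K" by (rule fixed_field_subfield[OF SG(1)])
  have fD: "f 1 = 1" "x \<in> ?K \<Longrightarrow> f x \<in> ?K'" "x \<in> ?K \<Longrightarrow> y \<in> ?K \<Longrightarrow> f (x + y) = f x + f y"
    "x \<in> ?K \<Longrightarrow> y \<in> ?K \<Longrightarrow> f (x * y) = f x * f y" for x y
    using ring_hom_one[OF f] ring_hom_closed[OF f, of x] ring_hom_add[OF f, of x y] ring_hom_mult[OF f, of x y]
    by simp_all
  obtain b where b: "b \<in> ?K" "\<forall>g\<in>carrier G. g b = b \<longrightarrow> g \<in> S" using ex_stabilizer[OF S] by blast
  then have bL: "b \<in> L" by (simp add: fixed_field_def)
  have "f b \<in> orbit b"
  proof (rule conjugate_in_orbit[OF bL algebraic[OF bL]])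
    fix q assume q: "rpoly q b = 0"
    have "f 0 = 0" using fD(3)[of 0 0] complex_subfieldD(2)[OF K] by simp
    then show "rpoly q (f b) = 0" using hom_rpoly[OF K fD(1,3,4) b(1), of q] q by simp
  qed
  then obtain g where g: "g \<in> carrier G" "f b = g b" by (auto simp: orbit_def)
  have conj: "inv\<^bsub>G\<^esub> g \<otimes>\<^bsub>G\<^esub> t \<otimes>\<^bsub>G\<^esub> g \<in> S" if t: "t \<in> T" for t
  proof -
    have tG: "t \<in> carrier G" using t SG by blast
    have "t (g b) = g b" using fD(2)[OF b(1)] g(2) t by (simp add: fixed_field_def)
    then have "(inv\<^bsub>G\<^esub> g \<otimes>\<^bsub>G\<^esub> t \<otimes>\<^bsub>G\<^esub> g) b = b"
      using g(1) tG bL G_D(6)[OF g(1) bL] G_inv(1)[OF g(1) bL] by (simp add: G_mult)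
    then show ?thesis using b(2) g(1) tG by simp
  qed
  let ?C = "(\<lambda>x. g \<otimes>\<^bsub>G\<^esub> x \<otimes>\<^bsub>G\<^esub> inv\<^bsub>G\<^esub> g) ` S"
  have "T \<subseteq> ?C"
  proof
    fix t assume t: "t \<in> T"
    then have tG: "t \<in> carrier G" using SG by blast
    have "t = g \<otimes>\<^bsub>G\<^esub> (inv\<^bsub>G\<^esub> g \<otimes>\<^bsub>G\<^esub> t \<otimes>\<^bsub>G\<^esub> g) \<otimes>\<^bsub>G\<^esub> inv\<^bsub>G\<^esub> g"
      using g(1) tG by (simp add: m_assoc) (simp add: m_assoc[symmetric])
    then show "t \<in> ?C" using conj[OF t] by (rule image_eqI)
  qed
  moreover have "finite ?C" using SG fin_Gal finite_subset by blast
  moreover have "card ?C \<le> card T" using card card_image_le[of S] SG fin_Gal finite_subset by metis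
  ultimately have "T = ?C" by (intro card_seteq)
  then show ?thesis using g(1) by blast
qed

theorem ex_solvably_equivalent_pair:
  assumes simple: "\<And>N. N \<lhd> G \<Longrightarrow> N = {\<one>\<^bsub>G\<^esub>} \<or> N = carrier G"
    and H: "group H" and tw: "twin_homs H G r s"
  shows "\<exists>K\<^sub>1 K\<^sub>2. solvably_equivalent_fields K\<^sub>1 K\<^sub>2 \<and> \<not> fields_isomorphic K\<^sub>1 K\<^sub>2 \<and>
    is_galois_closure K\<^sub>1 L"
proof -
  interpret H: group H by (rule H)
  note rs = twin_homsD(1-4)[OF tw] and nonconj = twin_homsD(6)[OF tw]
  interpret r: group_hom H G r using rs by unfold_locales
  interpret s: group_hom H G s using rs by unfold_locales
  let ?S = "r ` carrier H" and ?T = "s ` carrier H"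
  have sub: "subgroup ?S G" "subgroup ?T G" by (rule r.img_is_subgroup, rule s.img_is_subgroup)
  have SG: "?S \<subseteq> carrier G" "?T \<subseteq> carrier G" using sub subgroup.subset by blast+
  have card: "card ?S = card ?T" using rs by (simp add: card_image)
  \<comment> \<open>The images have equal size, so if one were the whole group both would be, and
    they would be conjugate by the identity.\<close>
  have proper: "?S \<noteq> carrier G" "?T \<noteq> carrier G"
  proof -
    have "?S \<noteq> ?T"
      using nonconj[OF one_closed] SG by (auto simp: image_image cong: image_cong)
    then show "?S \<noteq> carrier G" "?T \<noteq> carrier G"
      using card SG fin_Gal by (metis card_subset_eq)+
  qed
  have core: "x = \<one>\<^bsub>G\<^esub>" if S: "subgroup S G" "S \<noteq> carrier G" and x: "x \<in> carrier G"
    "\<And>g. g \<in> carrier G \<Longrightarrow> inv\<^bsub>G\<^esub> g \<otimes>\<^bsub>G\<^esub> x \<otimes>\<^bsub>G\<^esub> g \<in> S" for S x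
  proof -
    \<comment> \<open>The normal core of S. It is normal and contained in the proper subgroup S, so
      simplicity makes it trivial.\<close>
    define N where "N = {x \<in> carrier G. \<forall>g\<in>carrier G. inv\<^bsub>G\<^esub> g \<otimes>\<^bsub>G\<^esub> x \<otimes>\<^bsub>G\<^esub> g \<in> S}"
    have "N \<lhd> G"
      unfolding normal_inv_iff
    proof (intro conjI ballI)
      show "subgroup N G"
      proof (rule subgroupI)
        show "N \<subseteq> carrier G" by (auto simp: N_def)
        show "N \<noteq> {}" using subgroup.one_closed[OF S(1)] by (auto simp: N_def intro!: exI[of _ "\<one>\<^bsub>G\<^esub>"])
        show "inv\<^bsub>G\<^esub> a \<in> N" if a: "a \<in> N" for a
        proof -
          have "inv\<^bsub>G\<^esub> g \<otimes>\<^bsub>G\<^esub> inv\<^bsub>G\<^esub> a \<otimes>\<^bsub>G\<^esub> g \<in> S" if g: "g \<in> carrier G" for g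
          proof -
            have "inv\<^bsub>G\<^esub> (inv\<^bsub>G\<^esub> g \<otimes>\<^bsub>G\<^esub> a \<otimes>\<^bsub>G\<^esub> g) \<in> S"
              using a g subgroup.m_inv_closed[OF S(1)] by (simp add: N_def)
            then show ?thesis using a g by (simp add: N_def inv_mult_group m_assoc)
          qed
          then show ?thesis using a by (simp add: N_def)
        qed
        show "a \<otimes>\<^bsub>G\<^esub> b \<in> N" if ab: "a \<in> N" "b \<in> N" for a b
        proof -
          have "inv\<^bsub>G\<^esub> g \<otimes>\<^bsub>G\<^esub> (a \<otimes>\<^bsub>G\<^esub> b) \<otimes>\<^bsub>G\<^esub> g \<in> S" if g: "g \<in> carrier G" for g
          proof -
            have ab': "a \<in> carrier G" "b \<in> carrier G" using ab by (auto simp: N_def)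
            have conj: "inv\<^bsub>G\<^esub> g \<otimes>\<^bsub>G\<^esub> a \<otimes>\<^bsub>G\<^esub> g \<in> S" "inv\<^bsub>G\<^esub> g \<otimes>\<^bsub>G\<^esub> b \<otimes>\<^bsub>G\<^esub> g \<in> S"
              using ab g unfolding N_def by blast+
            have "g \<otimes>\<^bsub>G\<^esub> (inv\<^bsub>G\<^esub> g \<otimes>\<^bsub>G\<^esub> (b \<otimes>\<^bsub>G\<^esub> g)) = b \<otimes>\<^bsub>G\<^esub> g"
              using ab' g by (simp add: m_assoc[symmetric])
            then have "(inv\<^bsub>G\<^esub> g \<otimes>\<^bsub>G\<^esub> a \<otimes>\<^bsub>G\<^esub> g) \<otimes>\<^bsub>G\<^esub> (inv\<^bsub>G\<^esub> g \<otimes>\<^bsub>G\<^esub> b \<otimes>\<^bsub>G\<^esub> g) =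
                inv\<^bsub>G\<^esub> g \<otimes>\<^bsub>G\<^esub> (a \<otimes>\<^bsub>G\<^esub> b) \<otimes>\<^bsub>G\<^esub> g"
              using ab' g by (simp add: m_assoc)
            then show ?thesis using subgroup.m_closed[OF S(1) conj] by simp
          qed
          then show ?thesis using ab by (simp add: N_def)
        qed
      qed
      fix a h assume a: "a \<in> carrier G" and h: "h \<in> N"
      then have hG: "h \<in> carrier G" by (simp add: N_def)
      have "inv\<^bsub>G\<^esub> g \<otimes>\<^bsub>G\<^esub> (a \<otimes>\<^bsub>G\<^esub> h \<otimes>\<^bsub>G\<^esub> inv\<^bsub>G\<^esub> a) \<otimes>\<^bsub>G\<^esub> g \<in> S" if g: "g \<in> carrier G" for g
      proof -
        have "inv\<^bsub>G\<^esub> (inv\<^bsub>G\<^esub> a \<otimes>\<^bsub>G\<^esub> g) \<otimes>\<^bsub>G\<^esub> h \<otimes>\<^bsub>G\<^esub> (inv\<^bsub>G\<^esub> a \<otimes>\<^bsub>G\<^esub> g) \<in> S"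
          using h g a by (simp add: N_def)
        then show ?thesis using a g hG by (simp add: inv_mult_group m_assoc)
      qed
      then show "a \<otimes>\<^bsub>G\<^esub> h \<otimes>\<^bsub>G\<^esub> inv\<^bsub>G\<^esub> a \<in> N" using a hG by (simp add: N_def)
    qed
    then have "N = {\<one>\<^bsub>G\<^esub>} \<or> N = carrier G" by (rule simple)
    moreover have "N \<subseteq> S"
    proof
      fix y assume y: "y \<in> N"
      then have "inv\<^bsub>G\<^esub> \<one>\<^bsub>G\<^esub> \<otimes>\<^bsub>G\<^esub> y \<otimes>\<^bsub>G\<^esub> \<one>\<^bsub>G\<^esub> \<in> S" unfolding N_def by blast
      then show "y \<in> S" using y by (simp add: N_def)
    qed
    moreover have "x \<in> N" using x by (simp add: N_def)
    ultimately show ?thesis using S subgroup.subset[OF S(1)] by blast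
  qed
  note closure = galois_closure_fixed_field[OF sub(1) core[OF sub(1) proper(1)]]
    galois_closure_fixed_field[OF sub(2) core[OF sub(2) proper(2)]]
  have "solvably_equivalent_fields (fixed_field ?S) (fixed_field ?T)"
    unfolding solvably_equivalent_fields_def
  proof (intro conjI exI[of _ L])
    show "number_field (fixed_field ?S)" "number_field (fixed_field ?T)"
      using fixed_field_number_field SG by blast+
    show "solvably_equivalent_subgroups G (carrier (Gal L (fixed_field ?S))) (carrier (Gal L (fixed_field ?T)))"
      unfolding Gal_fixed_field[OF sub(1)] Gal_fixed_field[OF sub(2)]
      by (rule solvably_equivalent_if_twin_homs[OF H is_group fin_Gal tw])
  qed (use closure in blast)+
  moreover have "\<not> fields_isomorphic (fixed_field ?S) (fixed_field ?T)"
    using conjugate_if_fixed_fields_isomorphic[OF sub card] nonconj by blast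
  ultimately show ?thesis using closure(1) by blast
qed

end

subsection \<open>Inertia groups\<close>

context finite_galois_over_rat
begin

definition ints :: "complex set"
  where "ints = {x \<in> L. algebraic_int x}"

lemma ints_L: "x \<in> ints \<Longrightarrow> x \<in> L"
  by (simp add: ints_def)

lemma ints_closed:
  "x \<in> ints \<Longrightarrow> y \<in> ints \<Longrightarrow> x + y \<in> ints" "x \<in> ints \<Longrightarrow> y \<in> ints \<Longrightarrow> x - y \<in> ints"
  "x \<in> ints \<Longrightarrow> y \<in> ints \<Longrightarrow> x * y \<in> ints" "of_int k \<in> ints"
  using LD complex_subfield_of_int[OF L] algebraic_int_of_int
  by (simp_all add: ints_def algebraic_int_add_mult algebraic_int_diff)

lemma ints_01: "0 \<in> ints" "1 \<in> ints"
  using ints_closed(4)[of 0] ints_closed(4)[of 1] by simp_all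

lemma ints_uminus: "x \<in> ints \<Longrightarrow> - x \<in> ints"
  using ints_closed(2)[OF ints_01(1)] by simp

lemma ints_sum: "(\<And>i. i \<in> I \<Longrightarrow> f i \<in> ints) \<Longrightarrow> sum f I \<in> ints"
  by (induction I rule: infinite_finite_induct) (auto simp: ints_01 ints_closed)

lemma ints_prod: "(\<And>i. i \<in> I \<Longrightarrow> f i \<in> ints) \<Longrightarrow> prod f I \<in> ints"
  by (induction I rule: infinite_finite_induct) (auto simp: ints_01 ints_closed)

lemma ints_power: "x \<in> ints \<Longrightarrow> x ^ k \<in> ints"
  by (induction k) (auto simp: ints_01 ints_closed)

lemma int_domain_ints: "int_domain ints"
  using ints_01 ints_closed by (auto simp: int_domain_def)

lemma G_ints:
  assumes g: "g \<in> carrier G" and x: "x \<in> ints"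
  shows "g x \<in> ints"
proof -
  have xL: "x \<in> L" using x by (rule ints_L)
  obtain p :: "int poly" where p: "poly (map_poly of_int p) x = 0" "lead_coeff p = 1"
    using x unfolding ints_def algebraic_int_altdef_ipoly by blast
  have eq: "rpoly (map_poly of_int p) z = poly (map_poly of_int p) z" for z
    by (simp add: rpoly_def map_poly_map_poly comp_def)
  have "rpoly (map_poly of_int p) (g x) = g (rpoly (map_poly of_int p) x)"
    using G_rpoly[OF g xL] by simp
  also have "\<dots> = 0" using p(1) G_D(5)[OF g, of 0] by (simp add: eq)
  finally have "algebraic_int (g x)"
    unfolding algebraic_int_altdef_ipoly eq using p(2) by blast
  then show ?thesis using G_D(6)[OF g xL] by (simp add: ints_def)
qed

lemma ints_rat: "x \<in> ints \<Longrightarrow> x \<in> \<rat> \<Longrightarrow> \<exists>k. x = of_int k"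
  using algebraic_int_rat[of x] by (auto simp: ints_def elim: Ints_cases)

end

locale prime_over_rat = finite_galois_over_rat +
  fixes P :: "complex set" and q :: int
  assumes P: "prime_ideal_of ints P" and q: "Factorial_Ring.prime q" and qP: "of_int q \<in> P"
begin

lemma P_sub: "x \<in> P \<Longrightarrow> x \<in> ints"
  using P by (auto simp: prime_ideal_of_def)

lemma P_closed:
  "0 \<in> P" "1 \<notin> P" "x \<in> P \<Longrightarrow> y \<in> P \<Longrightarrow> x - y \<in> P" "r \<in> ints \<Longrightarrow> x \<in> P \<Longrightarrow> r * x \<in> P"
  "x \<in> ints \<Longrightarrow> y \<in> ints \<Longrightarrow> x * y \<in> P \<Longrightarrow> x \<in> P \<or> y \<in> P"
  using P by (auto simp: prime_ideal_of_def)

lemma P_uminus: "x \<in> P \<Longrightarrow> - x \<in> P"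
  using P_closed(3)[OF P_closed(1)] by simp

lemma P_add: "x \<in> P \<Longrightarrow> y \<in> P \<Longrightarrow> x + y \<in> P"
  using P_closed(3)[of x "- y"] P_uminus[of y] by simp

lemma P_mult_right: "r \<in> ints \<Longrightarrow> x \<in> P \<Longrightarrow> x * r \<in> P"
  using P_closed(4)[of r x] by (simp add: mult.commute)

lemma P_sum: "(\<And>i. i \<in> I \<Longrightarrow> f i \<in> P) \<Longrightarrow> sum f I \<in> P"
  by (induction I rule: infinite_finite_induct) (auto simp: P_closed(1) P_add)

lemma P_prod:
  assumes "finite I" "i \<in> I" "f i \<in> P" "\<And>j. j \<in> I \<Longrightarrow> f j \<in> ints"
  shows "prod f I \<in> P"
proof -
  have "prod f (I - {i}) \<in> ints" using assms(4) by (intro ints_prod) blast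
  then show ?thesis unfolding prod.remove[OF assms(1,2)] using assms(3) by (rule P_mult_right)
qed

lemma P_prod_iff:
  assumes "finite I" "\<And>j. j \<in> I \<Longrightarrow> f j \<in> ints"
  shows "prod f I \<in> P \<longleftrightarrow> (\<exists>i\<in>I. f i \<in> P)"
proof
  assume "prod f I \<in> P"
  with assms show "\<exists>i\<in>I. f i \<in> P"
  proof (induction I rule: finite_induct)
    case empty then show ?case using P_closed(2) by simp
  next
    case (insert j I)
    have "f j * prod f I \<in> P" "f j \<in> ints" "prod f I \<in> ints"
      using insert by (auto intro!: ints_prod)
    then have "f j \<in> P \<or> prod f I \<in> P" using P_closed(5) by blast
    then show ?case using insert by auto
  qed
qed (use P_prod[OF assms(1)] assms(2) in blast)

lemma P_power: "x \<in> ints \<Longrightarrow> x ^ k \<in> P \<Longrightarrow> x \<in> P"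
proof (induction k)
  case 0 then show ?case using P_closed(2) by simp
next
  case (Suc k) then show ?case using P_closed(5)[of x "x ^ k"] ints_power[of x k] by auto
qed

text \<open>If P contained an integer prime to q, a Bezout identity with q would bring 1 into
  P.\<close>

lemma of_int_in_P_iff: "of_int k \<in> P \<longleftrightarrow> q dvd k"
proof
  assume k: "of_int k \<in> P"
  show "q dvd k"
  proof (rule ccontr)
    assume "\<not> q dvd k"
    then have "coprime q k" using q by (simp add: prime_imp_coprime)
    then obtain u v where "u * q + v * k = 1"
      using bezout_int[of q k] by auto
    then have "of_int u * of_int q + of_int v * of_int k = (1 :: complex)"
      by (metis of_int_1 of_int_add of_int_mult)
    moreover have "of_int u * of_int q + of_int v * of_int k \<in> P"
      using k qP by (intro P_add P_closed(4) ints_closed(4))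
    ultimately show False using P_closed(2) by simp
  qed
next
  assume "q dvd k"
  then obtain j where "k = q * j" by (elim dvdE)
  then show "of_int k \<in> P" using P_mult_right[OF ints_closed(4) qP] by simp
qed

definition inertia :: "(complex \<Rightarrow> complex) set"
  where "inertia = {g \<in> carrier G. \<forall>x\<in>ints. g x - x \<in> P}"

lemma inertiaD: "g \<in> inertia \<Longrightarrow> g \<in> carrier G" "g \<in> inertia \<Longrightarrow> x \<in> ints \<Longrightarrow> g x - x \<in> P"
  by (auto simp: inertia_def)

lemma inertia_subgroup: "subgroup inertia G"
proof (rule subgroupI)
  show "inertia \<subseteq> carrier G" by (auto simp: inertia_def)
  have "\<one>\<^bsub>G\<^esub> \<in> inertia" by (simp add: inertia_def G_one ints_L P_closed(1))
  then show "inertia \<noteq> {}" by blast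
  show "inv\<^bsub>G\<^esub> g \<in> inertia" if g: "g \<in> inertia" for g
  proof -
    have gG: "g \<in> carrier G" using g by (rule inertiaD)
    have "(inv\<^bsub>G\<^esub> g) x - x \<in> P" if x: "x \<in> ints" for x
    proof -
      let ?y = "(inv\<^bsub>G\<^esub> g) x"
      have "?y \<in> ints" using G_ints[OF inv_closed[OF gG] x] .
      then have "g ?y - ?y \<in> P" using inertiaD(2)[OF g] by blast
      then show ?thesis using P_uminus[of "g ?y - ?y"] G_inv(2)[OF gG ints_L[OF x]] by simp
    qed
    then show ?thesis using gG by (simp add: inertia_def)
  qed
  show "g \<otimes>\<^bsub>G\<^esub> h \<in> inertia" if g: "g \<in> inertia" and h: "h \<in> inertia" for g h
  proof -
    have gh: "g \<in> carrier G" "h \<in> carrier G" using g h inertiaD by blast+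
    have "(g \<otimes>\<^bsub>G\<^esub> h) x - x \<in> P" if x: "x \<in> ints" for x
      using P_add[OF inertiaD(2)[OF g G_ints[OF gh(2) x]] inertiaD(2)[OF h x]]
        G_mult[OF gh ints_L[OF x]] by simp
    then show ?thesis using gh by (simp add: inertia_def)
  qed
qed

lemmas inertia_closed = subgroup.m_closed[OF inertia_subgroup] subgroup.m_inv_closed[OF inertia_subgroup]
  subgroup.one_closed[OF inertia_subgroup]

lemma finite_inertia: "finite inertia"
  using fin_Gal by (simp add: inertia_def)

lemma inertia_bij: "h \<in> inertia \<Longrightarrow> bij_betw (\<lambda>k. h \<otimes>\<^bsub>G\<^esub> k) inertia inertia"
  by (rule bij_betwI[where g = "\<lambda>k. inv\<^bsub>G\<^esub> h \<otimes>\<^bsub>G\<^esub> k"])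
    (auto simp: inertia_closed inertiaD(1) m_assoc[symmetric])

definition inertia_fixed :: "complex set"
  where "inertia_fixed = {z \<in> ints. \<forall>h\<in>inertia. h z = z}"

lemma inertia_fixedD:
  "z \<in> inertia_fixed \<Longrightarrow> z \<in> ints" "z \<in> inertia_fixed \<Longrightarrow> h \<in> inertia \<Longrightarrow> h z = z"
  by (simp_all add: inertia_fixed_def)

lemma inertia_fixedI: "z \<in> ints \<Longrightarrow> (\<And>h. h \<in> inertia \<Longrightarrow> h z = z) \<Longrightarrow> z \<in> inertia_fixed"
  by (simp add: inertia_fixed_def)

lemma inertia_fixed_mult:
  assumes z: "z \<in> inertia_fixed" and w: "w \<in> inertia_fixed" shows "z * w \<in> inertia_fixed"
proof (rule inertia_fixedI)
  show "z * w \<in> ints" using z w by (intro ints_closed(3) inertia_fixedD(1))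
  fix h assume h: "h \<in> inertia"
  have "h (z * w) = h z * h w"
    using z w by (intro G_D(4)[OF inertiaD(1)[OF h]] ints_L inertia_fixedD(1))
  then show "h (z * w) = z * w" using inertia_fixedD(2)[OF z h] inertia_fixedD(2)[OF w h] by simp
qed

lemma inertia_fixed_norm:
  assumes x: "x \<in> ints"
  shows "(\<Prod>h\<in>inertia. h x) \<in> inertia_fixed"
proof -
  have hx: "h x \<in> ints" if "h \<in> inertia" for h using G_ints[OF inertiaD(1)[OF that] x] .
  have "k (\<Prod>h\<in>inertia. h x) = (\<Prod>h\<in>inertia. h x)" if k: "k \<in> inertia" for k
  proof -
    have "k (\<Prod>h\<in>inertia. h x) = (\<Prod>h\<in>inertia. k (h x))"
      using hx ints_L by (intro G_prod[OF inertiaD(1)[OF k]]) blast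
    also have "\<dots> = (\<Prod>h\<in>inertia. (k \<otimes>\<^bsub>G\<^esub> h) x)"
      using G_mult[OF inertiaD(1)[OF k] inertiaD(1) ints_L[OF x]] by simp
    also have "\<dots> = (\<Prod>h\<in>inertia. h x)" by (rule prod.reindex_bij_betw[OF inertia_bij[OF k]])
    finally show ?thesis .
  qed
  then show ?thesis using hx by (simp add: inertia_fixed_def ints_prod)
qed

text \<open>A transversal of the left cosets of the inertia group. Traces of inertia-invariant elements
  must run over cosets rather than over \<open>G\<close>, because \<open>q\<close> may divide the order of the inertia group.\<close>

definition rep :: "(complex \<Rightarrow> complex) \<Rightarrow> complex \<Rightarrow> complex"
  where "rep s = (SOME t. t \<in> carrier G \<and> inv\<^bsub>G\<^esub> s \<otimes>\<^bsub>G\<^esub> t \<in> inertia)"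

definition transversal :: "(complex \<Rightarrow> complex) set"
  where "transversal = rep ` carrier G"

lemma rep: "s \<in> carrier G \<Longrightarrow> rep s \<in> carrier G \<and> inv\<^bsub>G\<^esub> s \<otimes>\<^bsub>G\<^esub> rep s \<in> inertia"
  unfolding rep_def by (rule someI[of _ s]) (simp add: inertia_closed(3))

lemma coset_trans:
  assumes "s \<in> carrier G" "t \<in> carrier G" "u \<in> carrier G"
    "inv\<^bsub>G\<^esub> s \<otimes>\<^bsub>G\<^esub> t \<in> inertia" "inv\<^bsub>G\<^esub> t \<otimes>\<^bsub>G\<^esub> u \<in> inertia"
  shows "inv\<^bsub>G\<^esub> s \<otimes>\<^bsub>G\<^esub> u \<in> inertia"
proof -
  have "t \<otimes>\<^bsub>G\<^esub> (inv\<^bsub>G\<^esub> t \<otimes>\<^bsub>G\<^esub> u) = u" using assms by (simp add: m_assoc[symmetric])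
  then have "(inv\<^bsub>G\<^esub> s \<otimes>\<^bsub>G\<^esub> t) \<otimes>\<^bsub>G\<^esub> (inv\<^bsub>G\<^esub> t \<otimes>\<^bsub>G\<^esub> u) = inv\<^bsub>G\<^esub> s \<otimes>\<^bsub>G\<^esub> u"
    using assms(1-3) by (simp add: m_assoc)
  then show ?thesis using inertia_closed(1)[OF assms(4,5)] by simp
qed

lemma coset_sym:
  assumes "s \<in> carrier G" "t \<in> carrier G" "inv\<^bsub>G\<^esub> s \<otimes>\<^bsub>G\<^esub> t \<in> inertia"
  shows "inv\<^bsub>G\<^esub> t \<otimes>\<^bsub>G\<^esub> s \<in> inertia"
  using inertia_closed(2)[OF assms(3)] assms(1,2) by (simp add: inv_mult_group)

lemma rep_eq:
  assumes "s \<in> carrier G" "t \<in> carrier G" "inv\<^bsub>G\<^esub> s \<otimes>\<^bsub>G\<^esub> t \<in> inertia"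
  shows "rep s = rep t"
proof -
  have "(\<lambda>u. u \<in> carrier G \<and> inv\<^bsub>G\<^esub> s \<otimes>\<^bsub>G\<^esub> u \<in> inertia) =
      (\<lambda>u. u \<in> carrier G \<and> inv\<^bsub>G\<^esub> t \<otimes>\<^bsub>G\<^esub> u \<in> inertia)"
    using coset_trans[OF assms(1,2) _ assms(3)] coset_trans[OF assms(2,1) _ coset_sym[OF assms]]
    by (intro ext) blast
  then show ?thesis by (simp add: rep_def)
qed

lemma transversal_sub: "s \<in> transversal \<Longrightarrow> s \<in> carrier G"
  using rep by (auto simp: transversal_def)

lemma transversal_unique:
  assumes "s \<in> transversal" "t \<in> transversal" "inv\<^bsub>G\<^esub> s \<otimes>\<^bsub>G\<^esub> t \<in> inertia"
  shows "s = t"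
proof -
  obtain s' t' where st: "s' \<in> carrier G" "s = rep s'" "t' \<in> carrier G" "t = rep t'"
    using assms by (auto simp: transversal_def)
  note G = transversal_sub[OF assms(1)] transversal_sub[OF assms(2)]
  have 1: "inv\<^bsub>G\<^esub> s' \<otimes>\<^bsub>G\<^esub> s \<in> inertia" "inv\<^bsub>G\<^esub> t' \<otimes>\<^bsub>G\<^esub> t \<in> inertia" using rep st by auto
  have "inv\<^bsub>G\<^esub> s' \<otimes>\<^bsub>G\<^esub> t \<in> inertia" by (rule coset_trans[OF st(1) G 1(1) assms(3)])
  then have "inv\<^bsub>G\<^esub> s' \<otimes>\<^bsub>G\<^esub> t' \<in> inertia"
    by (rule coset_trans[OF st(1) G(2) st(3) _ coset_sym[OF st(3) G(2) 1(2)]])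
  then show ?thesis using rep_eq st by simp
qed

lemma rep_act:
  assumes s: "s \<in> carrier G" and z: "z \<in> inertia_fixed"
  shows "rep s z = s z"
proof -
  let ?h = "inv\<^bsub>G\<^esub> s \<otimes>\<^bsub>G\<^esub> rep s"
  have r: "rep s \<in> carrier G" "?h \<in> inertia" using rep[OF s] by auto
  have zL: "z \<in> L" using ints_L[OF inertia_fixedD(1)[OF z]] .
  have "rep s = s \<otimes>\<^bsub>G\<^esub> ?h" using s r by (simp add: m_assoc[symmetric])
  then have "rep s z = s (?h z)" using G_mult[OF s inertiaD(1)[OF r(2)] zL] by simp
  then show ?thesis using inertia_fixedD(2)[OF z r(2)] by simp
qed

text \<open>On an element fixed by inertia, s z depends only on the coset of s. Left multiplication
  permutes the cosets, so the trace is fixed by the group and is a rational integer; it lies in P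
  and is therefore a multiple of q.\<close>

lemma trace_divisible:
  assumes z: "z \<in> inertia_fixed" and zP: "\<And>s. s \<in> carrier G \<Longrightarrow> s z \<in> P"
  shows "\<exists>w\<in>ints. (\<Sum>s\<in>transversal. s z) = of_int q * w"
proof -
  let ?T = "\<Sum>s\<in>transversal. s z"
  have zR: "z \<in> ints" using z by (simp add: inertia_fixed_def)
  have sz: "s z \<in> ints" if "s \<in> transversal" for s using G_ints[OF transversal_sub[OF that] zR] .
  have TR: "?T \<in> ints" using sz by (rule ints_sum)
  have "g ?T = ?T" if g: "g \<in> carrier G" for g
  proof -
    have bij: "bij_betw (\<lambda>s. rep (g \<otimes>\<^bsub>G\<^esub> s)) transversal transversal"
    proof -
      have inj: "inj_on (\<lambda>s. rep (g \<otimes>\<^bsub>G\<^esub> s)) transversal"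
      proof (rule inj_onI)
        fix s t assume st: "s \<in> transversal" "t \<in> transversal" "rep (g \<otimes>\<^bsub>G\<^esub> s) = rep (g \<otimes>\<^bsub>G\<^esub> t)"
        note G = transversal_sub[OF st(1)] transversal_sub[OF st(2)]
        have c: "g \<otimes>\<^bsub>G\<^esub> s \<in> carrier G" "g \<otimes>\<^bsub>G\<^esub> t \<in> carrier G" using g G by auto
        note r = rep[OF c(1)] rep[OF c(2)]
        have "inv\<^bsub>G\<^esub> (g \<otimes>\<^bsub>G\<^esub> s) \<otimes>\<^bsub>G\<^esub> (g \<otimes>\<^bsub>G\<^esub> t) \<in> inertia"
          using r st(3) coset_trans[OF c(1) _ c(2)] coset_sym[OF c(2)] by metis
        also have "inv\<^bsub>G\<^esub> (g \<otimes>\<^bsub>G\<^esub> s) \<otimes>\<^bsub>G\<^esub> (g \<otimes>\<^bsub>G\<^esub> t) = inv\<^bsub>G\<^esub> s \<otimes>\<^bsub>G\<^esub> (inv\<^bsub>G\<^esub> g \<otimes>\<^bsub>G\<^esub> g) \<otimes>\<^bsub>G\<^esub> t"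
          using g G by (simp only: inv_mult_group m_assoc m_closed inv_closed)
        also have "\<dots> = inv\<^bsub>G\<^esub> s \<otimes>\<^bsub>G\<^esub> t" using g G by simp
        finally show "s = t" using transversal_unique st by blast
      qed
      have "(\<lambda>s. rep (g \<otimes>\<^bsub>G\<^esub> s)) ` transversal \<subseteq> transversal"
        using g transversal_sub by (auto simp: transversal_def)
      then have "(\<lambda>s. rep (g \<otimes>\<^bsub>G\<^esub> s)) ` transversal = transversal"
        using inj fin_Gal by (intro endo_inj_surj) (simp_all add: transversal_def)
      then show ?thesis using inj by (simp add: bij_betw_def)
    qed
    have "g ?T = (\<Sum>s\<in>transversal. g (s z))"
      using sz ints_L by (intro G_sum[OF g]) blast
    also have "\<dots> = (\<Sum>s\<in>transversal. rep (g \<otimes>\<^bsub>G\<^esub> s) z)"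
      using rep_act[OF _ z] g transversal_sub G_mult[OF g _ ints_L[OF zR]]
      by (intro sum.cong) simp_all
    also have "\<dots> = ?T" by (rule sum.reindex_bij_betw[OF bij])
    finally show ?thesis .
  qed
  then have "?T \<in> \<rat>" by (rule fixed_rat[OF ints_L[OF TR]])
  then obtain k where k: "?T = of_int k" using ints_rat[OF TR] by blast
  have "?T \<in> P" using zP transversal_sub by (intro P_sum) blast
  then have "q dvd k" using of_int_in_P_iff k by simp
  then obtain j where "k = q * j" by (elim dvdE)
  then show ?thesis using k ints_closed(4)[of j] by auto
qed

text \<open>Weights that preserve the divisibility in \<open>trace_divisible\<close>. Starting from
  the constant 1, factors are multiplied on until only one coset is left in the trace.\<close>

definition trace_weight :: "((complex \<Rightarrow> complex) \<Rightarrow> complex) \<Rightarrow> bool"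
  where "trace_weight \<delta> \<longleftrightarrow> (\<forall>z\<in>inertia_fixed. (\<forall>s\<in>carrier G. s z \<in> P) \<longrightarrow>
    (\<exists>w\<in>ints. (\<Sum>s\<in>transversal. \<delta> s * s z) = of_int q * w))"

lemma trace_weight_one: "trace_weight (\<lambda>s. 1)"
  using trace_divisible by (simp add: trace_weight_def)

text \<open>Expanding the polynomial, the coefficients of N are absorbed into z, which stays fixed
  by inertia with all its conjugates in P, while the powers of x do not depend on s and leave the
  trace.\<close>

lemma trace_weight_mult:
  assumes d: "trace_weight \<delta>" and x: "x \<in> ints" and N: "\<And>i. coeff N i \<in> inertia_fixed"
  shows "trace_weight (\<lambda>s. \<delta> s * poly (map_poly s N) x)"
  unfolding trace_weight_def
proof (intro ballI impI)
  fix z assume z: "z \<in> inertia_fixed" and zP: "\<forall>s\<in>carrier G. s z \<in> P"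
  have NR: "coeff N i \<in> ints" for i using N by (simp add: inertia_fixed_def)
  have zR: "z \<in> ints" using z by (simp add: inertia_fixed_def)
  have "\<exists>w\<in>ints. (\<Sum>s\<in>transversal. \<delta> s * s (coeff N i * z)) = of_int q * w" for i
  proof -
    have "s (coeff N i * z) \<in> P" if s: "s \<in> carrier G" for s
      using G_D(4)[OF s ints_L[OF NR] ints_L[OF zR]] P_closed(4)[OF G_ints[OF s NR]] zP s by simp
    then show ?thesis using d inertia_fixed_mult[OF N z] unfolding trace_weight_def by blast
  qed
  then obtain w where w: "\<And>i. w i \<in> ints" "\<And>i. (\<Sum>s\<in>transversal. \<delta> s * s (coeff N i * z)) = of_int q * w i"
    by metis
  let ?n = "Polynomial.degree N"
  have val: "poly (map_poly s N) x = (\<Sum>i\<le>?n. s (coeff N i) * x ^ i)" if s: "s \<in> carrier G" for s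
    using poly_eq_sum_le[OF degree_map_poly_le[of s N], of x] G_D(5)[OF s, of 0] by (simp add: coeff_map_poly)
  have "(\<Sum>s\<in>transversal. \<delta> s * poly (map_poly s N) x * s z) =
      (\<Sum>s\<in>transversal. \<Sum>i\<le>?n. x ^ i * (\<delta> s * s (coeff N i * z)))"
  proof (rule sum.cong[OF refl])
    fix s assume "s \<in> transversal"
    then have s: "s \<in> carrier G" by (rule transversal_sub)
    show "\<delta> s * poly (map_poly s N) x * s z = (\<Sum>i\<le>?n. x ^ i * (\<delta> s * s (coeff N i * z)))"
      unfolding val[OF s] G_D(4)[OF s ints_L[OF NR] ints_L[OF zR]]
      by (simp add: sum_distrib_left sum_distrib_right ac_simps)
  qed
  also have "\<dots> = (\<Sum>i\<le>?n. x ^ i * (\<Sum>s\<in>transversal. \<delta> s * s (coeff N i * z)))"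
    by (subst sum.swap) (simp add: sum_distrib_left)
  also have "\<dots> = of_int q * (\<Sum>i\<le>?n. x ^ i * w i)"
    unfolding w(2) by (simp add: sum_distrib_left mult.left_commute)
  finally show "\<exists>w\<in>ints. (\<Sum>s\<in>transversal. \<delta> s * poly (map_poly s N) x * s z) = of_int q * w"
    using w(1) ints_power[OF x] by (intro bexI[of _ "\<Sum>i\<le>?n. x ^ i * w i"] ints_sum ints_closed(3))
qed

definition norm_poly :: "complex \<Rightarrow> complex poly"
  where "norm_poly y = (\<Prod>h\<in>inertia. [:- h y, 1:])"

lemma norm_poly_map:
  assumes s: "s \<in> carrier G" and y: "y \<in> ints"
  shows "map_poly s (norm_poly y) = (\<Prod>h\<in>inertia. [:- s (h y), 1:])"
proof -
  have hL: "h y \<in> L" if "h \<in> inertia" for h using G_D(6)[OF inertiaD(1)[OF that] ints_L[OF y]] .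
  have "map_poly s (norm_poly y) = (\<Prod>h\<in>inertia. map_poly s [:- h y, 1:])"
    unfolding norm_poly_def using hL LD(1,7) by (intro G_coeff_prod[OF s] coeffs_in_linear[OF L]) blast+
  also have "\<dots> = (\<Prod>h\<in>inertia. [:- s (h y), 1:])"
    using G_coeff_linear[OF s hL] by simp
  finally show ?thesis .
qed

lemma coeff_prod_linear_ints:
  assumes "\<And>i. i \<in> I \<Longrightarrow> f i \<in> ints"
  shows "coeff (\<Prod>i\<in>I. [:- f i, 1:]) k \<in> ints"
  using assms
proof (induction I arbitrary: k rule: infinite_finite_induct)
  case (insert i I)
  have "coeff (\<Prod>i\<in>insert i I. [:- f i, 1:]) k =
      (case k of 0 \<Rightarrow> 0 | Suc j \<Rightarrow> coeff (\<Prod>i\<in>I. [:- f i, 1:]) j) - f i * coeff (\<Prod>i\<in>I. [:- f i, 1:]) k"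
    using insert(1,2) by (simp add: coeff_pCons split: nat.split)
  also have "\<dots> \<in> ints" using insert by (auto intro!: ints_closed(2,3) ints_01 ints_uminus split: nat.split)
  finally show ?case .
qed (auto simp: ints_01 coeff_1)

lemma norm_poly_coeff:
  assumes y: "y \<in> ints"
  shows "coeff (norm_poly y) i \<in> inertia_fixed"
proof -
  have "k (coeff (norm_poly y) i) = coeff (norm_poly y) i" if k: "k \<in> inertia" for k
  proof -
    have "map_poly k (norm_poly y) = (\<Prod>h\<in>inertia. [:- (k \<otimes>\<^bsub>G\<^esub> h) y, 1:])"
      unfolding norm_poly_map[OF inertiaD(1)[OF k] y]
      using G_mult[OF inertiaD(1)[OF k] inertiaD(1) ints_L[OF y]] by simp
    also have "\<dots> = norm_poly y"
      unfolding norm_poly_def by (rule prod.reindex_bij_betw[OF inertia_bij[OF k]])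
    finally show ?thesis using G_D(5)[OF inertiaD(1)[OF k], of 0] by (metis coeff_map_poly Rats_0)
  qed
  moreover have "coeff (norm_poly y) i \<in> ints"
    unfolding norm_poly_def using G_ints[OF inertiaD(1) y] by (rule coeff_prod_linear_ints)
  ultimately show ?thesis by (simp add: inertia_fixed_def)
qed

text \<open>\<open>q\<close> is unramified below the inertia field. The weight \<open>\<delta>\<close> vanishes on every coset but the trivial
  one, so the weighted trace of \<open>z\<close> is a multiple of \<open>z\<close> by an element outside \<open>P\<close>.\<close>

lemma inertia_fixed_unramified_aux:
  assumes z: "z \<in> inertia_fixed" and zP: "\<And>s. s \<in> carrier G \<Longrightarrow> s z \<in> P"
  shows "\<exists>v\<in>ints. v \<notin> P \<and> (\<exists>w\<in>ints. v * z = of_int q * w)"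
proof -
  have zR: "z \<in> ints" using z by (simp add: inertia_fixed_def)
  let ?E = "carrier G - inertia"
  \<comment> \<open>For g outside inertia, x is chosen with y, the preimage of x under g,
    incongruent to x modulo P. The factor of the weight that belongs to g is the product of all x -
    s (h y) with h in inertia: it vanishes for s = g, while for s in inertia each term is congruent
    to x - y and so lies outside P.\<close>
  have "\<exists>x\<in>ints. (inv\<^bsub>G\<^esub> g) x - x \<notin> P" if g: "g \<in> ?E" for g
  proof (rule ccontr)
    assume "\<not> ?thesis"
    then have "inv\<^bsub>G\<^esub> g \<in> inertia" using g by (simp add: inertia_def)
    then show False using inertia_closed(2) g by fastforce
  qed
  then obtain x where x: "\<And>g. g \<in> ?E \<Longrightarrow> x g \<in> ints" "\<And>g. g \<in> ?E \<Longrightarrow> (inv\<^bsub>G\<^esub> g) (x g) - x g \<notin> P" by metis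
  define y where "y g = (inv\<^bsub>G\<^esub> g) (x g)" for g
  have y: "y g \<in> ints" if "g \<in> ?E" for g using G_ints[OF inv_closed x(1)] that by (simp add: y_def)
  define \<delta> where "\<delta> A s = (\<Prod>g\<in>A. poly (map_poly s (norm_poly (y g))) (x g))" for A s
  have weight: "trace_weight (\<delta> A)" if "finite A" "A \<subseteq> ?E" for A
    using that
  proof (induction A)
    case empty then show ?case using trace_weight_one by (simp add: \<delta>_def)
  next
    case (insert g A)
    then have "trace_weight (\<lambda>s. \<delta> A s * poly (map_poly s (norm_poly (y g))) (x g))"
      using x(1) norm_poly_coeff[OF y] by (intro trace_weight_mult) auto
    moreover have "\<delta> (insert g A) = (\<lambda>s. \<delta> A s * poly (map_poly s (norm_poly (y g))) (x g))"
      using insert(1,2) by (auto simp: \<delta>_def mult.commute)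
    ultimately show ?case by simp
  qed
  have finE: "finite ?E" using fin_Gal by simp
  have val: "\<delta> ?E s = (\<Prod>g\<in>?E. \<Prod>h\<in>inertia. x g - s (h (y g)))" if s: "s \<in> carrier G" for s
    unfolding \<delta>_def using norm_poly_map[OF s y] by (intro prod.cong) (simp_all add: poly_prod)
  have zero: "\<delta> ?E s = 0" if s: "s \<in> ?E" for s
  proof -
    have "x s - s (\<one>\<^bsub>G\<^esub> (y s)) = 0"
      using G_one[OF ints_L[OF y[OF s]]] G_inv(2)[of s "x s"] s ints_L[OF x(1)[OF s]] by (simp add: y_def)
    then have "(\<Prod>h\<in>inertia. x s - s (h (y s))) = 0"
      using finite_inertia inertia_closed(3) by (intro prod_zero) blast+
    then show ?thesis using s finE unfolding val[of s, OF DiffD1[OF s]] by (intro prod_zero) blast+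
  qed
  \<comment> \<open>The representative of the trivial coset is some element of inertia, not
    necessarily the identity.\<close>
  define s0 where "s0 = rep \<one>\<^bsub>G\<^esub>"
  have s0: "s0 \<in> inertia" "s0 \<in> transversal"
    using rep[OF one_closed] by (auto simp: s0_def transversal_def)
  have s0G: "s0 \<in> carrier G" using s0 inertiaD by blast
  let ?v = "\<delta> ?E s0"
  have factor: "x g - s0 (h (y g)) \<in> ints" "x g - s0 (h (y g)) \<notin> P" if g: "g \<in> ?E" and h: "h \<in> inertia" for g h
  proof -
    have hy: "h (y g) \<in> ints" using G_ints[OF inertiaD(1)[OF h] y[OF g]] .
    show R: "x g - s0 (h (y g)) \<in> ints" using x(1)[OF g] G_ints[OF s0G hy] by (rule ints_closed(2))
    have "s0 (h (y g)) - y g \<in> P"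
      using P_add[OF inertiaD(2)[OF s0(1) hy] inertiaD(2)[OF h y[OF g]]] by simp
    moreover have "y g - x g \<notin> P" using x(2)[OF g] by (simp add: y_def)
    ultimately show "x g - s0 (h (y g)) \<notin> P"
      using P_add[of "s0 (h (y g)) - y g" "x g - s0 (h (y g))"] P_uminus[of "x g - y g"] by auto
  qed
  have "?v \<in> ints" unfolding val[OF s0G] using factor(1) by (intro ints_prod)
  moreover have "?v \<notin> P"
    unfolding val[OF s0G] using factor finE finite_inertia
    by (subst P_prod_iff) (auto simp: P_prod_iff intro!: ints_prod)
  moreover have "(\<Sum>s\<in>transversal. \<delta> ?E s * s z) = ?v * z"
  proof -
    have "(\<Sum>s\<in>transversal. \<delta> ?E s * s z) = (\<Sum>s\<in>{s0}. \<delta> ?E s * s z)"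
    proof (rule sum.mono_neutral_right)
      show "finite transversal" using fin_Gal by (simp add: transversal_def)
      show "{s0} \<subseteq> transversal" using s0 by simp
      show "\<forall>s\<in>transversal - {s0}. \<delta> ?E s * s z = 0"
      proof
        fix s assume s: "s \<in> transversal - {s0}"
        then have sG: "s \<in> carrier G" using transversal_sub by blast
        have "s \<notin> inertia"
        proof
          assume "s \<in> inertia"
          then have "inv\<^bsub>G\<^esub> s0 \<otimes>\<^bsub>G\<^esub> s \<in> inertia" using s0(1) inertia_closed by blast
          then show False using transversal_unique s0(2) s by blast
        qed
        then show "\<delta> ?E s * s z = 0" using zero sG by simp
      qed
    qed
    also have "\<dots> = ?v * z" using inertia_fixedD(2)[OF z s0(1)] by simp
    finally show ?thesis .
  qed
  moreover have "\<exists>w\<in>ints. (\<Sum>s\<in>transversal. \<delta> ?E s * s z) = of_int q * w"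
    using weight[OF finE subset_refl] z zP unfolding trace_weight_def by blast
  ultimately show ?thesis by metis
qed

text \<open>The auxiliary lemma wants all conjugates in P, not only y itself. Multiplication by a
  suitable c outside P that is fixed by inertia achieves this: automorphisms in \<open>B\<close>
  send c into P, and the others send y into P.\<close>

lemma inertia_fixed_unramified:
  assumes y: "y \<in> inertia_fixed" "y \<in> P"
  shows "\<exists>v\<in>ints. v \<notin> P \<and> (\<exists>w\<in>ints. v * y = of_int q * w)"
proof -
  have yR: "y \<in> ints" using y P_sub by blast
  \<comment> \<open>For these s some r outside P is sent into P by s. Its inertia norm is fixed by
    inertia and stays outside P, since inertia preserves residues, and s still sends it into
    P.\<close>
  define B where "B = {s \<in> carrier G. \<exists>r\<in>ints. s r \<in> P \<and> r \<notin> P}"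
  have "\<forall>s\<in>B. \<exists>r\<in>ints. s r \<in> P \<and> r \<notin> P" by (simp add: B_def)
  then obtain r where r: "\<And>s. s \<in> B \<Longrightarrow> r s \<in> ints" "\<And>s. s \<in> B \<Longrightarrow> s (r s) \<in> P" "\<And>s. s \<in> B \<Longrightarrow> r s \<notin> P"
    by metis
  define N where "N s = (\<Prod>h\<in>inertia. h (r s))" for s
  have finB: "finite B" using fin_Gal by (simp add: B_def)
  have BG: "s \<in> carrier G" if "s \<in> B" for s using that by (simp add: B_def)
  have hr: "h (r s) \<in> ints" if "h \<in> inertia" "s \<in> B" for h s using G_ints[OF inertiaD(1) r(1)] that by blast
  have N_fixed: "N s \<in> inertia_fixed" if "s \<in> B" for s unfolding N_def by (rule inertia_fixed_norm[OF r(1)[OF that]])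
  have N_ints: "N s \<in> ints" if "s \<in> B" for s using N_fixed[OF that] by (simp add: inertia_fixed_def)
  have hr_P: "h (r s) \<notin> P" if "h \<in> inertia" "s \<in> B" for h s
    using inertiaD(2)[OF that(1) r(1)[OF that(2)]] r(3)[OF that(2)] P_closed(3)[of "h (r s)" "h (r s) - r s"] by auto
  have N_P: "N s \<notin> P" if s: "s \<in> B" for s
    unfolding N_def by (subst P_prod_iff[OF finite_inertia]) (use hr[OF _ s] hr_P[OF _ s] in auto)
  define c where "c = (\<Prod>s\<in>B. N s)"
  have cR: "c \<in> ints" unfolding c_def using N_ints by (rule ints_prod)
  have cP: "c \<notin> P"
    unfolding c_def by (subst P_prod_iff[OF finB]) (use N_ints N_P in auto)
  have c_fixed: "c \<in> inertia_fixed"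
  proof -
    have "h c = c" if h: "h \<in> inertia" for h
    proof -
      have "h c = (\<Prod>s\<in>B. h (N s))"
        unfolding c_def using N_ints ints_L by (intro G_prod[OF inertiaD(1)[OF h]]) blast
      also have "\<dots> = c" unfolding c_def using inertia_fixedD(2)[OF N_fixed h] by (intro prod.cong) simp_all
      finally show ?thesis .
    qed
    then show ?thesis using cR by (simp add: inertia_fixed_def)
  qed
  have all_P: "s (c * y) \<in> P" if s: "s \<in> carrier G" for s
  proof -
    have eq: "s (c * y) = s c * s y" using G_D(4)[OF s ints_L[OF cR] ints_L[OF yR]] .
    show ?thesis
    proof (cases "s \<in> B")
      case True
      have "s (N s) = (\<Prod>h\<in>inertia. s (h (r s)))"
        unfolding N_def using hr[OF _ True] ints_L by (intro G_prod[OF s]) blast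
      also have "\<dots> \<in> P"
      proof (rule P_prod[OF finite_inertia inertia_closed(3)])
        show "s (\<one>\<^bsub>G\<^esub> (r s)) \<in> P" using r(2)[OF True] G_one[OF ints_L[OF r(1)[OF True]]] by simp
        show "s (h (r s)) \<in> ints" if "h \<in> inertia" for h using G_ints[OF s hr[OF that True]] .
      qed
      finally have "s (N s) \<in> P" .
      moreover have "s c = (\<Prod>t\<in>B. s (N t))"
        unfolding c_def using N_ints ints_L by (intro G_prod[OF s]) blast
      ultimately have "s c \<in> P" using P_prod[OF finB True, of "\<lambda>t. s (N t)"] G_ints[OF s N_ints] by simp
      then show ?thesis unfolding eq using P_mult_right[OF G_ints[OF s yR]] by blast
    next
      case False
      then have back_P: "x \<in> P" if "x \<in> ints" "s x \<in> P" for x using s that by (auto simp: B_def)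
      \<comment> \<open>For s outside \<open>B\<close> the inverse of s maps P into P. As s is
        itself a power of its inverse, the group being finite, s also maps P into P.\<close>
      let ?t = "inv\<^bsub>G\<^esub> s"
      have tG: "?t \<in> carrier G" using s by simp
      have t_P: "?t x \<in> P" if "x \<in> P" for x
        using back_P[OF G_ints[OF tG P_sub[OF that]]] G_inv(2)[OF s ints_L[OF P_sub[OF that]]] that by simp
      have pow: "(?t [^]\<^bsub>G\<^esub> (k :: nat)) y \<in> P" for k
      proof (induction k)
        case 0 then show ?case using y(2) G_one[OF ints_L[OF yR]] by simp
      next
        case (Suc k)
        have "(?t [^]\<^bsub>G\<^esub> Suc k) y = ?t ((?t [^]\<^bsub>G\<^esub> k) y)"
          using G_mult[OF tG nat_pow_closed[OF tG] ints_L[OF yR], of k] nat_pow_Suc2[OF tG, of k] by simp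
        then show ?case using t_P[OF Suc] by simp
      qed
      have "Coset.order G > 0" using order_gt_0_iff_finite fin_Gal by blast
      then obtain k where k: "Coset.order G = Suc k" by (cases "Coset.order G") auto
      have "?t \<otimes>\<^bsub>G\<^esub> (?t [^]\<^bsub>G\<^esub> k) = \<one>\<^bsub>G\<^esub>"
        using pow_order_eq_1[OF tG] nat_pow_Suc2[OF tG, of k] by (simp add: k)
      then have "inv\<^bsub>G\<^esub> (?t [^]\<^bsub>G\<^esub> k) = ?t" by (rule inv_equality[OF _ nat_pow_closed[OF tG] tG])
      then have "?t [^]\<^bsub>G\<^esub> k = s" using inv_inv[OF nat_pow_closed[OF tG, of k]] inv_inv[OF s] by simp
      then have "s y \<in> P" using pow[of k] by simp
      then show ?thesis unfolding eq using P_closed(4)[OF G_ints[OF s cR]] by blast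
    qed
  qed
  have "\<exists>v\<in>ints. v \<notin> P \<and> (\<exists>w\<in>ints. v * (c * y) = of_int q * w)"
    by (rule inertia_fixed_unramified_aux, rule inertia_fixed_mult[OF c_fixed y(1)], rule all_P)
  then obtain v w where vw: "v \<in> ints" "v \<notin> P" "w \<in> ints" "v * (c * y) = of_int q * w" by blast
  have "v * c \<in> ints" by (rule ints_closed(3)[OF vw(1) cR])
  moreover have "v * c \<notin> P" using P_closed(5)[OF vw(1) cR] vw(2) cP by blast
  moreover have "(v * c) * y = of_int q * w" using vw(4) by (simp add: mult.assoc)
  ultimately show ?thesis using vw(3) by blast
qed

text \<open>The roots congruent to \<open>a\<close> that form one inertia orbit contribute a factor \<open>q\<close> to the product, so
  there is only one such orbit.\<close>

theorem inertia_transitive: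
  assumes A: "finite A" "A \<subseteq> ints" "\<And>g. g \<in> carrier G \<Longrightarrow> g ` A \<subseteq> A"
    and val: "(\<Prod>x\<in>A. of_int a - x) = of_int (q * c)" and c: "\<not> q dvd c"
    and x: "x \<in> A" "of_int a - x \<in> P" and y: "y \<in> A" "of_int a - y \<in> P"
  shows "\<exists>g\<in>inertia. g x = y"
proof (rule ccontr)
  assume neg: "\<not> ?thesis"
  define S where "S = {z \<in> A. of_int a - z \<in> P}"
  define B where "B = (\<lambda>g. g x) ` inertia"
  have aR: "of_int a \<in> ints" by (rule ints_closed(4))
  have S_stable: "g z \<in> S" if g: "g \<in> inertia" and z: "z \<in> S" for g z
  proof -
    have "z \<in> ints" using z A(2) by (auto simp: S_def)
    then have "g z - z \<in> P" by (rule inertiaD(2)[OF g])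
    then have "of_int a - g z \<in> P"
      using P_closed(3)[of "of_int a - z" "g z - z"] z by (simp add: S_def)
    moreover have "g z \<in> A" using A(3)[OF inertiaD(1)[OF g]] z by (auto simp: S_def)
    ultimately show ?thesis by (simp add: S_def)
  qed
  have xS: "x \<in> S" and yS: "y \<in> S" using x y by (simp_all add: S_def)
  have BS: "B \<subseteq> S" using S_stable xS by (auto simp: B_def)
  have "x = \<one>\<^bsub>G\<^esub> x" using A(2) x(1) by (intro G_one[symmetric] ints_L) blast
  then have xB: "x \<in> B" unfolding B_def using inertia_closed(3) by (rule image_eqI)
  have yB: "y \<notin> B" using neg by (auto simp: B_def)
  have finS: "finite S" using A(1) by (simp add: S_def)
  have SR: "z \<in> ints" if "z \<in> S" for z using that A(2) by (auto simp: S_def)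
  have inj: "inj_on g S" if "g \<in> inertia" for g
    using G_D(7)[OF inertiaD(1)[OF that]] ints_L[OF SR] by (auto simp: inj_on_def)
  have B_stable: "g ` B = B" if g: "g \<in> inertia" for g
  proof (rule endo_inj_surj)
    show "finite B" using finite_inertia by (simp add: B_def)
    show "g ` B \<subseteq> B"
    proof
      fix w assume "w \<in> g ` B"
      then obtain h where h: "h \<in> inertia" "w = g (h x)" by (auto simp: B_def)
      then have "w = (g \<otimes>\<^bsub>G\<^esub> h) x"
        using G_mult[OF inertiaD(1)[OF g] inertiaD(1)[OF h(1)] ints_L[OF SR[OF xS]]] by simp
      then show "w \<in> B" unfolding B_def using inertia_closed(1)[OF g h(1)] by blast
    qed
    show "inj_on g B" using inj[OF g] BS by (rule inj_on_subset)
  qed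
  have comp_stable: "g ` (S - B) = S - B" if g: "g \<in> inertia" for g
  proof -
    have "g ` S = S" using S_stable[OF g] inj[OF g] finS by (intro endo_inj_surj) auto
    then show ?thesis using inj_on_image_set_diff[OF inj[OF g], of S B] BS B_stable[OF g] by auto
  qed
  define nm :: "complex set \<Rightarrow> complex" where "nm D = (\<Prod>z\<in>D. of_int a - z)" for D
  have nm_R: "nm D \<in> ints" if "D \<subseteq> A" for D
    unfolding nm_def using that A(2) aR by (intro ints_prod ints_closed(2)) auto
  have nm_fixed: "nm D \<in> inertia_fixed" if D: "D \<subseteq> S" "\<And>g. g \<in> inertia \<Longrightarrow> g ` D = D" for D
  proof -
    have "g (nm D) = nm D" if g: "g \<in> inertia" for g
    proof -
      have gG: "g \<in> carrier G" using g inertiaD by blast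
      have DL: "z \<in> L" if "z \<in> D" for z using D(1) that SR ints_L by blast
      have "g (nm D) = (\<Prod>z\<in>D. g (of_int a - z))"
        unfolding nm_def using DL ints_L[OF aR] LD(4) by (intro G_prod[OF gG]) blast
      also have "\<dots> = (\<Prod>z\<in>D. of_int a - g z)"
        using G_diff[OF gG ints_L[OF aR] DL] G_D(5)[OF gG, of "of_int a"] by simp
      also have "\<dots> = nm D"
      proof -
        have "bij_betw g D D" using inj_on_subset[OF inj[OF g] D(1)] D(2)[OF g] by (simp add: bij_betw_def)
        then show ?thesis unfolding nm_def by (rule prod.reindex_bij_betw)
      qed
      finally show ?thesis .
    qed
    moreover have "nm D \<in> ints" using D(1) by (intro nm_R) (auto simp: S_def)
    ultimately show ?thesis by (simp add: inertia_fixed_def)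
  qed
  have nm_P: "nm D \<in> P" if "D \<subseteq> S" "z \<in> D" for D z
    unfolding nm_def
  proof (rule P_prod)
    show "finite D" using that finS finite_subset by blast
    show "z \<in> D" "of_int a - z \<in> P" using that by (auto simp: S_def)
    show "of_int a - w \<in> ints" if "w \<in> D" for w using \<open>D \<subseteq> S\<close> that SR aR ints_closed(2) by blast
  qed
  obtain v1 w1 where 1: "v1 \<in> ints" "v1 \<notin> P" "w1 \<in> ints" "v1 * nm B = of_int q * w1"
    using inertia_fixed_unramified[OF nm_fixed[OF BS B_stable] nm_P[OF BS xB]] by blast
  obtain v2 w2 where 2: "v2 \<in> ints" "v2 \<notin> P" "w2 \<in> ints" "v2 * nm (S - B) = of_int q * w2"
    using inertia_fixed_unramified[OF nm_fixed[OF Diff_subset comp_stable] nm_P[OF Diff_subset, of y]] yS yB by blast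
  have "nm A = nm S * nm (A - S)"
    unfolding nm_def using A(1) by (subst prod.subset_diff[of S A]) (auto simp: S_def mult.commute)
  also have "nm S = nm B * nm (S - B)"
    unfolding nm_def using finS BS by (subst prod.subset_diff[of B S]) (auto simp: mult.commute)
  finally have "of_int q * of_int c = nm B * nm (S - B) * nm (A - S)" using val by (simp add: nm_def)
  \<comment> \<open>One factor q cancels; the other puts the product of v1, v2 and c into P,
    although none of the three lies there.\<close>
  then have "of_int q * (v1 * v2 * of_int c) = (v1 * nm B) * (v2 * nm (S - B)) * nm (A - S)"
    by (simp add: algebra_simps)
  also have "\<dots> = of_int q * (of_int q * (w1 * w2 * nm (A - S)))"
    unfolding 1(4) 2(4) by (simp add: algebra_simps)
  finally have "v1 * v2 * of_int c = of_int q * (w1 * w2 * nm (A - S))"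
    using q by (simp add: prime_gt_0_int less_imp_neq)
  also have "\<dots> \<in> P"
    using 1(3) 2(3) nm_R[of "A - S"] by (intro P_mult_right qP ints_closed(3)) auto
  finally have "v1 * v2 * of_int c \<in> P" .
  then have "v1 * v2 \<in> P \<or> of_int c \<in> P"
    by (rule P_closed(5)[OF ints_closed(3)[OF 1(1) 2(1)] ints_closed(4)])
  then show False
    using P_closed(5)[OF 1(1) 2(1)] 1(2) 2(2) c of_int_in_P_iff by blast
qed

end

text \<open>The inverse of q is rational but not an integer, so q is not a unit of the ring of
  integers and lies in a prime ideal.\<close>

lemma (in finite_galois_over_rat) ex_prime_over:
  assumes "Factorial_Ring.prime (q :: int)"
  shows "\<exists>P. prime_over_rat L P q"
proof -
  have "of_int q * r \<noteq> 1" if r: "r \<in> ints" for r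
  proof
    assume "of_int q * r = 1"
    then have req: "r = 1 / of_int q" using assms by (auto simp: field_simps)
    then have "r \<in> \<rat>" by simp
    then obtain k where k: "r = of_int k" using ints_rat[OF r] by blast
    have "of_int (q * k) = (1 :: complex)" using \<open>of_int q * r = 1\<close> k by simp
    then have "q * k = 1" by (metis of_int_eq_1_iff)
    then show False using assms by (metis dvd_triv_left not_prime_unit)
  qed
  then obtain P where "prime_ideal_of ints P" "of_int q \<in> P"
    using ex_prime_ideal[OF int_domain_ints ints_closed(4)] by blast
  then show ?thesis
    by (intro exI[of _ P] prime_over_rat.intro prime_over_rat_axioms.intro finite_galois_over_rat_axioms assms)
qed

subsection \<open>A polynomial with alternating Galois group\<close>

lemma card_index_pairs: "2 * card (index_pairs n) = n * (n - 1)"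
proof (induction n)
  case 0
  have "index_pairs 0 = {}" by (auto simp: index_pairs_def)
  then show ?case by simp
next
  case (Suc n)
  have eq: "index_pairs (Suc n) = index_pairs n \<union> (\<lambda>i. (i, Suc n)) ` {1..n}"
    by (auto simp: index_pairs_def)
  have "card (index_pairs (Suc n)) = card (index_pairs n) + card ((\<lambda>i. (i, Suc n)) ` {1..n})"
    unfolding eq by (rule card_Un_disjoint[OF finite_index_pairs]) (auto simp: index_pairs_def)
  also have "card ((\<lambda>i. (i, Suc n)) ` {1..n}) = n" by (subst card_image) (auto simp: inj_on_def)
  finally show ?case using Suc by (cases n) simp_all
qed

text \<open>For the roots of a monic polynomial the left side is the product of the values of the
  derivative at the roots, so this relates the discriminant to a square.\<close>

lemma difference_product_square:
  "(\<Prod>i\<in>{1..n}. \<Prod>j\<in>{1..n} - {i}. x i - x j) = (- 1) ^ card (index_pairs n) * difference_product n x ^ 2"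
proof -
  let ?P = "index_pairs n" and ?sw = "\<lambda>(i :: nat, j :: nat). (j, i)"
  have "(\<Prod>i\<in>{1..n}. \<Prod>j\<in>{1..n} - {i}. x i - x j) = (\<Prod>(i, j)\<in>Sigma {1..n} (\<lambda>i. {1..n} - {i}). x i - x j)"
    by (rule prod.Sigma) auto
  also have "Sigma {1..n} (\<lambda>i. {1..n} - {i}) = ?P \<union> ?sw ` ?P"
    by (force simp: index_pairs_def)
  also have "(\<Prod>(i, j)\<in>?P \<union> ?sw ` ?P. x i - x j) = (\<Prod>(i, j)\<in>?P. x i - x j) * (\<Prod>(i, j)\<in>?sw ` ?P. x i - x j)"
    by (rule prod.union_disjoint[OF finite_index_pairs finite_imageI[OF finite_index_pairs]]) (auto simp: index_pairs_def)
  also have "(\<Prod>(i, j)\<in>?sw ` ?P. x i - x j) = difference_product n x"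
    unfolding difference_product_def by (subst prod.reindex) (auto simp: inj_on_def case_prod_unfold)
  also have "(\<Prod>(i, j)\<in>?P. x i - x j) = (\<Prod>ij\<in>?P. - 1 * (case ij of (i, j) \<Rightarrow> x j - x i))"
    by (rule prod.cong) auto
  also have "\<dots> = (- 1) ^ card ?P * difference_product n x"
    unfolding prod.distrib difference_product_def by simp
  finally show ?thesis by (simp add: power2_eq_square)
qed

text \<open>This counts the roots congruent to 0 as an order of vanishing: modulo P a factor with d
  x in P multiplies by the variable, and any other factor multiplies the lowest nonzero coefficient
  by something outside P.\<close>

lemma (in prime_over_rat) coeff_prod_linear_mod:
  assumes "finite A" "\<And>x. x \<in> A \<Longrightarrow> d x \<in> ints"
  shows "(\<forall>k < card {x \<in> A. d x \<in> P}. coeff (\<Prod>x\<in>A. [:d x, 1:]) k \<in> P) \<and>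
    coeff (\<Prod>x\<in>A. [:d x, 1:]) (card {x \<in> A. d x \<in> P}) \<notin> P"
  using assms
proof (induction A)
  case empty
  then show ?case using P_closed(2) by simp
next
  case (insert x A)
  let ?Q = "\<Prod>x\<in>A. [:d x, 1:]" and ?S = "{x \<in> A. d x \<in> P}"
  have IH: "\<And>k. k < card ?S \<Longrightarrow> coeff ?Q k \<in> P" "coeff ?Q (card ?S) \<notin> P" using insert by auto
  have dx: "d x \<in> ints" using insert by simp
  have QR: "coeff ?Q k \<in> ints" for k
    using coeff_prod_linear_ints[of A "\<lambda>x. - d x" k] insert ints_uminus by simp
  have c: "coeff (\<Prod>x\<in>insert x A. [:d x, 1:]) k =
      d x * coeff ?Q k + (case k of 0 \<Rightarrow> 0 | Suc i \<Rightarrow> coeff ?Q i)" for k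
    using insert(1,2) by (simp add: coeff_pCons split: nat.split)
  have not_add: "a + b \<notin> P" if "a \<in> P" "b \<notin> P" for a b
    using P_closed(3)[of "a + b" a] that by auto
  have not_add': "a + b \<notin> P" if "a \<notin> P" "b \<in> P" for a b
    using P_closed(3)[of "a + b" b] that by auto
  show ?case
  proof (cases "d x \<in> P")
    case True
    have "{y \<in> insert x A. d y \<in> P} = insert x ?S" using True by auto
    then have card: "card {y \<in> insert x A. d y \<in> P} = Suc (card ?S)" using insert(1,2) by simp
    have dQ: "d x * coeff ?Q k \<in> P" for k using P_mult_right[OF QR True] .
    show ?thesis
      unfolding card c
    proof (intro conjI allI impI)
      fix k assume "k < Suc (card ?S)"
      then show "d x * coeff ?Q k + (case k of 0 \<Rightarrow> 0 | Suc i \<Rightarrow> coeff ?Q i) \<in> P"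
        using dQ IH(1) P_closed(1) by (intro P_add) (auto split: nat.split)
    next
      show "d x * coeff ?Q (Suc (card ?S)) + (case Suc (card ?S) of 0 \<Rightarrow> 0 | Suc i \<Rightarrow> coeff ?Q i) \<notin> P"
        using not_add[OF dQ IH(2)] by simp
    qed
  next
    case False
    have eq: "{y \<in> insert x A. d y \<in> P} = ?S" using False by auto
    have low: "(case k of 0 \<Rightarrow> 0 | Suc i \<Rightarrow> coeff ?Q i) \<in> P" if "k \<le> card ?S" for k
      using that IH(1) P_closed(1) by (auto split: nat.split)
    have top: "d x * coeff ?Q (card ?S) \<notin> P" using P_closed(5)[OF dx QR] IH(2) False by blast
    show ?thesis
      unfolding eq c
    proof (intro conjI allI impI)
      fix k assume "k < card ?S"
      then show "d x * coeff ?Q k + (case k of 0 \<Rightarrow> 0 | Suc i \<Rightarrow> coeff ?Q i) \<in> P"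
        using IH(1) low[of k] P_closed(4)[OF dx] by (intro P_add) auto
    qed (rule not_add'[OF top low[OF le_refl]])
  qed
qed

section \<open>The polynomial and its arithmetic\<close>

text \<open>Writing n = 2j + 3 keeps the exponents n - 1, n - 2, n - 3 free of subtraction. Odd j
  makes n (n - 1) / 2 even, which removes the sign in \<open>difference_product_square\<close>. The
  cofactors say that 2 and p divide f(0) = c, and q divides f(beta), exactly once. The conditions
  \<open>qn\<close> and \<open>qb\<close> keep f' nonzero modulo q and its zeros 0 and beta distinct
  there.\<close>

locale alt_poly =
  fixes j p :: nat and c c\<^sub>2 c\<^sub>p q c\<^sub>q :: int
  assumes n_sq: "2 * j + 3 = p ^ 2" and p: "Factorial_Ring.prime p" and j: "odd j"
    and c2: "c = 2 * c\<^sub>2" "odd c\<^sub>2" and cp: "c = int p * c\<^sub>p" "\<not> int p dvd c\<^sub>p"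
    and q: "Factorial_Ring.prime q" and cq: "int ((2 * j + 1) * (j + 1)) ^ (2 * j + 2) + c = q * c\<^sub>q" "\<not> q dvd c\<^sub>q"
    and qn: "\<not> q dvd int (2 * j + 3)" and qb: "\<not> q dvd int ((2 * j + 1) * (j + 1))"
begin

abbreviation "n \<equiv> 2 * j + 3"
text \<open>Integrating n x^(2j) (x - beta)^2 forces N = 2 n beta / (n - 1) and M = n beta^2 / (n -
  2). With n - 1 = 2 (j + 1) and n - 2 = 2j + 1, this beta makes both integral.\<close>

definition beta :: nat where "beta = (2 * j + 1) * (j + 1)"
definition N :: int where "N = int (n * (2 * j + 1))"
definition M :: int where "M = int (n * (2 * j + 1) * (j + 1) ^ 2)"

definition f :: "int poly"
  where "f = Polynomial.monom 1 n - Polynomial.monom N (2 * j + 2) + Polynomial.monom M (2 * j + 1) + [:c:]"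

definition F :: "complex poly" where "F = map_poly of_int f"

definition roots :: "complex set" where "roots = {z. poly F z = 0}"

lemma F_eq: "F = Polynomial.monom 1 n - Polynomial.monom (of_int N) (2 * j + 2) + Polynomial.monom (of_int M) (2 * j + 1) + [:of_int c:]"
  by (rule poly_eqI) (simp add: F_def f_def coeff_map_poly coeff_pCons split: nat.split)

lemma poly_F: "poly F z = z ^ n - of_int N * z ^ (2 * j + 2) + of_int M * z ^ (2 * j + 1) + of_int c"
  by (simp add: F_eq poly_monom)

lemma f_monic: "lead_coeff f = 1"
proof -
  have "coeff f n = 1" by (simp add: f_def coeff_pCons split: nat.split)
  moreover have "Polynomial.degree f \<le> n"
    by (rule degree_le) (auto simp: f_def coeff_pCons split: nat.split)
  ultimately show ?thesis by (metis le_antisym le_degree zero_neq_one)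
qed

lemma f_degree: "Polynomial.degree f = n"
proof (rule le_antisym)
  show "Polynomial.degree f \<le> n"
    by (rule degree_le) (auto simp: f_def coeff_pCons split: nat.split)
  have "coeff f n = 1" by (simp add: f_def coeff_pCons split: nat.split)
  then show "n \<le> Polynomial.degree f" by (intro le_degree) simp
qed

lemma F_monic: "Polynomial.degree F = n" "lead_coeff F = 1" "F \<noteq> 0"
proof -
  show deg: "Polynomial.degree F = n" unfolding F_def using f_degree by (simp add: degree_map_poly)
  show "lead_coeff F = 1" using f_monic f_degree unfolding deg by (simp add: F_def coeff_map_poly)
  then show "F \<noteq> 0" by auto
qed

text \<open>The choice of beta gives beta^2 - N beta + M = beta, so that f(beta) is beta^(2j + 2) +
  c, the expression in \<open>cq\<close>.\<close>

lemma poly_F_beta: "poly F (of_nat beta) = of_int (q * c\<^sub>q)"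
proof -
  let ?b = "(2 * of_nat j + 1) * (of_nat j + 1) :: complex"
  have "poly F (of_nat beta) = ?b ^ (2 * j + 1) * (?b ^ 2 - (2 * of_nat j + 3) * (2 * of_nat j + 1) * ?b
      + (2 * of_nat j + 3) * (2 * of_nat j + 1) * (of_nat j + 1) ^ 2) + of_int c"
    by (simp add: poly_F beta_def N_def M_def power_add algebra_simps numeral_eq_Suc)
  also have "?b ^ 2 - (2 * of_nat j + 3) * (2 * of_nat j + 1) * ?b
      + (2 * of_nat j + 3) * (2 * of_nat j + 1) * (of_nat j + 1) ^ 2 = ?b"
    by (simp add: power2_eq_square algebra_simps)
  also have "?b = of_nat beta" by (simp add: beta_def algebra_simps)
  also have "of_nat beta ^ (2 * j + 1) * of_nat beta + of_int c = (of_int (int beta ^ (2 * j + 2) + c) :: complex)"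
    by simp
  also have "\<dots> = of_int (q * c\<^sub>q)" unfolding cq(1)[folded beta_def] ..
  finally show ?thesis .
qed

lemma pderiv_F: "pderiv F = [:of_nat n:] * [:0, 1:] ^ (2 * j) * [:- of_nat beta, 1:] ^ 2"
proof -
  have "poly (pderiv F) z = poly ([:of_nat n:] * [:0, 1:] ^ (2 * j) * [:- of_nat beta, 1:] ^ 2) z" for z
  proof -
    have "poly (pderiv F) z = of_nat n * z ^ (2 * j + 2) - of_nat (2 * j + 2) * of_int N * z ^ (2 * j + 1)
        + of_nat (2 * j + 1) * of_int M * z ^ (2 * j)"
      by (simp add: F_eq pderiv_add pderiv_diff pderiv_monom poly_monom pderiv_pCons)
    also have "\<dots> = of_nat n * z ^ (2 * j) * (z - of_nat beta) ^ 2"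
      by (simp add: beta_def N_def M_def power_add power2_eq_square algebra_simps)
    finally show ?thesis by simp
  qed
  then have "poly (pderiv F) = poly ([:of_nat n:] * [:0, 1:] ^ (2 * j) * [:- of_nat beta, 1:] ^ 2)" by (rule ext)
  then show ?thesis by (simp only: poly_eq_poly_eq_iff)
qed

lemma poly_pderiv_F: "poly (pderiv F) z = of_nat n * z ^ (2 * j) * (z - of_nat beta) ^ 2"
  by (simp add: pderiv_F)

lemma nonzero_consts: "c \<noteq> 0" "q * c\<^sub>q \<noteq> 0"
  using c2 cq(2) q by auto

text \<open>A multiple root would be a zero of f', hence 0 or beta, where f takes the nonzero values
  c and q times \<open>c\<^sub>q\<close>.\<close>

lemma F_rsquarefree: "rsquarefree F"
  unfolding rsquarefree_roots
proof (intro allI notI)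
  fix z assume z: "poly F z = 0 \<and> poly (pderiv F) z = 0"
  then have "of_nat n * z ^ (2 * j) * (z - of_nat beta) ^ 2 = 0" by (simp only: poly_pderiv_F)
  moreover have "of_nat n \<noteq> (0 :: complex)" by (simp only: of_nat_eq_0_iff)
  ultimately have "z = 0 \<or> z = of_nat beta" by auto
  then show False
  proof
    assume "z = 0"
    then have "poly F z = of_int c" by (simp add: poly_F)
    then show False using z nonzero_consts(1) by simp
  next
    assume "z = of_nat beta"
    then have "of_int (q * c\<^sub>q) = (0 :: complex)" using z poly_F_beta by simp
    then show False using nonzero_consts(2) by (simp only: of_int_eq_0_iff)
  qed
qed

lemma finite_roots: "finite roots"
  unfolding roots_def by (rule poly_roots_finite[OF F_monic(3)])

lemma F_prod: "F = (\<Prod>z\<in>roots. [:- z, 1:])"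
  using complex_poly_decompose_rsquarefree[OF F_rsquarefree] F_monic(2) by (simp add: roots_def)

lemma card_roots: "card roots = n"
proof -
  have "Polynomial.degree (\<Prod>z\<in>roots. [:- z, 1:]) = card roots"
    by (subst degree_prod_eq_sum_degree) auto
  then show ?thesis using F_monic(1) F_prod by simp
qed

lemma F_val: "poly F a = (\<Prod>z\<in>roots. a - z)"
  by (subst F_prod) (simp add: poly_prod)

lemma pderiv_val: "x \<in> roots \<Longrightarrow> poly (pderiv F) x = (\<Prod>y\<in>roots - {x}. x - y)"
proof -
  assume x: "x \<in> roots"
  let ?H = "\<Prod>y\<in>roots - {x}. [:- y, 1:]"
  have "F = [:- x, 1:] * ?H" by (subst F_prod) (rule prod.remove[OF finite_roots x])
  then have "poly (pderiv F) x = poly (pderiv ([:- x, 1:] * ?H)) x" by simp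
  also have "\<dots> = poly ?H x" by (simp only: pderiv_mult poly_add poly_mult) (simp add: pderiv_pCons)
  also have "\<dots> = (\<Prod>y\<in>roots - {x}. x - y)" by (simp add: poly_prod)
  finally show ?thesis .
qed

lemma roots_algebraic_int: "z \<in> roots \<Longrightarrow> algebraic_int z"
  unfolding algebraic_int_altdef_ipoly roots_def using f_monic by (auto simp: F_def)

lemma roots_rpoly: "roots = {z. rpoly (map_poly of_int f) z = 0}"
  by (simp add: roots_def F_def rpoly_def map_poly_map_poly comp_def)

text \<open>An Eisenstein argument: N and M are divisible by n = p^2, so p divides the power k^n of
  an integer root k and thus k itself; then p^2 divides every other term, hence c.\<close>

lemma no_int_root: "of_int k \<notin> roots"
proof
  assume "of_int k \<in> roots"
  then have "(of_int (k ^ n - N * k ^ (2 * j + 2) + M * k ^ (2 * j + 1) + c) :: complex) = 0"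
    by (simp add: roots_def poly_F)
  then have eq: "k ^ n - N * k ^ (2 * j + 2) + M * k ^ (2 * j + 1) + c = 0" by (simp only: of_int_eq_0_iff)
  have "N = int p ^ 2 * int (2 * j + 1)" "M = int p ^ 2 * int ((2 * j + 1) * (j + 1) ^ 2)"
    unfolding N_def M_def n_sq by (simp_all add: algebra_simps)
  then have NM: "int p ^ 2 dvd N" "int p ^ 2 dvd M" by simp_all
  have c_eq: "c = N * k ^ (2 * j + 2) - M * k ^ (2 * j + 1) - k ^ n" using eq by simp
  have pp: "Factorial_Ring.prime (int p)" using p by simp
  have "int p dvd int p ^ 2" by (simp add: power2_eq_square)
  then have "int p dvd N" "int p dvd M" using NM dvd_trans by blast+
  then have "int p dvd N * k ^ (2 * j + 2) - M * k ^ (2 * j + 1) - c"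
    using cp(1) by (intro dvd_diff dvd_mult2) simp_all
  also have "N * k ^ (2 * j + 2) - M * k ^ (2 * j + 1) - c = k ^ n" using c_eq by simp
  finally have "int p dvd k" using prime_dvd_power pp by blast
  then have "int p ^ 2 dvd k ^ 2" by (rule dvd_power_same)
  also have "k ^ 2 dvd k ^ n" by (rule le_imp_power_dvd) simp
  finally have "int p ^ 2 dvd c" unfolding c_eq using NM by (intro dvd_diff dvd_mult2)
  then have "int p * int p dvd int p * c\<^sub>p" using cp(1) by (simp add: power2_eq_square)
  then show False using cp(2) pp by (auto simp: dvd_mult_cancel_left)
qed

end

section \<open>The Galois group as a permutation group on the roots\<close>

locale alt_poly_galois = alt_poly + finite_galois_over_rat +
  assumes roots_L: "roots \<subseteq> L"
    and roots_triv: "\<And>g. g \<in> carrier G \<Longrightarrow> (\<And>z. z \<in> roots \<Longrightarrow> g z = z) \<Longrightarrow> g = \<one>\<^bsub>G\<^esub>"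
begin

lemma roots_ints: "roots \<subseteq> ints"
  using roots_L roots_algebraic_int by (auto simp: ints_def)

lemma G_roots: "g \<in> carrier G \<Longrightarrow> x \<in> roots \<Longrightarrow> g x \<in> roots"
  using G_rpoly[of g x "map_poly of_int f"] roots_L G_D(5)[of g 0] by (auto simp: roots_rpoly)

lemma G_bij_roots: "g \<in> carrier G \<Longrightarrow> bij_betw g roots roots"
proof -
  assume g: "g \<in> carrier G"
  have "inj_on g roots" using G_D(7)[OF g] roots_L by (auto simp: inj_on_def)
  moreover have "g ` roots \<subseteq> roots" using G_roots[OF g] by blast
  ultimately show ?thesis using endo_inj_surj[OF finite_roots] by (simp add: bij_betw_def)
qed

definition e :: "nat \<Rightarrow> complex"
  where "e = (SOME e. bij_betw e {1..n} roots)"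

lemma e_bij: "bij_betw e {1..n} roots"
proof -
  have "\<exists>e. bij_betw e {1..n} roots"
    using ex_bij_betw_nat_finite_1[OF finite_roots] by (simp add: card_roots)
  then show ?thesis unfolding e_def by (rule someI_ex)
qed

lemma e_roots: "i \<in> {1..n} \<Longrightarrow> e i \<in> roots"
  using e_bij by (auto simp: bij_betw_def)

lemma e_inj: "i \<in> {1..n} \<Longrightarrow> k \<in> {1..n} \<Longrightarrow> e i = e k \<longleftrightarrow> i = k"
  using e_bij by (auto simp: bij_betw_def inj_on_def)

lemma e_surj: "x \<in> roots \<Longrightarrow> \<exists>i\<in>{1..n}. x = e i"
  using e_bij by (auto simp: bij_betw_def)

definition perm :: "(complex \<Rightarrow> complex) \<Rightarrow> nat \<Rightarrow> nat"
  where "perm g i = (if i \<in> {1..n} then inv_into {1..n} e (g (e i)) else i)"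

lemma e_perm: "g \<in> carrier G \<Longrightarrow> i \<in> {1..n} \<Longrightarrow> e (perm g i) = g (e i)"
  unfolding perm_def using G_roots[OF _ e_roots] e_bij
  by (simp add: bij_betw_inv_into_right)

lemma perm_in: "g \<in> carrier G \<Longrightarrow> i \<in> {1..n} \<Longrightarrow> perm g i \<in> {1..n}"
  unfolding perm_def using G_roots[OF _ e_roots] e_bij inv_into_into[of _ e "{1..n}"]
  by (simp add: bij_betw_def)

lemma perm_eqI:
  assumes "g \<in> carrier G" "i \<in> {1..n}" "k \<in> {1..n}" "g (e i) = e k"
  shows "perm g i = k"
  using e_perm[OF assms(1,2)] assms(4) e_inj[OF perm_in[OF assms(1,2)] assms(3)] by simp

lemma perm_out: "i \<notin> {1..n} \<Longrightarrow> perm g i = i"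
  unfolding perm_def by (rule if_not_P)

lemma perm_mult:
  assumes g: "g \<in> carrier G" and h: "h \<in> carrier G"
  shows "perm (g \<otimes>\<^bsub>G\<^esub> h) = perm g \<circ> perm h"
proof
  fix i show "perm (g \<otimes>\<^bsub>G\<^esub> h) i = (perm g \<circ> perm h) i"
  proof (cases "i \<in> {1..n}")
    case True
    have "e (perm (g \<otimes>\<^bsub>G\<^esub> h) i) = e (perm g (perm h i))"
      using e_perm[OF g perm_in[OF h True]] e_perm[OF h True] e_perm[OF m_closed[OF g h] True]
        G_mult[OF g h] e_roots[OF True] roots_L by auto
    then show ?thesis
      using e_inj[OF perm_in[OF m_closed[OF g h] True] perm_in[OF g perm_in[OF h True]]] by simp
  next
    case False show ?thesis by (simp only: perm_out[OF False] comp_apply)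
  qed
qed

lemma perm_one: "perm \<one>\<^bsub>G\<^esub> = id"
proof
  fix i show "perm \<one>\<^bsub>G\<^esub> i = id i"
  proof (cases "i \<in> {1..n}")
    case True
    then show ?thesis using perm_eqI[OF one_closed True True] G_one e_roots[OF True] roots_L by auto
  next
    case False show ?thesis by (simp only: perm_out[OF False] id_apply)
  qed
qed

lemma perm_permutes: "g \<in> carrier G \<Longrightarrow> perm g permutes {1..n}"
proof (rule permutesI_inverse)
  assume g: "g \<in> carrier G"
  show "perm g \<circ> perm (inv\<^bsub>G\<^esub> g) = id" "perm (inv\<^bsub>G\<^esub> g) \<circ> perm g = id"
    using g by (simp_all only: perm_mult[symmetric] inv_closed r_inv l_inv perm_one)
qed (rule perm_out)

text \<open>Since \<open>f' = p\<^sup>2 x\<^sup>2\<^sup>j (x - \<beta>)\<^sup>2\<close> is a square, so is the discriminant of \<open>f\<close>.\<close>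

lemma perm_even: "g \<in> carrier G \<Longrightarrow> evenperm (perm g)"
proof (rule ccontr)
  assume g: "g \<in> carrier G" and odd: "\<not> evenperm (perm g)"
  let ?D = "difference_product n e"
  \<comment> \<open>A square root of the product of the values f'(x) over the roots; automorphisms
    only permute its factors.\<close>
  define \<eta> where "\<eta> = (\<Prod>x\<in>roots. of_nat p * x ^ j * (x - of_nat beta))"
  have eL: "e i \<in> L" if "i \<in> {1..n}" for i using e_roots[OF that] roots_L by blast
  have pairs: "fst ij \<in> {1..n}" "snd ij \<in> {1..n}" if "ij \<in> index_pairs n" for ij
    using that by (auto simp: index_pairs_def)
  have "(\<Prod>i\<in>{1..n}. \<Prod>k\<in>{1..n} - {i}. e i - e k) = (\<Prod>i\<in>{1..n}. poly (pderiv F) (e i))"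
  proof (rule prod.cong[OF refl])
    fix i assume i: "i \<in> {1..n}"
    have "bij_betw e ({1..n} - {i}) (roots - {e i})"
      using e_bij i by (auto simp: bij_betw_def inj_on_def)
    then have "(\<Prod>k\<in>{1..n} - {i}. e i - e k) = (\<Prod>y\<in>roots - {e i}. e i - y)"
      by (rule prod.reindex_bij_betw)
    then show "(\<Prod>k\<in>{1..n} - {i}. e i - e k) = poly (pderiv F) (e i)"
      using pderiv_val[OF e_roots[OF i]] by simp
  qed
  also have "\<dots> = (\<Prod>x\<in>roots. poly (pderiv F) x)" by (rule prod.reindex_bij_betw[OF e_bij])
  also have "\<dots> = (\<Prod>x\<in>roots. (of_nat p * x ^ j * (x - of_nat beta)) ^ 2)"
  proof (rule prod.cong[OF refl])
    fix x
    have "of_nat n = (of_nat p ^ 2 :: complex)" using n_sq by (metis of_nat_power)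
    then show "poly (pderiv F) x = (of_nat p * x ^ j * (x - of_nat beta)) ^ 2"
      unfolding poly_pderiv_F by (simp add: power_mult_distrib power_mult[symmetric] mult.commute)
  qed
  also have "\<dots> = \<eta> ^ 2" by (simp add: \<eta>_def prod_power_distrib)
  finally have "(- 1) ^ card (index_pairs n) * ?D ^ 2 = \<eta> ^ 2"
    unfolding difference_product_square .
  moreover have "even (card (index_pairs n))"
  proof -
    have "2 * card (index_pairs n) = 2 * ((2 * j + 3) * (j + 1))"
      using card_index_pairs[of n] by (simp add: algebra_simps)
    then have "card (index_pairs n) = (2 * j + 3) * (j + 1)" by simp
    then show ?thesis using j by simp
  qed
  ultimately have sq: "?D ^ 2 = \<eta> ^ 2" by simp
  have gp: "g (of_nat k) = of_nat k" for k using G_D(5)[OF g, of "of_nat k"] by simp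
  have nat_L: "of_nat k \<in> L" for k by (rule complex_subfield_of_nat[OF L])
  have xL: "x \<in> L" if "x \<in> roots" for x using that roots_L by blast
  have "g \<eta> = (\<Prod>x\<in>roots. g (of_nat p * x ^ j * (x - of_nat beta)))"
    unfolding \<eta>_def using xL nat_L LD complex_subfield_power[OF L] by (intro G_prod[OF g]) simp
  also have "\<dots> = (\<Prod>x\<in>roots. of_nat p * g x ^ j * (g x - of_nat beta))"
  proof (rule prod.cong[OF refl])
    fix x assume x: "x \<in> roots"
    have m: "of_nat p * x ^ j \<in> L" "x ^ j \<in> L" "x - of_nat beta \<in> L"
      using xL[OF x] nat_L LD complex_subfield_power[OF L] by simp_all
    show "g (of_nat p * x ^ j * (x - of_nat beta)) = of_nat p * g x ^ j * (g x - of_nat beta)"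
      using G_D(4)[OF g m(1,3)] G_D(4)[OF g nat_L m(2), of p] G_power[OF g xL[OF x], of j]
        G_diff[OF g xL[OF x] nat_L, of beta] gp by simp
  qed
  also have "\<dots> = \<eta>" unfolding \<eta>_def by (rule prod.reindex_bij_betw[OF G_bij_roots[OF g]])
  finally have g\<eta>: "g \<eta> = \<eta>" .
  have \<eta>L: "\<eta> \<in> L" unfolding \<eta>_def
    using xL nat_L LD complex_subfield_power[OF L] by (intro complex_subfield_prod[OF L]) simp
  have DL: "?D \<in> L"
    unfolding difference_product_def using eL pairs LD(4)
    by (intro complex_subfield_prod[OF L]) (auto simp: case_prod_unfold)
  \<comment> \<open>So g fixes the difference product, whereas an odd permutation negates
    it.\<close>
  have "?D = \<eta> \<or> ?D = - \<eta>" using sq by (simp add: power2_eq_iff)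
  then have gD: "g ?D = ?D" using g\<eta> G_uminus[OF g \<eta>L] by auto
  have "g ?D = (\<Prod>ij\<in>index_pairs n. g (e (snd ij) - e (fst ij)))"
    unfolding difference_product_def case_prod_unfold using eL pairs LD(4) by (intro G_prod[OF g]) blast
  also have "\<dots> = difference_product n (e \<circ> perm g)"
    unfolding difference_product_def case_prod_unfold
    using G_diff[OF g eL eL] pairs e_perm[OF g] by (intro prod.cong) simp_all
  also have "\<dots> = - ?D"
    using difference_product_comp[OF perm_permutes[OF g]] inversion_sign_eq_sign[OF perm_permutes[OF g]] odd
    by (simp add: sign_def)
  finally have "?D = 0" using gD by simp
  moreover have "inj_on e {1..n}" using e_bij by (simp add: bij_betw_def)
  ultimately show False using difference_product_nonzero by blast
qed

lemma perm_hom: "perm \<in> hom G (alt_group n)"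
proof (rule homI)
  fix g assume "g \<in> carrier G"
  then show "perm g \<in> carrier (alt_group n)" unfolding alt_group_carrier using perm_permutes perm_even by blast
next
  fix g h assume "g \<in> carrier G" "h \<in> carrier G"
  then show "perm (g \<otimes>\<^bsub>G\<^esub> h) = perm g \<otimes>\<^bsub>alt_group n\<^esub> perm h" unfolding alt_group_mult by (rule perm_mult)
qed

lemma perm_inj: "inj_on perm (carrier G)"
proof -
  interpret h: group_hom G "alt_group n" perm
    by (intro group_hom.intro group_hom_axioms.intro is_group alt_group_is_group perm_hom)
  have "g = \<one>\<^bsub>G\<^esub>" if g: "g \<in> carrier G" and one: "perm g = id" for g
  proof (rule roots_triv[OF g])
    fix z assume "z \<in> roots"
    then obtain i where i: "i \<in> {1..n}" "z = e i" using e_surj by blast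
    then show "g z = z" using e_perm[OF g i(1)] one by simp
  qed
  then have "kernel G (alt_group n) perm = {\<one>\<^bsub>G\<^esub>}"
    using perm_one by (auto simp: kernel_def alt_group_one)
  then show ?thesis by (rule h.trivial_ker_imp_inj)
qed

text \<open>f'(x) is the product of the differences between x and the other roots, so none of these
  lies in Q, and an inertia element can move x only to a congruent root.\<close>

lemma isolated_root_fixed:
  assumes "prime_over_rat L Q r" and x: "x \<in> roots" "poly (pderiv F) x \<notin> Q"
  shows "y \<in> roots \<Longrightarrow> x - y \<in> Q \<Longrightarrow> y = x" "g \<in> prime_over_rat.inertia L Q \<Longrightarrow> g x = x"
proof -
  interpret Q: prime_over_rat L Q r by (rule assms)
  have iso: "y = x" if y: "y \<in> roots" "x - y \<in> Q" for y
  proof (rule ccontr)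
    assume "y \<noteq> x"
    then have "(\<Prod>y\<in>roots - {x}. x - y) \<in> Q"
      using y x(1) finite_roots roots_ints ints_closed(2) by (intro Q.P_prod[of _ y]) auto
    then show False using x pderiv_val by simp
  qed
  then show "y \<in> roots \<Longrightarrow> x - y \<in> Q \<Longrightarrow> y = x" by blast
  assume g: "g \<in> Q.inertia"
  have "g x - x \<in> Q" using Q.inertiaD(2)[OF g] x(1) roots_ints by blast
  then have "x - g x \<in> Q" using Q.P_uminus by fastforce
  then show "g x = x" using iso G_roots[OF Q.inertiaD(1)[OF g] x(1)] by blast
qed

lemma ex_three_cycle:
  "\<exists>u v w. distinct [u, v, w] \<and> {u, v, w} \<subseteq> {1..n} \<and> (\<exists>g\<in>carrier G. perm g = cycle_of_list [u, v, w])"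
proof -
  obtain Q where Q: "prime_over_rat L Q q" using ex_prime_over[OF q] by blast
  interpret Q: prime_over_rat L Q q by (rule Q)
  define S where "S = {x \<in> roots. of_nat beta - x \<in> Q}"
  have bR: "of_nat beta \<in> ints" using ints_closed(4)[of "int beta"] by simp
  have qc: "\<not> q dvd c"
  proof
    assume "q dvd c"
    then have "q dvd int ((2 * j + 1) * (j + 1)) ^ (2 * j + 2)"
      using cq(1) by (metis dvd_add_left_iff dvd_triv_left)
    then show False using qb q prime_dvd_power by blast
  qed
  \<comment> \<open>The product of the negated roots is f(0) = c, which q does not divide.\<close>
  have x_Q: "x \<notin> Q" if x: "x \<in> roots" for x
  proof
    assume "x \<in> Q"
    then have "0 - x \<in> Q" using Q.P_uminus by simp
    then have "(\<Prod>x\<in>roots. 0 - x) \<in> Q"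
      using x finite_roots roots_ints ints_uminus by (intro Q.P_prod[of _ x]) auto
    then have "of_int c \<in> Q" unfolding F_val[symmetric] by (simp add: poly_F power_0_left)
    then show False using qc Q.of_int_in_P_iff by blast
  qed
  have n_Q: "of_nat n \<notin> Q" using Q.of_int_in_P_iff[of "int n"] qn by simp
  have nR: "of_nat n \<in> ints" using ints_closed(4)[of "int n"] by simp
  have fixed: "g x = x" if g: "g \<in> Q.inertia" and x: "x \<in> roots" "x \<notin> S" for g x
  proof (rule isolated_root_fixed(2)[OF Q x(1) _ g])
    have xR: "x \<in> ints" using x roots_ints by blast
    have "x - of_nat beta \<notin> Q" using x Q.P_uminus[of "x - of_nat beta"] by (auto simp: S_def)
    moreover have "x - of_nat beta \<in> ints" using ints_closed(2)[OF xR bR] .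
    ultimately have "(x - of_nat beta) ^ 2 \<notin> Q" using Q.P_power by blast
    moreover have "x ^ (2 * j) \<notin> Q" using Q.P_power[OF xR] x_Q[OF x(1)] by blast
    ultimately show "poly (pderiv F) x \<notin> Q"
      unfolding poly_pderiv_F
      using Q.P_closed(5) n_Q nR xR \<open>x - of_nat beta \<in> ints\<close> ints_power ints_closed(3) by metis
  qed
  have val: "(\<Prod>x\<in>roots. of_int (int beta) - x) = of_int (q * c\<^sub>q)"
    using poly_F_beta by (simp add: F_val)
  have trans: "\<exists>g\<in>Q.inertia. g x = y" if "x \<in> S" "y \<in> S" for x y
    using Q.inertia_transitive[OF finite_roots roots_ints _ val cq(2), of x y] that G_roots
    by (auto simp: S_def)
  \<comment> \<open>The roots near beta are counted after the shift H(X) = f(X + beta), whose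
    derivative is divisible by X^2. So the coefficients at 1 and 2 vanish, the constant one is
    f(beta) and lies in Q, and three times the coefficient at 3 is n beta^(2j), which is prime to
    q.\<close>
  have "card S = 3"
  proof -
    define H where "H = pcompose F [:of_nat beta, 1:]"
    define C :: "complex poly" where "C = [:of_nat n:] * [:of_nat beta, 1:] ^ (2 * j)"
    have H_prod: "H = (\<Prod>x\<in>roots. [:of_nat beta - x, 1:])"
      unfolding H_def by (subst F_prod) (simp add: pcompose_prod pcompose_pCons)
    have d: "of_nat beta - x \<in> ints" if "x \<in> roots" for x using that roots_ints bR ints_closed(2) by blast
    note coeffs = Q.coeff_prod_linear_mod[of roots "\<lambda>x. of_nat beta - x", OF finite_roots d, folded H_prod, folded S_def]
    have "poly (pderiv H) z = poly (C * [:0, 1:] ^ 2) z" for z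
      by (simp add: H_def C_def pderiv_pcompose poly_pcompose poly_pderiv_F pderiv_pCons)
    then have "poly (pderiv H) = poly (C * [:0, 1:] ^ 2)" by (rule ext)
    then have "pderiv H = C * [:0, 1:] ^ 2" by (simp only: poly_eq_poly_eq_iff)
    also have "\<dots> = pCons 0 (pCons 0 C)" by (simp add: power2_eq_square)
    finally have dH: "pderiv H = pCons 0 (pCons 0 C)" .
    have "coeff C 0 = poly C 0" by (rule poly_0_coeff_0[symmetric])
    also have "\<dots> = of_nat n * of_nat beta ^ (2 * j)" by (simp add: C_def)
    finally have C0: "coeff C 0 = of_int (int n * int beta ^ (2 * j))" by simp
    have H1: "coeff H 1 = 0" and H2: "coeff H 2 = 0" and H3: "of_int 3 * coeff H 3 = coeff C 0"
      using coeff_pderiv[of H 0] coeff_pderiv[of H 1] coeff_pderiv[of H 2]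
      by (simp_all add: dH numeral_2_eq_2 numeral_3_eq_3)
    have "coeff H 0 = poly H 0" by (rule poly_0_coeff_0[symmetric])
    also have "\<dots> = of_int (q * c\<^sub>q)" using poly_F_beta by (simp add: H_def poly_pcompose)
    finally have H0: "coeff H 0 \<in> Q" using Q.of_int_in_P_iff[of "q * c\<^sub>q"] by simp
    have H3_Q: "coeff H 3 \<notin> Q"
    proof
      assume "coeff H 3 \<in> Q"
      then have "of_int 3 * coeff H 3 \<in> Q" by (rule Q.P_closed(4)[OF ints_closed(4)])
      then have "q dvd int n * int beta ^ (2 * j)" unfolding H3 C0 Q.of_int_in_P_iff .
      then have "q dvd int n \<or> q dvd int beta ^ (2 * j)" using q prime_dvd_multD by blast
      then show False using qn qb q prime_dvd_power unfolding beta_def by blast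
    qed
    have low: "\<And>k. k < card S \<Longrightarrow> coeff H k \<in> Q" and top: "coeff H (card S) \<notin> Q" using coeffs by auto
    have ne: "card S \<noteq> k" if "coeff H k \<in> Q" for k using top that by blast
    have "card S \<noteq> 1" using H1 Q.P_closed(1) by (intro ne) simp
    moreover have "card S \<noteq> 2" using H2 Q.P_closed(1) by (intro ne) simp
    moreover have "\<not> 3 < card S" using low[of 3] H3_Q by blast
    ultimately show ?thesis using ne[OF H0] by linarith
  qed
  then obtain x y z where S: "S = {x, y, z}" "distinct [x, y, z]" unfolding card_3_iff by auto
  have roots: "x \<in> roots" "y \<in> roots" "z \<in> roots" using S(1) by (auto simp: S_def)
  obtain g where g: "g \<in> Q.inertia" "g x = y" using trans[of x y] S(1) by blast
  have gG: "g \<in> carrier G" using Q.inertiaD(1)[OF g(1)] .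
  obtain u v w where uvw: "u \<in> {1..n}" "x = e u" "v \<in> {1..n}" "y = e v" "w \<in> {1..n}" "z = e w"
    using e_surj roots by metis
  have duvw: "distinct [u, v, w]" using S(2) uvw by auto
  have inj: "g a = g b \<longleftrightarrow> a = b" if "a \<in> roots" "b \<in> roots" for a b
    using G_D(7)[OF gG] that roots_L by blast
  have gS: "g a \<in> S" if a: "a \<in> S" for a
  proof (rule ccontr)
    assume neg: "g a \<notin> S"
    have ar: "a \<in> roots" using a by (simp add: S_def)
    have "g (g a) = g a" using fixed[OF g(1) G_roots[OF gG ar] neg] .
    then show False using inj[OF G_roots[OF gG ar] ar] neg a by simp
  qed
  have others: "perm g i = i" if i: "i \<notin> {u, v, w}" for i
  proof (cases "i \<in> {1..n}")
    case True
    then have "e i \<notin> S" using i uvw e_inj unfolding S(1) by auto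
    then show ?thesis using perm_eqI[OF gG True True] fixed[OF g(1) e_roots[OF True]] by blast
  qed (rule perm_out)
  have pu: "perm g u = v" using perm_eqI[OF gG uvw(1,3)] g(2) uvw by simp
  have gy: "g y \<in> {x, z}" using gS[of y] inj[of x y] g(2) roots S by auto
  \<comment> \<open>Inertia preserves S and fixes all other roots. If g exchanged x and y it would
    act as a transposition, which is odd.\<close>
  have "g y = z"
  proof (rule ccontr)
    assume "g y \<noteq> z"
    then have gyx: "g y = x" using gy by simp
    have gz: "g z = z" using gS[of z] inj[of z x] inj[of z y] g(2) gyx roots S by auto
    have "perm g v = u" "perm g w = w"
      using perm_eqI[OF gG uvw(3,1)] perm_eqI[OF gG uvw(5,5)] gyx gz uvw by simp_all
    then have "perm g = transpose u v"
      using pu others duvw by (auto simp: fun_eq_iff transpose_def)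
    then show False using perm_even[OF gG] duvw by (simp add: evenperm_swap)
  qed
  then have gz: "g z = x" using gS[of z] inj[of z x] inj[of z y] g(2) roots S by auto
  have "perm g v = w" "perm g w = u"
    using perm_eqI[OF gG uvw(3,5)] perm_eqI[OF gG uvw(5,1)] \<open>g y = z\<close> gz uvw by simp_all
  then have "perm g = cycle_of_list [u, v, w]"
    using pu others duvw by (auto simp: fun_eq_iff transpose_def)
  then show ?thesis using duvw uvw gG by (intro exI[of _ u] exI[of _ v] exI[of _ w]) auto
qed

text \<open>Modulo 2 the polynomial is \<open>x\<^sup>n\<^sup>-\<^sup>1 (x - 1)\<close>, so the inertia group at 2 fixes one root and is
  transitive on the others.\<close>

lemma ex_point_stabilizer_transitive:
  "\<exists>w\<in>roots. \<forall>x\<in>roots - {w}. \<forall>y\<in>roots - {w}. \<exists>g\<in>carrier G. g x = y \<and> g w = w"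
proof -
  have two: "Factorial_Ring.prime (2 :: int)" by simp
  obtain Q where Q: "prime_over_rat L Q 2" using ex_prime_over[OF two] by blast
  interpret Q: prime_over_rat L Q 2 by (rule Q)
  have odd_n: "odd (int n)" by simp
  have oddN: "odd N" and evenM: "even M" and even_beta: "even beta"
    using j by (simp_all add: N_def M_def beta_def)
  have xR: "x \<in> ints" if "x \<in> roots" for x using that roots_ints by blast
  \<comment> \<open>beta is even because j + 1 is, and n is odd; so modulo a prime above 2 the only
    zero of f' is 0.\<close>
  have simple: "poly (pderiv F) x \<notin> Q" if x: "x \<in> roots" "x \<notin> Q" for x
  proof -
    have "of_int (int beta) \<in> Q" using Q.of_int_in_P_iff[of "int beta"] even_beta by simp
    then have bQ: "of_nat beta \<in> Q" by simp
    have "x - of_nat beta \<notin> Q" using Q.P_add[of "x - of_nat beta" "of_nat beta"] bQ x(2) by auto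
    moreover have xb: "x - of_nat beta \<in> ints" using ints_closed(2)[OF xR[OF x(1)] Q.P_sub[OF bQ]] .
    ultimately have "(x - of_nat beta) ^ 2 \<notin> Q" using Q.P_power by blast
    moreover have "x ^ (2 * j) \<notin> Q" using Q.P_power[OF xR[OF x(1)]] x(2) by blast
    moreover have "of_nat n \<notin> Q" using Q.of_int_in_P_iff[of "int n"] odd_n by simp
    moreover have "of_nat n \<in> ints" using ints_closed(4)[of "int n"] by simp
    ultimately show ?thesis
      unfolding poly_pderiv_F
      using Q.P_closed(5) xR[OF x(1)] xb ints_power ints_closed(3) by metis
  qed
  have one_mod: "x - 1 \<in> Q" if x: "x \<in> roots" "x \<notin> Q" for x
  proof -
    have multiple: "of_int k * x ^ i \<in> Q" if "even k" for k i
      using Q.P_mult_right[OF ints_power[OF xR[OF x(1)]], of "of_int k"] Q.of_int_in_P_iff[of k] that by simp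
    have "even c" using c2(1) by simp
    then have cQ: "of_int c \<in> Q" using Q.of_int_in_P_iff[of c] by simp
    have "x ^ (2 * j + 2) * (x - 1) =
        of_int (N - 1) * x ^ (2 * j + 2) - of_int M * x ^ (2 * j + 1) - of_int c"
      using x(1) by (simp add: roots_def poly_F algebra_simps power_add numeral_eq_Suc)
    also have "\<dots> \<in> Q" using oddN evenM cQ by (intro Q.P_closed(3) multiple) simp_all
    finally have "x ^ (2 * j + 2) \<in> Q \<or> x - 1 \<in> Q"
      using Q.P_closed(5) ints_power[OF xR[OF x(1)]] ints_closed(2)[OF xR[OF x(1)] ints_01(2)] by blast
    then show ?thesis using Q.P_power[OF xR[OF x(1)]] x(2) by blast
  qed
  \<comment> \<open>f(1) is even, so some root w is congruent to 1. It is not in Q, hence simple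
    modulo Q, and no other root is congruent to it.\<close>
  have "(\<Prod>x\<in>roots. 1 - x) = of_int (1 - N + M + c)"
    unfolding F_val[symmetric] by (simp add: poly_F)
  then have "(\<Prod>x\<in>roots. 1 - x) \<in> Q"
    using Q.of_int_in_P_iff[of "1 - N + M + c"] oddN evenM c2(1) by simp
  then obtain w where w: "w \<in> roots" "1 - w \<in> Q"
    using Q.P_prod_iff[OF finite_roots, of "\<lambda>x. 1 - x"] xR ints_closed(2)[OF ints_01(2)] by blast
  have wQ: "w \<notin> Q" using Q.P_add[of "1 - w" w] w(2) Q.P_closed(2) by auto
  have inQ: "x \<in> Q" if x: "x \<in> roots - {w}" for x
  proof (rule ccontr)
    assume "x \<notin> Q"
    then have "x - 1 \<in> Q" using one_mod x by blast
    then have "w - x \<in> Q" using Q.P_uminus[OF Q.P_add[of "x - 1" "1 - w"]] w(2) by simp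
    then show False using isolated_root_fixed(1)[OF Q w(1) simple[OF w(1) wQ], of x] x by blast
  qed
  have val: "(\<Prod>x\<in>roots. of_int 0 - x) = of_int (2 * c\<^sub>2)"
  proof -
    have "(\<Prod>x\<in>roots. of_int 0 - x) = poly F 0" unfolding F_val by simp
    also have "\<dots> = of_int c" by (simp add: poly_F)
    finally show ?thesis using c2(1) by simp
  qed
  have "\<exists>g\<in>carrier G. g x = y \<and> g w = w" if xy: "x \<in> roots - {w}" "y \<in> roots - {w}" for x y
  proof -
    have "of_int 0 - x \<in> Q" "of_int 0 - y \<in> Q" using inQ xy Q.P_uminus by simp_all
    then obtain g where g: "g \<in> Q.inertia" "g x = y"
      using Q.inertia_transitive[OF finite_roots roots_ints _ val, of x y] c2(2) xy G_roots by auto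
    then show ?thesis
      using isolated_root_fixed(2)[OF Q w(1) simple[OF w(1) wQ] g(1)] Q.inertiaD(1)[OF g(1)] by blast
  qed
  then show ?thesis using w(1) by blast
qed

text \<open>A group fixing w would make w a rational integer, so w is moved; with the point
  stabilizer transitive on the other roots, the group is transitive. Two pairs are then compared by
  carrying their first members to w.\<close>

lemma two_transitive:
  assumes xy: "x \<in> roots" "y \<in> roots" "x \<noteq> y" and xy': "x' \<in> roots" "y' \<in> roots" "x' \<noteq> y'"
  shows "\<exists>g\<in>carrier G. g x = x' \<and> g y = y'"
proof -
  obtain w where w: "w \<in> roots"
    and st: "\<And>x y. x \<in> roots - {w} \<Longrightarrow> y \<in> roots - {w} \<Longrightarrow> \<exists>g\<in>carrier G. g x = y \<and> g w = w"
    using ex_point_stabilizer_transitive by blast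
  have wL: "w \<in> L" using w roots_L by blast
  have "\<exists>g\<in>carrier G. g w \<noteq> w"
  proof (rule ccontr)
    assume "\<not> ?thesis"
    then have "w \<in> \<rat>" using fixed_rat[OF wL] by blast
    then obtain k where "w = of_int k" using ints_rat w roots_ints by blast
    then show False using no_int_root w by simp
  qed
  then obtain g0 where g0: "g0 \<in> carrier G" "g0 w \<noteq> w" by blast
  have trans: "\<exists>g\<in>carrier G. g w = a" if a: "a \<in> roots" for a
  proof (cases "a = w")
    case True then show ?thesis using G_one[OF wL] one_closed by blast
  next
    case False
    obtain h where h: "h \<in> carrier G" "h (g0 w) = a"
      using st[of "g0 w" a] G_roots[OF g0(1) w] g0(2) a False by blast
    then show ?thesis using G_mult[OF h(1) g0(1) wL] m_closed[OF h(1) g0(1)] by auto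
  qed
  obtain k where k: "k \<in> carrier G" "k w = x" using trans xy(1) by blast
  obtain k' where k': "k' \<in> carrier G" "k' w = x'" using trans xy'(1) by blast
  have L: "x \<in> L" "y \<in> L" "x' \<in> L" "y' \<in> L" using xy xy' roots_L by auto
  let ?u = "(inv\<^bsub>G\<^esub> k) y" and ?u' = "(inv\<^bsub>G\<^esub> k') y'"
  have u: "?u \<in> roots - {w}" "?u' \<in> roots - {w}"
    using G_roots[OF inv_closed[OF k(1)] xy(2)] G_roots[OF inv_closed[OF k'(1)] xy'(2)]
      G_inv(2)[OF k(1) L(2)] G_inv(2)[OF k'(1) L(4)] k(2) k'(2) xy(3) xy'(3) by auto
  obtain h where h: "h \<in> carrier G" "h ?u = ?u'" "h w = w" using st[OF u] by blast
  let ?g = "k' \<otimes>\<^bsub>G\<^esub> (h \<otimes>\<^bsub>G\<^esub> inv\<^bsub>G\<^esub> k)"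
  have "?g z = k' (h ((inv\<^bsub>G\<^esub> k) z))" if "z \<in> L" for z
    using that k(1) k'(1) h(1) by (simp add: G_mult)
  then have "?g x = x'" "?g y = y'"
    using L G_inv(1)[OF k(1) wL] k(2) h k'(2) G_inv(2)[OF k'(1) L(4)] by simp_all
  then show ?thesis using k(1) k'(1) h(1) by (intro bexI[of _ ?g]) auto
qed

theorem perm_iso: "perm \<in> iso G (alt_group n)"
proof -
  interpret h: group_hom G "alt_group n" perm
    by (intro group_hom.intro group_hom_axioms.intro is_group alt_group_is_group perm_hom)
  have H: "subgroup (perm ` carrier G) (alt_group n)" by (rule h.img_is_subgroup)
  obtain u v w g where uvw: "distinct [u, v, w]" "{u, v, w} \<subseteq> {1..n}" "g \<in> carrier G" "perm g = cycle_of_list [u, v, w]"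
    using ex_three_cycle by blast
  have "perm ` carrier G = carrier (alt_group n)"
  proof (rule eq_alt_groupI_two_transitive[OF H _ uvw(1,2)])
    show "cycle_of_list [u, v, w] \<in> perm ` carrier G" using uvw(3,4) by (metis imageI)
    fix a b a' b' assume ab: "a \<in> {1..n}" "b \<in> {1..n}" "a \<noteq> b" "a' \<in> {1..n}" "b' \<in> {1..n}" "a' \<noteq> b'"
    have ne: "e a \<noteq> e b" "e a' \<noteq> e b'" using e_inj ab by simp_all
    obtain g where g: "g \<in> carrier G" "g (e a) = e a'" "g (e b) = e b'"
      using two_transitive[OF e_roots[OF ab(1)] e_roots[OF ab(2)] ne(1) e_roots[OF ab(4)] e_roots[OF ab(5)] ne(2)] by blast
    then have "perm g a = a'" "perm g b = b'" using perm_eqI ab by blast+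
    then show "\<exists>h\<in>perm ` carrier G. h a = a' \<and> h b = b'" using g(1) by blast
  qed
  then show ?thesis using perm_hom perm_inj by (simp add: iso_def bij_betw_def)
qed

end

subsection \<open>Infinitely many pairs\<close>

text \<open>The witness weights the residue v by the Bezout multiple of \<open>a\<close> and the
  residue u by that of b.\<close>

lemma ex_crt_int:
  fixes a b :: int
  assumes "coprime a b"
  shows "\<exists>x. a dvd x - u \<and> b dvd x - v"
proof -
  obtain s t where st: "s * a + t * b = 1" using bezout_int[of a b] assms by (auto simp: coprime_iff_gcd_eq_1)
  have "v * s * a + u * t * b - u = v * s * a + u * (t * b - 1)" by (simp add: algebra_simps)
  also have "t * b - 1 = - (s * a)" using st by simp
  also have "v * s * a + u * - (s * a) = a * (v * s - u * s)" by (simp add: algebra_simps)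
  finally have "a dvd v * s * a + u * t * b - u" by simp
  moreover have "v * s * a + u * t * b - v = v * (s * a - 1) + u * t * b" by (simp add: algebra_simps)
  then have "v * s * a + u * t * b - v = b * (u * t - v * t)" using st by (simp add: algebra_simps flip: st)
  then have "b dvd v * s * a + u * t * b - v" by simp
  ultimately show ?thesis by blast
qed

lemma ex_alt_poly:
  assumes p: "Factorial_Ring.prime p" "p > 2"
  shows "\<exists>j c c\<^sub>2 c\<^sub>p q c\<^sub>q. alt_poly j p c c\<^sub>2 c\<^sub>p q c\<^sub>q"
proof -
  have "odd p" using p prime_odd_nat by blast
  then obtain m where m: "p = 2 * m + 1" by (elim oddE)
  obtain i where i: "m = Suc i" using m p(2) by (cases m) auto
  \<comment> \<open>This solves 2j + 3 = p^2 for p = 2i + 3, and it is odd.\<close>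
  define j where "j = 2 * i ^ 2 + 6 * i + 3"
  have n: "2 * j + 3 = p ^ 2" by (simp add: j_def m i power2_eq_square algebra_simps)
  have j: "odd j" by (simp add: j_def)
  define b where "b = (2 * j + 1) * (j + 1)"
  \<comment> \<open>A prime beyond p^2 b divides neither n nor beta; it also differs from 2 and
    p.\<close>
  obtain q where q: "Factorial_Ring.prime q" "q > p ^ 2 * b" using bigger_prime by blast
  have pos: "p ^ 2 > 0" "b > 0" using p(2) by (simp_all add: b_def)
  have ndvd: "\<not> q dvd k" if "0 < k" "k dvd p ^ 2 * b" for k
  proof
    assume "q dvd k"
    then have "q dvd p ^ 2 * b" using that(2) dvd_trans by blast
    moreover have "0 < p ^ 2 * b" using pos by simp
    ultimately have "q \<le> p ^ 2 * b" by (rule dvd_imp_le)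
    then show False using q(2) by simp
  qed
  have qn: "\<not> q dvd p ^ 2" and qb: "\<not> q dvd b" using ndvd pos by simp_all
  have "q \<noteq> 2"
  proof -
    have "2 * 2 \<le> p * p" using p(2) by (intro mult_le_mono) simp_all
    moreover have "1 \<le> b" using pos by simp
    ultimately have "4 * 1 \<le> p ^ 2 * b" unfolding power2_eq_square by (intro mult_le_mono) simp_all
    then show ?thesis using q(2) by simp
  qed
  moreover have "q \<noteq> p" using qn by auto
  ultimately have "coprime 2 p" "coprime 2 q" "coprime p q"
    using p q(1) primes_coprime[of 2 p] primes_coprime[of 2 q] primes_coprime[of p q] by auto
  then have "coprime (int 2) (int p)" "coprime (int 2) (int q)" "coprime (int p) (int q)"
    by (simp_all only: coprime_int_iff)
  then have co: "coprime (int 2 ^ 2) (int p ^ 2)" "coprime (int 2 ^ 2 * int p ^ 2) (int q ^ 2)"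
    by (auto simp only: coprime_power_left_iff coprime_power_right_iff coprime_mult_left_iff)
  \<comment> \<open>The target is c congruent to 2 modulo 4, to p modulo p^2 and to q - b^(2j + 2)
    modulo q^2. Working modulo squares makes each of 2, p, q divide its value exactly once.\<close>
  obtain d where d: "int 2 ^ 2 dvd d - 2" "int p ^ 2 dvd d - int p" using ex_crt_int[OF co(1)] by blast
  obtain c where c: "int 2 ^ 2 * int p ^ 2 dvd c - d" "int q ^ 2 dvd c - (int q - int b ^ (2 * j + 2))"
    using ex_crt_int[OF co(2)] by blast
  have cd: "int 2 ^ 2 dvd c - d" "int p ^ 2 dvd c - d" using c(1) by (auto elim: dvd_mult_left dvd_mult_right)
  have "int 2 ^ 2 dvd c - 2" "int p ^ 2 dvd c - int p"
    using dvd_add[OF cd(1) d(1)] dvd_add[OF cd(2) d(2)] by simp_all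
  then obtain k l where k: "c - 2 = int 2 ^ 2 * k" and l: "c - int p = int p ^ 2 * l" by (auto elim!: dvdE)
  obtain t where t: "c - (int q - int b ^ (2 * j + 2)) = int q ^ 2 * t" using c(2) by (elim dvdE)
  have nd: "\<not> int r dvd 1 + int r * s" if "Factorial_Ring.prime r" for r s
    using that by (simp add: dvd_add_left_iff prime_nat_iff)
  have "alt_poly j p c (1 + 2 * k) (1 + int p * l) (int q) (1 + int q * t)"
  proof (rule alt_poly.intro)
    show "c = 2 * (1 + 2 * k)" "odd (1 + 2 * k)" using k by simp_all
    show "c = int p * (1 + int p * l)" using l by (simp add: power2_eq_square algebra_simps)
    have "int b ^ (2 * j + 2) + c = int q * (1 + int q * t)"
      using t by (simp add: power2_eq_square algebra_simps)
    then show "int ((2 * j + 1) * (j + 1)) ^ (2 * j + 2) + c = int q * (1 + int q * t)" unfolding b_def .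
    show "\<not> int q dvd int (2 * j + 3)" using qn unfolding n by (simp only: int_dvd_int_iff not_False_eq_True)
    show "\<not> int q dvd int ((2 * j + 1) * (j + 1))" using qb unfolding b_def by (simp only: int_dvd_int_iff not_False_eq_True)
  qed (use n p(1) j q(1) nd in auto)
  then show ?thesis by blast
qed

lemma alt_group_simple: "n \<ge> 9 \<Longrightarrow> simple_group (alt_group n)"
proof -
  assume n: "n \<ge> 9"
  interpret group "alt_group n" by (rule alt_group_is_group)
  show ?thesis
  proof
    have "(fact 3 :: nat) \<le> fact n" using n by (intro fact_mono) simp
    then have "6 \<le> (fact n :: nat)" by (simp add: numeral_3_eq_3)
    then show "Coset.order (alt_group n) > 1" using alt_group_card_carrier[of n] n by (simp add: Coset.order_def)
    fix N assume "N \<lhd> alt_group n"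
    then show "N = carrier (alt_group n) \<or> N = {\<one>\<^bsub>alt_group n\<^esub>}"
      using alt_group_normal_trivial[OF n] by (auto simp: alt_group_one)
  qed
qed

lemma ex_pair_alt_group:
  assumes p: "Factorial_Ring.prime p" "p > 2"
    and H: "group H" and tw: "twin_homs H (alt_group (p ^ 2)) r s"
  shows "\<exists>K\<^sub>1 K\<^sub>2 L. solvably_equivalent_fields K\<^sub>1 K\<^sub>2 \<and> \<not> fields_isomorphic K\<^sub>1 K\<^sub>2 \<and>
    is_galois_closure K\<^sub>1 L \<and> Gal L \<rat> \<cong> alt_group (p ^ 2)"
proof -
  obtain j c c\<^sub>2 c\<^sub>p q c\<^sub>q where ap: "alt_poly j p c c\<^sub>2 c\<^sub>p q c\<^sub>q" using ex_alt_poly[OF p] by blast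
  interpret A: alt_poly j p c c\<^sub>2 c\<^sub>p q c\<^sub>q by (rule ap)
  obtain a where a: "algebraic_rat a" "A.roots \<subseteq> Qadj a" and fg: "finite_galois_over_rat (Qadj a)"
    and triv: "\<And>g. g \<in> carrier (Gal (Qadj a) \<rat>) \<Longrightarrow> (\<And>z. z \<in> A.roots \<Longrightarrow> g z = z) \<Longrightarrow> g = \<one>\<^bsub>Gal (Qadj a) \<rat>\<^esub>"
    and gen: "\<And>g. g \<in> carrier (Gal (Qadj a) \<rat>) \<Longrightarrow> g a = a \<Longrightarrow> g = \<one>\<^bsub>Gal (Qadj a) \<rat>\<^esub>"
    using splitting_field[OF A.finite_roots A.roots_algebraic_int A.roots_rpoly] by blast
  interpret F: finite_galois_over_rat "Qadj a" by (rule fg)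
  interpret AG: alt_poly_galois j p c c\<^sub>2 c\<^sub>p q c\<^sub>q "Qadj a"
    by unfold_locales (use a(2) triv in blast)+
  have aL: "a \<in> Qadj a" by (rule Qadj_base(1))
  interpret gen: generated_galois "Qadj a" a
    by unfold_locales (use aL gen Qadj_finite_dimension[OF a(1)] in blast)+
  have iso: "AG.perm \<in> iso (Gal (Qadj a) \<rat>) (alt_group (p ^ 2))" using AG.perm_iso A.n_sq by simp
  then have inv: "inv_into (carrier (Gal (Qadj a) \<rat>)) AG.perm \<in> iso (alt_group (p ^ 2)) (Gal (Qadj a) \<rat>)"
    by (rule F.iso_set_sym)
  have "3 * 3 \<le> p * p" using p(2) by (intro mult_le_mono) simp_all
  then have "p ^ 2 \<ge> 9" by (simp add: power2_eq_square)
  then have "simple_group (Gal (Qadj a) \<rat>)"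
    using simple_group.iso_simple[OF alt_group_simple F.is_group inv] by blast
  then have "\<exists>K\<^sub>1 K\<^sub>2. solvably_equivalent_fields K\<^sub>1 K\<^sub>2 \<and> \<not> fields_isomorphic K\<^sub>1 K\<^sub>2 \<and> is_galois_closure K\<^sub>1 (Qadj a)"
    using gen.ex_solvably_equivalent_pair[OF _ H twin_homs_compose_iso[OF tw inv H alt_group_is_group F.is_group]]
      simple_group.no_real_normal_subgroup by blast
  then show ?thesis using iso unfolding is_iso_def by blast
qed

text \<open>The unsolvable group is the alternating group on five points throughout. The bound gives
  p^2 points room for two copies of all words.\<close>

lemma ex_pairs_alt_group:
  "\<exists>b. \<forall>p. Factorial_Ring.prime p \<and> b < p \<longrightarrow> 2 < p \<and> (\<exists>K\<^sub>1 K\<^sub>2 L. solvably_equivalent_fields K\<^sub>1 K\<^sub>2 \<and>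
    \<not> fields_isomorphic K\<^sub>1 K\<^sub>2 \<and> is_galois_closure K\<^sub>1 L \<and> Gal L \<rat> \<cong> alt_group (p ^ 2))"
proof -
  have fin: "finite (carrier (alt_group 5))"
    using alt_group_card_carrier[of 5] card_ge_0_finite[of "carrier (alt_group 5)"] by (simp add: fact_numeral)
  interpret H: unsolvable_finite_group "alt_group 5"
    by (intro unsolvable_finite_group.intro unsolvable_finite_group_axioms.intro alt_group_is_group fin
      alt_group_is_unsolvable) simp
  have "2 < p \<and> (\<exists>K\<^sub>1 K\<^sub>2 L. solvably_equivalent_fields K\<^sub>1 K\<^sub>2 \<and>
    \<not> fields_isomorphic K\<^sub>1 K\<^sub>2 \<and> is_galois_closure K\<^sub>1 L \<and> Gal L \<rat> \<cong> alt_group (p ^ 2))"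
    if p: "Factorial_Ring.prime p" and gt: "max 2 (2 * card H.words) < p" for p
  proof
    show p2: "2 < p" using gt by simp
    have "p \<le> p ^ 2" by (simp add: power2_eq_square)
    then have "2 * card H.words \<le> p ^ 2" using gt by simp
    then obtain r s where "twin_homs (alt_group 5) (alt_group (p ^ 2)) r s" using H.ex_twin_homs_alt_group by blast
    then show "\<exists>K\<^sub>1 K\<^sub>2 L. solvably_equivalent_fields K\<^sub>1 K\<^sub>2 \<and>
        \<not> fields_isomorphic K\<^sub>1 K\<^sub>2 \<and> is_galois_closure K\<^sub>1 L \<and> Gal L \<rat> \<cong> alt_group (p ^ 2)"
      using ex_pair_alt_group[OF p p2 alt_group_is_group] by blast
  qed
  then show ?thesis by (intro exI[of _ "max 2 (2 * card H.words)"]) blast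
qed

text \<open>The only nontrivial quotient of a simple group is by the trivial subgroup and has the
  order of the group itself.\<close>

lemma simple_groups_common_quotient:
  assumes G: "simple_group G" and H: "simple_group H" and quot: "common_nontrivial_quotient G H"
  shows "card (carrier G) = card (carrier H)"
proof -
  obtain M N where M: "M \<lhd> G" and N: "N \<lhd> H" and iso: "G Mod M \<cong> H Mod N"
    and nontriv: "carrier (G Mod M) \<noteq> {\<one>\<^bsub>G Mod M\<^esub>}"
    using quot unfolding common_nontrivial_quotient_def by blast
  have card: "card (carrier (K Mod L)) = card (carrier K) \<or> card (carrier (K Mod L)) = 1"
    if K: "simple_group K" and L: "L \<lhd> K" for K :: "('x, 'y) monoid_scheme" and L
  proof -
    interpret K: simple_group K by (rule K)
    have lagr: "card (rcosets\<^bsub>K\<^esub> L) * card L = card (carrier K)"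
      using K.lagrange[OF normal_imp_subgroup[OF L]] by (simp add: Coset.order_def)
    have "card (carrier K) > 1" using K.order_gt_one by (simp add: Coset.order_def)
    then show ?thesis using K.no_real_normal_subgroup[OF L] lagr by (auto simp: FactGroup_def)
  qed
  have "card (carrier (G Mod M)) \<noteq> 1"
  proof
    assume "card (carrier (G Mod M)) = 1"
    then obtain x where "carrier (G Mod M) = {x}" by (auto simp: card_1_singleton_iff)
    moreover have "\<one>\<^bsub>G Mod M\<^esub> \<in> carrier (G Mod M)"
      using normal.factorgroup_is_group[OF M] group.is_monoid monoid.one_closed by blast
    ultimately show False using nontriv by auto
  qed
  then show ?thesis using card[OF G M] card[OF H N] iso_same_card[OF iso] by simp
qed

lemma galois_closure_unique: "is_galois_closure K L \<Longrightarrow> is_galois_closure K L' \<Longrightarrow> L = L'"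
  unfolding is_galois_closure_def by blast

theorem mainTheorem8:
  shows "\<exists>\<P> :: (complex set \<times> complex set) set.
    infinite \<P> \<and>
    (\<forall>(K\<^sub>1, K\<^sub>2) \<in> \<P>. solvably_equivalent_fields K\<^sub>1 K\<^sub>2 \<and> \<not> fields_isomorphic K\<^sub>1 K\<^sub>2) \<and>
    (\<forall>(K\<^sub>1, K\<^sub>2) \<in> \<P>. \<forall>(K\<^sub>1', K\<^sub>2') \<in> \<P>. (K\<^sub>1, K\<^sub>2) \<noteq> (K\<^sub>1', K\<^sub>2') \<longrightarrow>
      (\<forall>L L'. is_galois_closure K\<^sub>1 L \<and> is_galois_closure K\<^sub>2 L \<and>
              is_galois_closure K\<^sub>1' L' \<and> is_galois_closure K\<^sub>2' L' \<longrightarrow>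
        \<not> common_nontrivial_quotient (Gal L \<rat>) (Gal L' \<rat>)))"
proof -
  obtain b where b: "\<And>p. Factorial_Ring.prime p \<Longrightarrow> b < p \<Longrightarrow> 2 < p \<and> (\<exists>K\<^sub>1 K\<^sub>2 L.
      solvably_equivalent_fields K\<^sub>1 K\<^sub>2 \<and> \<not> fields_isomorphic K\<^sub>1 K\<^sub>2 \<and> is_galois_closure K\<^sub>1 L \<and>
      Gal L \<rat> \<cong> alt_group (p ^ 2))"
    using ex_pairs_alt_group by blast
  let ?S = "{p. Factorial_Ring.prime p \<and> b < p}"
  have "\<forall>p\<in>?S. \<exists>K\<^sub>1 K\<^sub>2 L. solvably_equivalent_fields K\<^sub>1 K\<^sub>2 \<and> \<not> fields_isomorphic K\<^sub>1 K\<^sub>2 \<and>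
      is_galois_closure K\<^sub>1 L \<and> Gal L \<rat> \<cong> alt_group (p ^ 2)"
    using b by blast
  then obtain k\<^sub>1 k\<^sub>2 l where kl: "\<And>p. p \<in> ?S \<Longrightarrow> solvably_equivalent_fields (k\<^sub>1 p) (k\<^sub>2 p) \<and>
      \<not> fields_isomorphic (k\<^sub>1 p) (k\<^sub>2 p) \<and> is_galois_closure (k\<^sub>1 p) (l p) \<and> Gal (l p) \<rat> \<cong> alt_group (p ^ 2)"
    unfolding bchoice_iff by blast
  have iso: "Gal L \<rat> \<cong> alt_group (p ^ 2)" if "p \<in> ?S" "is_galois_closure (k\<^sub>1 p) L" for p L
    using kl[OF that(1)] galois_closure_unique[OF that(2)] by blast
  \<comment> \<open>The order of the alternating group on p^2 points is half a factorial and
    determines p.\<close>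
  have card: "card (carrier (Gal L \<rat>)) = card (carrier (Gal L' \<rat>)) \<Longrightarrow> p = p'"
    if p: "p \<in> ?S" "is_galois_closure (k\<^sub>1 p) L" and p': "p' \<in> ?S" "is_galois_closure (k\<^sub>1 p') L'" for p p' L L'
  proof -
    assume eq: "card (carrier (Gal L \<rat>)) = card (carrier (Gal L' \<rat>))"
    have ge: "2 \<le> r ^ 2" if "r \<in> ?S" for r
    proof -
      have "2 < r" using b that by blast
      also have "r \<le> r ^ 2" by (simp add: power2_eq_square)
      finally show ?thesis by simp
    qed
    have "(fact (p ^ 2) :: nat) = fact (p' ^ 2)"
      using eq iso_same_card[OF iso[OF p]] iso_same_card[OF iso[OF p']]
        alt_group_card_carrier[OF ge[OF p(1)]] alt_group_card_carrier[OF ge[OF p'(1)]] by simp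
    moreover have "x = y" if "(fact x :: nat) = fact y" "2 \<le> x" "2 \<le> y" for x y
      using that fact_less_mono_nat[of x y] fact_less_mono_nat[of y x] by (cases x y rule: linorder_cases) simp_all
    ultimately have "p ^ 2 = p' ^ 2" using ge[OF p(1)] ge[OF p'(1)] by blast
    then show "p = p'" by (simp add: power2_eq_iff_nonneg)
  qed
  have simple: "simple_group (Gal L \<rat>)" if p: "p \<in> ?S" "is_galois_closure (k\<^sub>1 p) L" for p L
  proof -
    have "galois_extension \<rat> L" using p(2) by (simp add: is_galois_closure_def)
    then have Gal: "group (Gal L \<rat>)" by (intro group_Gal) (simp_all add: galois_extension_def)
    have "2 < p" using b p(1) by blast
    then have "3 * 3 \<le> p * p" by (intro mult_le_mono) simp_all
    then have "9 \<le> p ^ 2" by (simp add: power2_eq_square)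
    moreover obtain f where "f \<in> iso (alt_group (p ^ 2)) (Gal L \<rat>)"
      using group.iso_sym[OF Gal iso[OF p]] unfolding is_iso_def by blast
    ultimately show ?thesis using simple_group.iso_simple[OF alt_group_simple Gal] by blast
  qed
  \<comment> \<open>Equal pairs have the same Galois closure, and the order of its group determines
    p.\<close>
  have "inj_on (\<lambda>p. (k\<^sub>1 p, k\<^sub>2 p)) ?S"
  proof (rule inj_onI)
    fix p p' assume p: "p \<in> ?S" and p': "p' \<in> ?S" and eq: "(k\<^sub>1 p, k\<^sub>2 p) = (k\<^sub>1 p', k\<^sub>2 p')"
    have "is_galois_closure (k\<^sub>1 p) (l p)" using kl[OF p] by blast
    moreover from this have "is_galois_closure (k\<^sub>1 p') (l p)" using eq by simp
    ultimately show "p = p'" using card[OF p _ p' _ refl] by blast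
  qed
  moreover have "infinite ?S"
    unfolding infinite_nat_iff_unbounded
  proof
    fix m
    obtain q where "Factorial_Ring.prime q" "max b m < q" using bigger_prime by blast
    then show "\<exists>q>m. q \<in> ?S" by auto
  qed
  ultimately have "infinite ((\<lambda>p. (k\<^sub>1 p, k\<^sub>2 p)) ` ?S)" by (simp add: finite_image_iff)
  moreover have "\<forall>(K\<^sub>1, K\<^sub>2) \<in> (\<lambda>p. (k\<^sub>1 p, k\<^sub>2 p)) ` ?S. solvably_equivalent_fields K\<^sub>1 K\<^sub>2 \<and> \<not> fields_isomorphic K\<^sub>1 K\<^sub>2"
    using kl by auto
  moreover have "\<not> common_nontrivial_quotient (Gal L \<rat>) (Gal L' \<rat>)"
    if "p \<in> ?S" "p' \<in> ?S" "(k\<^sub>1 p, k\<^sub>2 p) \<noteq> (k\<^sub>1 p', k\<^sub>2 p')" "is_galois_closure (k\<^sub>1 p) L" "is_galois_closure (k\<^sub>1 p') L'"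
    for p p' L L'
    using simple_groups_common_quotient[OF simple[OF that(1,4)] simple[OF that(2,5)]] card[OF that(1,4,2,5)] that(3) by blast
  ultimately show ?thesis
    by (intro exI[of _ "(\<lambda>p. (k\<^sub>1 p, k\<^sub>2 p)) ` ?S"]) blast
qed

end
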